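(* Fix $\nu\in(-1/2,1)$ and let $\tau=\kappa(1-\nu)$ with $\kappa>0$. Suppose that the inflow boundary data $f_{LR}(v)=f_L(v)1_{v_1>0}+f_R(v)1_{v_1<0}\ge 0$ (not identically zero) satisfies $$f_{LR},\quad \frac{1}{|v_1|}f_{LR}\in L^1_2,$$ so that the quantities $a_u,a_\ell,a_s,c_u,c_\ell,c_s$ defined in the context are well-defined. Suppose further that $$\int_{\mathbb{R}^2}f_L\,v_i\,dv_2dv_3=\int_{\mathbb{R}^2}f_R\,v_i\,dv_2dv_3=0\qquad(i=2,3)$$ and that there exists a constant $\gamma_\ell>0$ such that $$\left(\int_{v_1>0}e^{-\frac{a_u}{\tau|v_1|}}f_L(v)|v_1|dv\right)\left(\int_{v_1<0}e^{-\frac{a_u}{\tau|v_1|}}f_R(v)|v_1|dv\right)>\gamma_\ell.$$ Then there exists a constant $K>0$, depending only on the quantities $a_u,a_\ell,a_s,c_u,c_\ell,c_s$ and $\gamma_\ell$ (for the fixed $\nu$), such that, if $\tau>K$, then there exists a unique mild solution $f\ge0$ of the boundary value problem $$v_1\frac{\partial f}{\partial x}=\frac{\rho}{\tau}\big(\mathcal{M}_\nu(f)-f\big)\ \text{ on }[0,1]\times\mathbb{R}^3,\qquad f(0,v)=f_L(v)\ (v_1>0),\quad f(1,v)=f_R(v)\ (v_1<0),$$ satisfying $$a_\ell\le\int_{\mathbb{R}^3}f(x,v)dv\le a_u,\qquad c_\ell\le\int_{\mathbb{R}^3}f(x,v)|v|^2dv\le c_u,$$ and $$\left(\int_{\mathbb{R}^3}f\,dv\right)\left(\int_{\mathbb{R}^3}f|v|^2dv\right)-\left(\int_{\mathbb{R}^3}f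 v_1dv\right)^2\ge\gamma_\ell.$$
   Context: $L^1_2$ denotes $L^1$ with weight $1+|v|^2$ in the velocity variable. $f_L$ is given for $v_1>0$ and $f_R$ for $v_1<0$. Macroscopic fields of $f=f(x,v)\ge0$, $x\in[0,1]$, $v=(v_1,v_2,v_3)\in\mathbb{R}^3$ (integrals over $\mathbb{R}^3$): $\rho=\rho_f(x)=\int f\,dv$, $\rho U=\int f v\,dv$, $3\rho T=\int f|v-U|^2dv$, $\rho\Theta=\int f (v-U)\otimes(v-U)dv$. Temperature tensor: $\mathcal{T}_\nu=(1-\nu)T\,Id+\nu\Theta$. Ellipsoidal Gaussian: $$\mathcal{M}_\nu(f)=\frac{\rho}{\sqrt{\det(2\pi\mathcal{T}_\nu)}}\exp\left(-\tfrac12 (v-U)^\top\mathcal{T}_\nu^{-1}(v-U)\right).$$ Quantities attached to the boundary data (integrals over $\mathbb{R}^3$): $a_u=2\int f_{LR}dv$, $a_\ell=\int e^{-\frac{a_u}{\tau|v_1|}}f_{LR}dv$, $a_s=\int\frac{1}{|v_1|}f_{LR}dv$, $c_u=2\int f_{LR}|v|^2dv$, $c_\ell=\int e^{-\frac{a_u}{\tau|v_1|}}f_{LR}|v|^2dv$, $c_s=\int\frac{1}{|v_1|}f_{LR}|v|^2dv$. Mild solution: $f\in L^1_2([0,1]_x\times\mathbb{R}^3_v)$ is a mild solution if for $v_1>0$ $$f(x,v)=e^{-\frac{1}{\tau|v_1|}\int_0^x\rho_f(y)dy}f_L(v)+\frac{1}{\tau|v_1|}\int_0^x e^{-\frac{1}{\tau|v_1|}\int_y^x\rho_f(z)dz}\rho_f(y)\mathcal{M}_\nu(f)(y,v)dy,$$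 and for $v_1<0$ $$f(x,v)=e^{-\frac{1}{\tau|v_1|}\int_x^1\rho_f(y)dy}f_R(v)+\frac{1}{\tau|v_1|}\int_x^1 e^{-\frac{1}{\tau|v_1|}\int_x^y\rho_f(z)dz}\rho_f(y)\mathcal{M}_\nu(f)(y,v)dy.$$ *)

theory Defs
  imports "HOL-Analysis.Analysis"
begin

type_synonym vel = "real ^ 3"

definition L12 :: "(vel \<Rightarrow> real) set" where
  "L12 = {g. integrable lborel (\<lambda>v. (1 + (norm v)\<^sup>2) * g v)}"


subsection \<open>Macroscopic fields and the ellipsoidal Gaussian\<close>

text \<open>
  All fields are functionals of a velocity distribution \<open>g\<close>; the fields of \<open>f\<close> at \<open>x\<close> are obtained
  with \<open>g = f x\<close>. They carry their usual meaning when \<open>g\<close> is in \<open>L12\<close> and has positive mass, and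
  the Gaussian does when moreover the temperature tensor is positive definite; otherwise the usual
  conventions for division by zero apply.
\<close>

definition density :: "(vel \<Rightarrow> real) \<Rightarrow> real" where
  "density g = (LINT v|lborel. g v)"

definition bulk :: "(vel \<Rightarrow> real) \<Rightarrow> vel" where
  "bulk g = (1 / density g) *\<^sub>R (LINT v|lborel. g v *\<^sub>R v)"

definition temperature :: "(vel \<Rightarrow> real) \<Rightarrow> real" where
  "temperature g = (LINT v|lborel. g v * (norm (v - bulk g))\<^sup>2) / (3 * density g)"

definition stress :: "(vel \<Rightarrow> real) \<Rightarrow> real ^ 3 ^ 3" where
  "stress g = (\<chi> i j. (LINT v|lborel. g v * ((v - bulk g) $ i * (v - bulk g) $ j)) / density g)"

definition temperature_tensor :: "real \<Rightarrow> (vel \<Rightarrow> real) \<Rightarrow> real ^ 3 ^ 3" where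
  "temperature_tensor \<nu> g = ((1 - \<nu>) * temperature g) *\<^sub>R mat 1 + \<nu> *\<^sub>R stress g"

definition gaussian :: "real \<Rightarrow> (vel \<Rightarrow> real) \<Rightarrow> vel \<Rightarrow> real" where
  "gaussian \<nu> g v =
     density g / sqrt (det ((2 * pi) *\<^sub>R temperature_tensor \<nu> g)) *
     exp (- (1 / 2) * ((v - bulk g) \<bullet> (matrix_inv (temperature_tensor \<nu> g) *v (v - bulk g))))"


subsection \<open>Inflow data\<close>

text \<open>Only the values of \<open>fL\<close> at \<open>v $ 1 > 0\<close> and of \<open>fR\<close> at \<open>v $ 1 < 0\<close> are ever used.\<close>

definition inflow :: "(vel \<Rightarrow> real) \<Rightarrow> (vel \<Rightarrow> real) \<Rightarrow> vel \<Rightarrow> real" where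
  "inflow fL fR v = fL v * indicator {w. w $ 1 > 0} v + fR v * indicator {w. w $ 1 < 0} v"

text \<open>In the following, \<open>g\<close> stands for \<open>inflow fL fR\<close>, which vanishes where \<open>v $ 1 = 0\<close>.\<close>

definition a_u :: "(vel \<Rightarrow> real) \<Rightarrow> real" where
  "a_u g = 2 * (LINT v|lborel. g v)"

definition a_l :: "real \<Rightarrow> (vel \<Rightarrow> real) \<Rightarrow> real" where
  "a_l \<tau> g = (LINT v|lborel. exp (- (a_u g / (\<tau> * \<bar>v $ 1\<bar>))) * g v)"

definition a_s :: "(vel \<Rightarrow> real) \<Rightarrow> real" where
  "a_s g = (LINT v|lborel. 1 / \<bar>v $ 1\<bar> * g v)"

definition c_u :: "(vel \<Rightarrow> real) \<Rightarrow> real" where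
  "c_u g = 2 * (LINT v|lborel. g v * (norm v)\<^sup>2)"

definition c_l :: "real \<Rightarrow> (vel \<Rightarrow> real) \<Rightarrow> real" where
  "c_l \<tau> g = (LINT v|lborel. exp (- (a_u g / (\<tau> * \<bar>v $ 1\<bar>))) * g v * (norm v)\<^sup>2)"

definition c_s :: "(vel \<Rightarrow> real) \<Rightarrow> real" where
  "c_s g = (LINT v|lborel. 1 / \<bar>v $ 1\<bar> * g v * (norm v)\<^sup>2)"

text \<open>The integral of \<open>g v * v $ i\<close> over the last two velocity components, at fixed \<open>v $ 1 = s\<close>.\<close>

definition slice_moment :: "(vel \<Rightarrow> real) \<Rightarrow> 3 \<Rightarrow> real \<Rightarrow> real" where
  "slice_moment g i s =
     (LINT w|(lborel :: (real \<times> real) measure).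
        g (vector [s, fst w, snd w]) * (vector [s, fst w, snd w] :: vel) $ i)"


subsection \<open>Mild solutions\<close>

definition damping :: "real \<Rightarrow> (real \<Rightarrow> vel \<Rightarrow> real) \<Rightarrow> vel \<Rightarrow> real \<Rightarrow> real \<Rightarrow> real" where
  "damping \<tau> f v a b = exp (- (1 / (\<tau> * \<bar>v $ 1\<bar>)) * (LINT y:{a..b}|lborel. density (f y)))"

text \<open>
  Identities between velocity distributions hold for every \<open>x\<close> in \<open>[0,1]\<close> and almost every \<open>v\<close>; in
  particular the boundary values are attained at \<open>x = 0\<close> and \<open>x = 1\<close>. Because the Lebesgue integral
  of a non-integrable function is 0 by convention, the existence of the integrals involved is
  required explicitly.
\<close>

definition mild_solution ::
  "real \<Rightarrow> real \<Rightarrow> (vel \<Rightarrow> real) \<Rightarrow> (vel \<Rightarrow> real) \<Rightarrow> (real \<Rightarrow> vel \<Rightarrow> real) \<Rightarrow> bool" where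
  "mild_solution \<nu> \<tau> fL fR f \<longleftrightarrow>
     set_integrable (lborel :: (real \<times> vel) measure) ({0..1} \<times> UNIV)
       (\<lambda>(x, v). (1 + (norm v)\<^sup>2) * f x v) \<and>
     (\<forall>x\<in>{0..1}. f x \<in> L12) \<and>
     (\<forall>x\<in>{0..1}. AE v in lborel.
        (v $ 1 > 0 \<longrightarrow>
           set_integrable lborel {0..x}
             (\<lambda>y. damping \<tau> f v y x * density (f y) * gaussian \<nu> (f y) v) \<and>
           f x v = damping \<tau> f v 0 x * fL v + 1 / (\<tau> * \<bar>v $ 1\<bar>) *
             (LINT y:{0..x}|lborel. damping \<tau> f v y x * density (f y) * gaussian \<nu> (f y) v)) \<and>
        (v $ 1 < 0 \<longrightarrow>
           set_integrable lborel {x..1}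
             (\<lambda>y. damping \<tau> f v x y * density (f y) * gaussian \<nu> (f y) v) \<and>
           f x v = damping \<tau> f v x 1 * fR v + 1 / (\<tau> * \<bar>v $ 1\<bar>) *
             (LINT y:{x..1}|lborel. damping \<tau> f v x y * density (f y) * gaussian \<nu> (f y) v)))"

definition satisfies_bounds ::
  "real \<Rightarrow> (vel \<Rightarrow> real) \<Rightarrow> real \<Rightarrow> (real \<Rightarrow> vel \<Rightarrow> real) \<Rightarrow> bool" where
  "satisfies_bounds \<tau> g \<gamma> f \<longleftrightarrow>
     (\<forall>x\<in>{0..1}.
        a_l \<tau> g \<le> (LINT v|lborel. f x v) \<and>
        (LINT v|lborel. f x v) \<le> a_u g \<and>
        c_l \<tau> g \<le> (LINT v|lborel. f x v * (norm v)\<^sup>2) \<and>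
        (LINT v|lborel. f x v * (norm v)\<^sup>2) \<le> c_u g \<and>
        (LINT v|lborel. f x v) * (LINT v|lborel. f x v * (norm v)\<^sup>2)
          - (LINT v|lborel. f x v * v $ 1)\<^sup>2 \<ge> \<gamma>)"

end

theory Submission
  imports Defs "HOL-Probability.Distributions"
begin

text \<open>
  The Gaussian sees a distribution only through its moments \<open>m = (\<rho>, \<rho>U, \<integral> f v v\<^sup>T)\<close>, so a mild
  solution is determined by the profile \<open>x \<mapsto> m x\<close>, which is a fixed point of the map taking \<open>m\<close> to
  the moments of the transport formula with coefficients frozen at \<open>m\<close>. On the moments with
  \<open>a\<^sub>l \<le> \<rho> \<le> a\<^sub>u\<close>, bounded norm and tensor bounded below by \<open>\<alpha> > 0\<close>, the Gaussian is dominated by a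
  fixed Gaussian weight and Lipschitz in \<open>m\<close>. The map is then a contraction for large \<open>\<tau>\<close>: the loss
  term contributes \<open>O(1/\<tau>)\<close>, and the gain term is weighted by \<open>min (1/a) (1/(\<tau>\<bar>v\<^sub>1\<bar>))\<close>, which tends
  to \<open>0\<close> by dominated convergence.

  The temperature is bounded below because every mild solution dominates the attenuated inflow data:
  Cauchy--Schwarz for \<open>\<bar>v\<^sub>1\<bar>\<close> bounds \<open>\<rho> \<integral> f v\<^sub>1\<^sup>2 - (\<integral> f v\<^sub>1)\<^sup>2\<close> by four times the product of
  the two half-space fluxes, hence by \<open>4\<gamma>\<close>. Uniqueness follows since the profile of any other
  solution satisfies the same bounds and is a fixed point too.
\<close>

section \<open>Bounded Lipschitz functions with weights\<close>

text \<open>Two circularities shape the argument. For uniqueness, a competing solution has to be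
  shown admissible, which rests on a nonnegative gain term, which in turn needs a positive
  temperature; a merely qualitative positivity (no distribution with a density sits on one point)
  breaks this loop. The analytic obstacle is at \<open>v $ 1 = 0\<close>:
  \<open>1 / \<bar>v $ 1\<bar>\<close> is not integrable against a Gaussian, so the gain and its
  variation must keep the exponential decay of the attenuation. Varying the attenuation costs a
  factor slowness times distance, paid for with half of the decay; hence the rate
  \<open>al / 2\<close>. The factor 2 in \<open>a_u\<close> and \<open>c_u\<close> is the room for
  the gain: the inflow takes one half, the gain at most the other.\<close>

text \<open>One constant serves for the bound and for the Lipschitz estimate, uniformly in the
  parameter \<open>x\<close>, while the growth in \<open>b\<close> is carried by \<open>w\<close>.
  Under products the weights multiply, so the estimates for the Gaussian can be assembled along its
  formula without differentiating in the moments.\<close>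

definition bounded_lipschitz :: "'a::metric_space set \<Rightarrow> ('b \<Rightarrow> real) \<Rightarrow> ('a \<Rightarrow> 'b \<Rightarrow> real) \<Rightarrow> bool" where
  "bounded_lipschitz X w f \<longleftrightarrow> (\<exists>C\<ge>0. \<forall>b. \<forall>x\<in>X. \<bar>f x b\<bar> \<le> C * w b \<and>
     (\<forall>y\<in>X. \<bar>f x b - f y b\<bar> \<le> C * w b * dist x y))"

lemma bounded_lipschitzI:
  assumes "0 \<le> C" "0 \<le> D" "\<And>b. 0 \<le> w b"
    and "\<And>x b. x \<in> X \<Longrightarrow> \<bar>f x b\<bar> \<le> C * w b"
    and "\<And>x y b. x \<in> X \<Longrightarrow> y \<in> X \<Longrightarrow> \<bar>f x b - f y b\<bar> \<le> D * w b * dist x y"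
  shows "bounded_lipschitz X w f"
  unfolding bounded_lipschitz_def
proof (intro exI[of _ "C + D"] conjI allI ballI)
  show "0 \<le> C + D" using assms by simp
  fix b x assume x: "x \<in> X"
  have "0 \<le> D * w b" using assms by simp
  then show "\<bar>f x b\<bar> \<le> (C + D) * w b" using assms(4)[OF x, of b] by (simp add: algebra_simps)
  fix y assume y: "y \<in> X"
  have "0 \<le> C * w b * dist x y" using assms by simp
  then show "\<bar>f x b - f y b\<bar> \<le> (C + D) * w b * dist x y"
    using assms(5)[OF x y, of b] by (simp add: algebra_simps)
qed

lemma bounded_lipschitz_number:
  "bounded_lipschitz X (\<lambda>b. 1) (\<lambda>x b. k)"
  by (intro bounded_lipschitzI[of "\<bar>k\<bar>" 0]) auto

lemma bounded_lipschitz_add: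
  assumes "\<And>b. 0 \<le> w b" "bounded_lipschitz X w f" "bounded_lipschitz X w g"
  shows "bounded_lipschitz X w (\<lambda>x b. f x b + g x b)"
proof -
  obtain C where C: "0 \<le> C" "\<And>b x. x \<in> X \<Longrightarrow> \<bar>f x b\<bar> \<le> C * w b"
    "\<And>b x y. x \<in> X \<Longrightarrow> y \<in> X \<Longrightarrow> \<bar>f x b - f y b\<bar> \<le> C * w b * dist x y"
    using assms(2) unfolding bounded_lipschitz_def by blast
  obtain D where D: "0 \<le> D" "\<And>b x. x \<in> X \<Longrightarrow> \<bar>g x b\<bar> \<le> D * w b"
    "\<And>b x y. x \<in> X \<Longrightarrow> y \<in> X \<Longrightarrow> \<bar>g x b - g y b\<bar> \<le> D * w b * dist x y"
    using assms(3) unfolding bounded_lipschitz_def by blast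
  show ?thesis
  proof (rule bounded_lipschitzI[of "C + D" "C + D"])
    fix x y b assume xy: "x \<in> X" "y \<in> X"
    show "\<bar>f x b + g x b - (f y b + g y b)\<bar> \<le> (C + D) * w b * dist x y"
      using C(3)[OF xy, of b] D(3)[OF xy, of b] by (simp add: algebra_simps)
  next
    fix x b assume x: "x \<in> X"
    show "\<bar>f x b + g x b\<bar> \<le> (C + D) * w b"
      using C(2)[OF x, of b] D(2)[OF x, of b] by (simp add: algebra_simps)
  qed (use C D assms in auto)
qed

lemma bounded_lipschitz_mult:
  assumes "\<And>b. 0 \<le> w b" "\<And>b. 0 \<le> u b"
    "bounded_lipschitz X w f" "bounded_lipschitz X u g"
  shows "bounded_lipschitz X (\<lambda>b. w b * u b) (\<lambda>x b. f x b * g x b)"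
proof -
  obtain C where C: "0 \<le> C" "\<And>b x. x \<in> X \<Longrightarrow> \<bar>f x b\<bar> \<le> C * w b"
    "\<And>b x y. x \<in> X \<Longrightarrow> y \<in> X \<Longrightarrow> \<bar>f x b - f y b\<bar> \<le> C * w b * dist x y"
    using assms(3) unfolding bounded_lipschitz_def by blast
  obtain D where D: "0 \<le> D" "\<And>b x. x \<in> X \<Longrightarrow> \<bar>g x b\<bar> \<le> D * u b"
    "\<And>b x y. x \<in> X \<Longrightarrow> y \<in> X \<Longrightarrow> \<bar>g x b - g y b\<bar> \<le> D * u b * dist x y"
    using assms(4) unfolding bounded_lipschitz_def by blast
  show ?thesis
  proof (rule bounded_lipschitzI[of "C * D" "2 * (C * D)"])
    fix x y b assume xy: "x \<in> X" "y \<in> X"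
    have "f x b * g x b - f y b * g y b = f x b * (g x b - g y b) + (f x b - f y b) * g y b"
      by (simp add: algebra_simps)
    also have "\<bar>\<dots>\<bar> \<le> \<bar>f x b\<bar> * \<bar>g x b - g y b\<bar> + \<bar>f x b - f y b\<bar> * \<bar>g y b\<bar>"
      by (simp add: abs_mult[symmetric])
    also have "\<dots> \<le> (C * w b) * (D * u b * dist x y) + (C * w b * dist x y) * (D * u b)"
      using C D assms(1,2) xy by (intro add_mono mult_mono) auto
    finally show "\<bar>f x b * g x b - f y b * g y b\<bar> \<le> 2 * (C * D) * (w b * u b) * dist x y"
      by (simp add: algebra_simps)
  next
    fix x b assume x: "x \<in> X"
    have "\<bar>f x b\<bar> * \<bar>g x b\<bar> \<le> (C * w b) * (D * u b)"
      using C D assms(1,2) x by (intro mult_mono) auto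
    then show "\<bar>f x b * g x b\<bar> \<le> C * D * (w b * u b)"
      by (simp add: abs_mult algebra_simps)
  qed (use C D assms in auto)
qed

lemma bounded_lipschitz_mult_1:
  assumes "bounded_lipschitz X (\<lambda>b. 1) f" "bounded_lipschitz X (\<lambda>b. 1) g"
  shows "bounded_lipschitz X (\<lambda>b. 1) (\<lambda>x b. f x b * g x b)"
  using bounded_lipschitz_mult[OF _ _ assms] by simp

lemma bounded_lipschitz_add_1:
  assumes "bounded_lipschitz X (\<lambda>b. 1) f" "bounded_lipschitz X (\<lambda>b. 1) g"
  shows "bounded_lipschitz X (\<lambda>b. 1) (\<lambda>x b. f x b + g x b)"
  using bounded_lipschitz_add[OF _ assms] by simp

lemma bounded_lipschitz_diff_1:
  assumes "bounded_lipschitz X (\<lambda>b. 1) f" "bounded_lipschitz X (\<lambda>b. 1) g"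
  shows "bounded_lipschitz X (\<lambda>b. 1) (\<lambda>x b. f x b - g x b)"
  using bounded_lipschitz_add_1[OF assms(1)
      bounded_lipschitz_mult_1[OF bounded_lipschitz_number[of X "-1"] assms(2)]] by simp

lemma bounded_lipschitz_inverse:
  assumes "0 < \<delta>" "\<And>x b. x \<in> X \<Longrightarrow> \<delta> \<le> f x b" "bounded_lipschitz X (\<lambda>b. 1) f"
  shows "bounded_lipschitz X (\<lambda>b. 1) (\<lambda>x b. 1 / f x b)"
proof -
  obtain C where C: "0 \<le> C"
    "\<And>b x y. x \<in> X \<Longrightarrow> y \<in> X \<Longrightarrow> \<bar>f x b - f y b\<bar> \<le> C * dist x y"
    using assms(3) unfolding bounded_lipschitz_def by auto
  show ?thesis
  proof (rule bounded_lipschitzI[of "1 / \<delta>" "C / \<delta>\<^sup>2"])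
    fix x y b assume xy: "x \<in> X" "y \<in> X"
    have p: "\<delta> \<le> f x b" "\<delta> \<le> f y b" using assms xy by auto
    have "\<bar>1 / f x b - 1 / f y b\<bar> = \<bar>f x b - f y b\<bar> / (f x b * f y b)"
      using p assms(1) by (simp add: diff_frac_eq abs_minus_commute)
    also have "\<dots> \<le> (C * dist x y) / (\<delta> * \<delta>)"
      using p assms(1) C xy by (intro frac_le mult_mono) auto
    finally show "\<bar>1 / f x b - 1 / f y b\<bar> \<le> C / \<delta>\<^sup>2 * 1 * dist x y"
      by (simp add: power2_eq_square)
  next
    fix x b assume x: "x \<in> X"
    have p: "\<delta> \<le> f x b" using assms x by auto
    then show "\<bar>1 / f x b\<bar> \<le> 1 / \<delta> * 1" using assms(1) by (simp add: frac_le)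
  qed (use C assms in auto)
qed

text \<open>Multiply by the conjugate: the sum of the two roots is at least
  \<open>sqrt \<delta>\<close>, which is where the lower bound enters.\<close>

lemma bounded_lipschitz_sqrt:
  assumes "0 < \<delta>" "\<And>x b. x \<in> X \<Longrightarrow> \<delta> \<le> f x b" "bounded_lipschitz X (\<lambda>b. 1) f"
  shows "bounded_lipschitz X (\<lambda>b. 1) (\<lambda>x b. sqrt (f x b))"
proof -
  obtain C where C: "0 \<le> C" "\<And>b x. x \<in> X \<Longrightarrow> \<bar>f x b\<bar> \<le> C"
    "\<And>b x y. x \<in> X \<Longrightarrow> y \<in> X \<Longrightarrow> \<bar>f x b - f y b\<bar> \<le> C * dist x y"
    using assms(3) unfolding bounded_lipschitz_def by auto
  show ?thesis
  proof (rule bounded_lipschitzI[of "sqrt C" "C / sqrt \<delta>"])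
    fix x y b assume xy: "x \<in> X" "y \<in> X"
    have p: "\<delta> \<le> f x b" "\<delta> \<le> f y b" using assms xy by auto
    have s: "sqrt \<delta> \<le> sqrt (f x b)" "0 \<le> sqrt (f y b)" "0 < sqrt \<delta>"
      using p assms(1) by auto
    have "f x b - f y b = (sqrt (f x b) - sqrt (f y b)) * (sqrt (f x b) + sqrt (f y b))"
      using p assms(1) by (simp add: algebra_simps)
    then have "\<bar>f x b - f y b\<bar> = \<bar>sqrt (f x b) - sqrt (f y b)\<bar> * (sqrt (f x b) + sqrt (f y b))"
      using s by (simp add: abs_mult)
    also have "\<dots> \<ge> \<bar>sqrt (f x b) - sqrt (f y b)\<bar> * sqrt \<delta>"
      using s by (intro mult_left_mono add_increasing2) auto
    finally have "\<bar>sqrt (f x b) - sqrt (f y b)\<bar> * sqrt \<delta> \<le> C * dist x y"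
      using C(3)[OF xy, of b] by simp
    then show "\<bar>sqrt (f x b) - sqrt (f y b)\<bar> \<le> C / sqrt \<delta> * 1 * dist x y"
      using s by (simp add: field_simps)
  next
    fix x b assume x: "x \<in> X"
    have p: "\<delta> \<le> f x b" using assms x by auto
    then show "\<bar>sqrt (f x b)\<bar> \<le> sqrt C * 1" using assms(1) C(2)[OF x, of b] by simp
  qed (use C assms in auto)
qed

text \<open>The exponential alone is bounded by \<open>exp (- e b)\<close>, its variation by a
  multiple of \<open>w b * exp (- e b)\<close>; the weight \<open>1 + w b\<close> covers
  both.\<close>

lemma bounded_lipschitz_exp:
  assumes "\<And>b. 0 \<le> w b" "\<And>x b. x \<in> X \<Longrightarrow> e b \<le> f x b" "bounded_lipschitz X w f"
  shows "bounded_lipschitz X (\<lambda>b. (1 + w b) * exp (- e b)) (\<lambda>x b. exp (- f x b))"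
proof -
  obtain C where C: "0 \<le> C"
    "\<And>b x y. x \<in> X \<Longrightarrow> y \<in> X \<Longrightarrow> \<bar>f x b - f y b\<bar> \<le> C * w b * dist x y"
    using assms(3) unfolding bounded_lipschitz_def by auto
  \<comment> \<open>Mean value estimate with the derivative bounded at the common lower end
    \<open>r\<close>; it reduces to \<open>1 + z \<le> exp z\<close>.\<close>
  have exp_diff: "\<bar>exp (- s) - exp (- t)\<bar> \<le> \<bar>s - t\<bar> * exp (- r)" if "r \<le> s" "r \<le> t" for r s t :: real
  proof -
    have *: "exp (- s) - exp (- t) \<le> (t - s) * exp (- r) \<and> 0 \<le> exp (- s) - exp (- t)"
      if "r \<le> s" "s \<le> t" for s t :: real
    proof -
      have "1 - exp (- (t - s)) \<le> t - s" using exp_ge_add_one_self[of "- (t - s)"] by linarith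
      then have "exp (- s) * (1 - exp (- (t - s))) \<le> exp (- r) * (t - s)"
        using that by (intro mult_mono) auto
      moreover have "exp (- s) * (1 - exp (- (t - s))) = exp (- s) - exp (- t)"
        by (simp add: algebra_simps flip: exp_add)
      ultimately show ?thesis using that by (simp add: algebra_simps)
    qed
    show ?thesis using *[of s t] *[of t s] that by (cases "s \<le> t") auto
  qed
  show ?thesis
  proof (rule bounded_lipschitzI[of 1 C])
    fix x y b assume xy: "x \<in> X" "y \<in> X"
    have "\<bar>exp (- f x b) - exp (- f y b)\<bar> \<le> \<bar>f x b - f y b\<bar> * exp (- e b)"
      using assms xy by (intro exp_diff) auto
    also have "\<dots> \<le> C * w b * dist x y * exp (- e b)"
      using C xy by (intro mult_right_mono) auto
    also have "\<dots> \<le> C * ((1 + w b) * exp (- e b)) * dist x y"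
      using C by (simp add: algebra_simps)
    finally show "\<bar>exp (- f x b) - exp (- f y b)\<bar> \<le> C * ((1 + w b) * exp (- e b)) * dist x y" .
  next
    fix x b assume x: "x \<in> X"
    have "exp (- f x b) \<le> 1 * exp (- e b)" using assms x by simp
    also have "\<dots> \<le> (1 + w b) * exp (- e b)"  using assms(1)[of b] by (intro mult_right_mono) auto
    finally show "\<bar>exp (- f x b)\<bar> \<le> 1 * ((1 + w b) * exp (- e b))" by simp
  qed (use C assms in auto)
qed

section \<open>Coercive matrices\<close>

text \<open>A bound on the quadratic form rather than on eigenvalues: invertibility, bounds on the
  inverse and the sign of the determinant are drawn from the form directly.\<close>

definition coercive :: "real \<Rightarrow> real^'n^'n \<Rightarrow> bool" where
  "coercive \<alpha> A \<longleftrightarrow> (\<forall>\<xi>. \<alpha> * (norm \<xi>)\<^sup>2 \<le> \<xi> \<bullet> (A *v \<xi>))"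

lemma coercive_norm_le:
  assumes "coercive \<alpha> A"
  shows "\<alpha> * norm \<xi> \<le> norm (A *v \<xi>)"
proof (cases "\<xi> = 0")
  case False
  have "\<alpha> * (norm \<xi>)\<^sup>2 \<le> norm \<xi> * norm (A *v \<xi>)"
    using assms norm_cauchy_schwarz[of \<xi> "A *v \<xi>"] unfolding coercive_def
    by (meson order_trans)
  then have "norm \<xi> * (\<alpha> * norm \<xi>) \<le> norm \<xi> * norm (A *v \<xi>)"
    by (simp add: power2_eq_square mult_ac)
  then show ?thesis using False by simp
qed auto

lemma coercive_invertible:
  assumes "coercive \<alpha> A" "0 < \<alpha>"
  shows "invertible A"
proof -
  have "\<xi> = 0" if "A *v \<xi> = 0" for \<xi>
    using coercive_norm_le[OF assms(1), of \<xi>] that assms(2)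
    by (simp add: mult_le_0_iff)
  then show ?thesis
    using invertible_left_inverse matrix_left_invertible_ker by blast
qed

lemma coercive_inv_mult:
  assumes "coercive \<alpha> A" "0 < \<alpha>"
  shows "A ** matrix_inv A = mat 1" "matrix_inv A ** A = mat 1"
  using coercive_invertible[OF assms] by (auto simp: matrix_inv_def invertible_def intro: someI2_ex)

lemma coercive_inv_norm_le:
  assumes "coercive \<alpha> A" "0 < \<alpha>"
  shows "norm (matrix_inv A *v w) \<le> norm w / \<alpha>"
proof -
  have "\<alpha> * norm (matrix_inv A *v w) \<le> norm (A *v (matrix_inv A *v w))"
    by (rule coercive_norm_le[OF assms(1)])
  also have "A *v (matrix_inv A *v w) = w"
    by (simp add: matrix_vector_mul_assoc coercive_inv_mult[OF assms])
  finally show ?thesis using assms by (simp add: field_simps)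
qed

lemma coercive_inv_component_le:
  fixes A :: "real^'n^'n"
  assumes "coercive \<alpha> A" "0 < \<alpha>"
  shows "\<bar>matrix_inv A $ i $ j\<bar> \<le> 1 / \<alpha>"
proof -
  have "\<bar>matrix_inv A $ i $ j\<bar> = \<bar>(matrix_inv A *v axis j 1) $ i\<bar>"
    by (simp add: matrix_vector_mult_basis column_def)
  also have "\<dots> \<le> norm (matrix_inv A *v axis j 1)" by (rule component_le_norm_cart)
  also have "\<dots> \<le> 1 / \<alpha>" using coercive_inv_norm_le[OF assms, of "axis j 1"]
    by (simp add: norm_axis_1)
  finally show ?thesis .
qed

text \<open>Along the segment from the identity to \<open>A\<close> all matrices stay coercive,
  hence invertible, so the determinant, which starts at 1, cannot reach 0.\<close>

lemma coercive_det_pos: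
  fixes A :: "real^'n^'n"
  assumes "coercive \<alpha> A" "0 < \<alpha>"
  shows "0 < det A"
proof (rule ccontr)
  assume neg: "\<not> 0 < det A"
  define H where "H t = (1 - t) *\<^sub>R mat 1 + t *\<^sub>R A" for t :: real
  have H: "det (H t) \<noteq> 0" if "0 \<le> t" "t \<le> 1" for t
  proof -
    have "coercive (min 1 \<alpha>) (H t)"
      unfolding coercive_def
    proof
      fix \<xi> :: "real^'n"
      have "\<xi> \<bullet> (H t *v \<xi>) = (1 - t) * (norm \<xi>)\<^sup>2 + t * (\<xi> \<bullet> (A *v \<xi>))"
        by (simp add: H_def matrix_vector_mult_add_rdistrib inner_add_right power2_norm_eq_inner
            flip: scaleR_matrix_vector_assoc)
      moreover have "t * (\<alpha> * (norm \<xi>)\<^sup>2) \<le> t * (\<xi> \<bullet> (A *v \<xi>))"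
        using assms that by (intro mult_left_mono) (auto simp: coercive_def)
      moreover have "min 1 \<alpha> * (norm \<xi>)\<^sup>2 \<le> ((1 - t) * 1 + t * \<alpha>) * (norm \<xi>)\<^sup>2"
      proof (rule mult_right_mono)
        have "(1 - t) * min 1 \<alpha> + t * min 1 \<alpha> \<le> (1 - t) * 1 + t * \<alpha>"
          using that by (intro add_mono mult_left_mono) auto
        then show "min 1 \<alpha> \<le> (1 - t) * 1 + t * \<alpha>" by (simp add: algebra_simps)
      qed auto
      ultimately show "min 1 \<alpha> * (norm \<xi>)\<^sup>2 \<le> \<xi> \<bullet> (H t *v \<xi>)"
        by (simp add: algebra_simps)
    qed
    then have "invertible (H t)" using coercive_invertible[of "min 1 \<alpha>"] assms by auto
    then show ?thesis by (simp add: invertible_det_nz)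
  qed
  have cont: "continuous_on {0..1} (\<lambda>t. det (H t))"
    unfolding H_def det_def by (intro continuous_intros) 
  have "\<exists>t. 0 \<le> t \<and> t \<le> 1 \<and> det (H t) = 0"
    by (rule IVT2'[of "\<lambda>t. det (H t)" 1 0 0]) (use neg cont in \<open>auto simp: H_def\<close>)
  then show False using H by auto
qed

section \<open>The Gaussian as a function of the moments\<close>

type_synonym moments = "real \<times> vel \<times> (real^3^3)"

definition mbulk :: "moments \<Rightarrow> vel" where
  "mbulk m = (1 / fst m) *\<^sub>R fst (snd m)"

definition mstress :: "moments \<Rightarrow> real^3^3" where
  "mstress m = (\<chi> i j. snd (snd m) $ i $ j / fst m - mbulk m $ i * mbulk m $ j)"

definition mtensor :: "real \<Rightarrow> moments \<Rightarrow> real^3^3" where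
  "mtensor \<nu> m = ((1 - \<nu>) * (trace (mstress m) / 3)) *\<^sub>R mat 1 + \<nu> *\<^sub>R mstress m"

definition mgaussian :: "real \<Rightarrow> moments \<Rightarrow> vel \<Rightarrow> real" where
  "mgaussian \<nu> m v =
     fst m / sqrt (det ((2 * pi) *\<^sub>R mtensor \<nu> m)) *
     exp (- (1 / 2) * ((v - mbulk m) \<bullet> (matrix_inv (mtensor \<nu> m) *v (v - mbulk m))))"

text \<open>Coercivity is imposed on the tensor itself with one \<open>\<alpha>\<close> for the
  whole set; together with the bounds on density and norm it keeps every constant below
  uniform.\<close>

definition admissible :: "real \<Rightarrow> real \<Rightarrow> real \<Rightarrow> real \<Rightarrow> real \<Rightarrow> moments set" where
  "admissible \<nu> \<alpha> al au R =
     {m. al \<le> fst m \<and> fst m \<le> au \<and> norm m \<le> R \<and> coercive \<alpha> (mtensor \<nu> m)}"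

lemma moments_component_le:
  fixes m :: moments
  shows "\<bar>fst m\<bar> \<le> norm m" "\<bar>fst (snd m) $ i\<bar> \<le> norm m" "\<bar>snd (snd m) $ i $ j\<bar> \<le> norm m"
proof -
  have *: "norm (fst m) \<le> norm m" "norm (snd m) \<le> norm m"
    "norm (fst (snd m)) \<le> norm (snd m)" "norm (snd (snd m)) \<le> norm (snd m)"
    using norm_fst_le[of "fst m" "snd m"] norm_snd_le[of "snd m" "fst m"]
      norm_fst_le[of "fst (snd m)" "snd (snd m)"] norm_snd_le[of "snd (snd m)" "fst (snd m)"]
    by auto
  show "\<bar>fst m\<bar> \<le> norm m" using * by auto
  show "\<bar>fst (snd m) $ i\<bar> \<le> norm m"
    using * component_le_norm_cart[of "fst (snd m)" i] by linarith
  have "\<bar>snd (snd m) $ i $ j\<bar> \<le> norm (snd (snd m) $ i)" by (rule component_le_norm_cart)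
  also have "\<dots> \<le> norm (snd (snd m))" by (rule Finite_Cartesian_Product.norm_nth_le)
  finally show "\<bar>snd (snd m) $ i $ j\<bar> \<le> norm m" using * by linarith
qed

lemma bounded_lipschitz_moments:
  fixes X :: "moments set"
  assumes "\<And>m. m \<in> X \<Longrightarrow> norm m \<le> R" "0 \<le> R"
  shows "bounded_lipschitz X (\<lambda>b. 1) (\<lambda>m b. fst m)"
    "bounded_lipschitz X (\<lambda>b. 1) (\<lambda>m b. fst (snd m) $ i)"
    "bounded_lipschitz X (\<lambda>b. 1) (\<lambda>m b. snd (snd m) $ i $ j)"
proof -
  have *: "bounded_lipschitz X (\<lambda>b. 1) (\<lambda>m b. g m)"
    if "\<And>m. \<bar>g m\<bar> \<le> norm m" "\<And>m n. g m - g n = g (m - n)" for g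
  proof (rule bounded_lipschitzI[of R 1])
    fix m assume "m \<in> X"
    then show "\<bar>g m\<bar> \<le> R * 1" using that(1)[of m] assms(1)[of m] by simp
  qed (use assms that in \<open>auto simp: dist_norm\<close>)
  show "bounded_lipschitz X (\<lambda>b. 1) (\<lambda>m b. fst m)"
    "bounded_lipschitz X (\<lambda>b. 1) (\<lambda>m b. fst (snd m) $ i)"
    "bounded_lipschitz X (\<lambda>b. 1) (\<lambda>m b. snd (snd m) $ i $ j)"
    by (rule *; simp add: moments_component_le)+
qed

lemmas bounded_lipschitz_intros =
  bounded_lipschitz_mult_1 bounded_lipschitz_add_1 bounded_lipschitz_diff_1 bounded_lipschitz_number

lemma admissibleD:
  assumes "m \<in> admissible \<nu> \<alpha> al au R"
  shows "al \<le> fst m" "fst m \<le> au" "norm m \<le> R" "coercive \<alpha> (mtensor \<nu> m)"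
  using assms by (auto simp: admissible_def)

section \<open>Lipschitz dependence of bulk velocity, tensor, determinant and inverse on the
  moments\<close>

lemma bounded_lipschitz_mbulk:
  assumes "0 < al" "0 \<le> R"
  shows "bounded_lipschitz (admissible \<nu> \<alpha> al au R) (\<lambda>b. 1) (\<lambda>m b. mbulk m $ i)"
  unfolding mbulk_def vector_scaleR_component real_scaleR_def
  by (intro bounded_lipschitz_mult_1 bounded_lipschitz_inverse[OF assms(1)]
      bounded_lipschitz_moments[of _ R] admissibleD assms)

lemma bounded_lipschitz_mtensor:
  assumes "0 < al" "0 \<le> R"
  shows "bounded_lipschitz (admissible \<nu> \<alpha> al au R) (\<lambda>b. 1) (\<lambda>m b. mtensor \<nu> m $ i $ j)"
proof -
  let ?X = "admissible \<nu> \<alpha> al au R"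
  have stress: "bounded_lipschitz ?X (\<lambda>b. 1) (\<lambda>m b. mstress m $ i $ j)" for i j
  proof -
    have "bounded_lipschitz ?X (\<lambda>b. 1) (\<lambda>m b. snd (snd m) $ i $ j * (1 / fst m))"
      by (intro bounded_lipschitz_mult_1 bounded_lipschitz_inverse[OF assms(1)]
          bounded_lipschitz_moments[of _ R] admissibleD assms)
    then show ?thesis unfolding mstress_def
      by (simp, intro bounded_lipschitz_diff_1 bounded_lipschitz_mult_1
          bounded_lipschitz_mbulk[OF assms]) auto
  qed
  have "bounded_lipschitz ?X (\<lambda>b. 1) (\<lambda>m b. (1 - \<nu>) * (trace (mstress m) * (1 / 3)) *
      (mat 1 :: real^3^3) $ i $ j + \<nu> * mstress m $ i $ j)"
    unfolding trace_def sum_3 by (intro bounded_lipschitz_intros stress)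
  then show ?thesis by (simp add: mtensor_def)
qed

lemma bounded_lipschitz_det:
  fixes A :: "'a::metric_space \<Rightarrow> real^3^3"
  assumes "\<And>i j. bounded_lipschitz X (\<lambda>b. 1) (\<lambda>m b::'b. A m $ i $ j)"
  shows "bounded_lipschitz X (\<lambda>b. 1) (\<lambda>m b::'b. det (A m))"
  unfolding det_3 by (intro bounded_lipschitz_intros assms)

lemma matrix_diff_ldistrib: "(A :: real^'n^'m) ** (B - C) = A ** B - A ** C"
  by (vector matrix_matrix_mult_def sum_subtractf right_diff_distrib)

lemma matrix_diff_rdistrib: "((A :: real^'n^'m) - B) ** C = A ** C - B ** C"
  by (vector matrix_matrix_mult_def sum_subtractf left_diff_distrib)

text \<open>Resolvent identity: \<open>P - Q = P ** (B - A) ** Q\<close> for the inverses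
  \<open>P\<close> of \<open>A\<close> and \<open>Q\<close> of \<open>B\<close>, where coercivity
  bounds the entries of \<open>P\<close> and \<open>Q\<close> by
  \<open>1 / \<alpha>\<close>.\<close>

lemma bounded_lipschitz_matrix_inv:
  fixes A :: "'a::metric_space \<Rightarrow> real^'n^'n"
  assumes "0 < \<alpha>" "\<And>m. m \<in> X \<Longrightarrow> coercive \<alpha> (A m)"
    and "\<And>i j. bounded_lipschitz X (\<lambda>b. 1) (\<lambda>m b::'b. A m $ i $ j)"
  shows "bounded_lipschitz X (\<lambda>b. 1) (\<lambda>m b::'b. matrix_inv (A m) $ i $ j)"
proof -
  have "\<forall>i j. \<exists>C\<ge>0. \<forall>x\<in>X. \<forall>y\<in>X. \<bar>A x $ i $ j - A y $ i $ j\<bar> \<le> C * dist x y"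
    using assms(3) unfolding bounded_lipschitz_def by fastforce
  then obtain C where C0: "\<And>i j. 0 \<le> C i j"
    and C: "\<And>i j x y. x \<in> X \<Longrightarrow> y \<in> X \<Longrightarrow> \<bar>A x $ i $ j - A y $ i $ j\<bar> \<le> C i j * dist x y"
    by metis
  define D where "D = (\<Sum>k\<in>UNIV. \<Sum>l\<in>UNIV. C l k / \<alpha>\<^sup>2)"
  show ?thesis
  proof (rule bounded_lipschitzI[of "1 / \<alpha>" D])
    fix x y and b :: 'b assume xy: "x \<in> X" "y \<in> X"
    let ?P = "matrix_inv (A x)" and ?Q = "matrix_inv (A y)"
    have "?P ** (A y - A x) ** ?Q = ?P ** (A y ** ?Q) - (?P ** A x) ** ?Q"
      by (simp add: matrix_diff_ldistrib matrix_diff_rdistrib matrix_mul_assoc)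
    then have eq: "?P - ?Q = ?P ** (A y - A x) ** ?Q"
      by (simp add: coercive_inv_mult[OF assms(2)[OF xy(1)] assms(1)]
          coercive_inv_mult[OF assms(2)[OF xy(2)] assms(1)])
    have "?P $ i $ j - ?Q $ i $ j = (?P ** (A y - A x) ** ?Q) $ i $ j"
      by (simp flip: eq)
    also have "\<dots> = (\<Sum>k\<in>UNIV. \<Sum>l\<in>UNIV. ?P $ i $ l * (A y $ l $ k - A x $ l $ k) * ?Q $ k $ j)"
      by (simp add: matrix_matrix_mult_def sum_distrib_right)
    also have "\<bar>\<dots>\<bar> \<le> (\<Sum>k\<in>UNIV. \<Sum>l\<in>UNIV. C l k / \<alpha>\<^sup>2 * dist x y)"
    proof (intro order_trans[OF sum_abs] sum_mono)
      fix k l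
      have "\<bar>?P $ i $ l * (A y $ l $ k - A x $ l $ k) * ?Q $ k $ j\<bar>
        = \<bar>?P $ i $ l\<bar> * \<bar>A y $ l $ k - A x $ l $ k\<bar> * \<bar>?Q $ k $ j\<bar>" by (simp add: abs_mult)
      also have "\<dots> \<le> (1 / \<alpha>) * (C l k * dist x y) * (1 / \<alpha>)"
        using C[OF xy(2,1), of l k] assms(1) C0[of l k]
          coercive_inv_component_le[OF assms(2)[OF xy(1)] assms(1), of i l]
          coercive_inv_component_le[OF assms(2)[OF xy(2)] assms(1), of k j]
        by (intro mult_mono) (auto simp: dist_commute)
      finally show "\<bar>?P $ i $ l * (A y $ l $ k - A x $ l $ k) * ?Q $ k $ j\<bar> \<le> C l k / \<alpha>\<^sup>2 * dist x y"
        by (simp add: power2_eq_square mult_ac)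
    qed
    finally show "\<bar>?P $ i $ j - ?Q $ i $ j\<bar> \<le> D * 1 * dist x y"
      by (simp add: D_def sum_distrib_right)
  next
    fix x and b :: 'b assume "x \<in> X"
    then show "\<bar>matrix_inv (A x) $ i $ j\<bar> \<le> 1 / \<alpha> * 1"
      using coercive_inv_component_le[OF assms(2) assms(1)] by simp
  qed (use assms C0 in \<open>auto simp: D_def intro!: sum_nonneg\<close>)
qed

lemma det_3_abs_le:
  fixes A :: "real^3^3"
  assumes "\<And>i j. \<bar>A $ i $ j\<bar> \<le> c" "0 \<le> c"
  shows "\<bar>det A\<bar> \<le> 6 * c ^ 3"
proof -
  have *: "\<bar>x * y * z\<bar> \<le> c ^ 3" if "\<bar>x\<bar> \<le> c" "\<bar>y\<bar> \<le> c" "\<bar>z\<bar> \<le> c" for x y z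
  proof -
    have "\<bar>x\<bar> * \<bar>y\<bar> * \<bar>z\<bar> \<le> c * c * c" using that assms(2) by (intro mult_mono) auto
    then show ?thesis by (simp add: abs_mult power3_eq_cube)
  qed
  note * = *[OF assms(1) assms(1) assms(1)]
  show ?thesis unfolding det_3
    using *[of 1 1 2 2 3 3] *[of 1 2 2 3 3 1] *[of 1 3 2 1 3 2]
      *[of 1 1 2 3 3 2] *[of 1 2 2 1 3 3] *[of 1 3 2 2 3 1] by linarith
qed

text \<open>The determinant of the inverse is at most \<open>6 / \<alpha> ^ 3\<close>, since each of
  its six Leibniz terms is a product of three entries of size at most \<open>1 / \<alpha>\<close>;
  now take reciprocals.\<close>

lemma coercive_det_ge:
  fixes A :: "real^3^3"
  assumes "coercive \<alpha> A" "0 < \<alpha>"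
  shows "\<alpha> ^ 3 / 6 \<le> det A"
proof -
  have "det A * det (matrix_inv A) = 1"
    using coercive_inv_mult(1)[OF assms] by (metis det_I det_mul)
  moreover have "det (matrix_inv A) \<le> 6 / \<alpha> ^ 3"
    using det_3_abs_le[of "matrix_inv A" "1 / \<alpha>"] coercive_inv_component_le[OF assms] assms
    by (auto simp: power_one_over divide_inverse power_inverse)
  ultimately have "1 \<le> det A * (6 / \<alpha> ^ 3)"
    using mult_left_mono[of "det (matrix_inv A)" "6 / \<alpha> ^ 3" "det A"] coercive_det_pos[OF assms]
    by simp
  then show ?thesis using assms by (simp add: field_simps)
qed

lemma norm_matrix_vector_le:
  fixes A :: "real^'n^'m" and c :: real
  assumes "\<And>i j. \<bar>A $ i $ j\<bar> \<le> c"
  shows "norm (A *v x) \<le> CARD('m) * CARD('n) * c * norm x"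
proof -
  have "norm (A *v x) \<le> (\<Sum>i\<in>UNIV. \<bar>(A *v x) $ i\<bar>)" by (rule norm_le_l1_cart)
  also have "\<dots> \<le> (\<Sum>i\<in>(UNIV::'m set). \<Sum>j\<in>(UNIV::'n set). c * norm x)"
    unfolding matrix_vector_mult_def vec_lambda_beta
  proof (intro sum_mono order_trans[OF sum_abs])
    fix i :: 'm and j :: 'n
    show "\<bar>A $ i $ j * x $ j\<bar> \<le> c * norm x" unfolding abs_mult
      using assms[of i j] component_le_norm_cart[of x j] by (intro mult_mono) auto
  qed
  also have "\<dots> = CARD('m) * CARD('n) * c * norm x" by simp
  finally show ?thesis .
qed

lemma det_scaleR_3: "det (c *\<^sub>R (A :: real^3^3)) = c ^ 3 * det A"
  by (simp add: det_3 algebra_simps power3_eq_cube)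

section \<open>The Gaussian on the admissible set: uniform bounds, continuity, measurability\<close>

lemma mgaussian_pos:
  assumes "coercive \<alpha> (mtensor \<nu> m)" "0 < \<alpha>" "0 < fst m"
  shows "0 < mgaussian \<nu> m v"
  using coercive_det_pos[OF assms(1,2)] assms(3) by (simp add: mgaussian_def det_scaleR_3)

text \<open>The prefactor is controlled by the determinant bound, the exponential by a lower bound
  on the quadratic form that is uniform over the set: bounded tensor entries keep the Gaussian from
  spreading, and the bounded bulk velocity keeps its centre in a ball.\<close>

lemma bounded_lipschitz_mgaussian:
  assumes "0 < al" "0 < \<alpha>" "0 \<le> R"
  obtains e where "0 < e"
    "bounded_lipschitz (admissible \<nu> \<alpha> al au R) (\<lambda>v. (1 + norm v)\<^sup>2 * exp (- e * (norm v)\<^sup>2))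
       (mgaussian \<nu>)"
proof -
  let ?X = "admissible \<nu> \<alpha> al au R"
  let ?q = "\<lambda>m v. (v - mbulk m) \<bullet> (matrix_inv (mtensor \<nu> m) *v (v - mbulk m))"
  note bulk = bounded_lipschitz_mbulk[OF assms(1,3), of \<nu> \<alpha> au]
  note tensor = bounded_lipschitz_mtensor[OF assms(1,3), of \<nu> \<alpha> au]
  have inv: "bounded_lipschitz ?X (\<lambda>b. 1) (\<lambda>m b. matrix_inv (mtensor \<nu> m) $ i $ j)" for i j
    by (intro bounded_lipschitz_matrix_inv[OF assms(2)] admissibleD(4) tensor)
  have shift: "bounded_lipschitz ?X (\<lambda>v. 1 + norm v) (\<lambda>m v. (v - mbulk m) $ i)" for i
  proof -
    obtain C where C: "0 \<le> C" "\<And>m. m \<in> ?X \<Longrightarrow> \<bar>mbulk m $ i\<bar> \<le> C"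
      "\<And>m n. m \<in> ?X \<Longrightarrow> n \<in> ?X \<Longrightarrow> \<bar>mbulk m $ i - mbulk n $ i\<bar> \<le> C * dist m n"
      using bulk[of i] unfolding bounded_lipschitz_def by auto
    show ?thesis
    proof (rule bounded_lipschitzI[of "1 + C" C])
      fix m and v :: vel assume "m \<in> ?X"
      have "\<bar>(v - mbulk m) $ i\<bar> \<le> norm v + C"
        using component_le_norm_cart[of v i] C(2)[OF \<open>m \<in> ?X\<close>] by simp
      also have "\<dots> \<le> (1 + C) * (1 + norm v)" using C(1) by (simp add: algebra_simps)
      finally show "\<bar>(v - mbulk m) $ i\<bar> \<le> (1 + C) * (1 + norm v)" .
    next
      fix m n and v :: vel assume "m \<in> ?X" "n \<in> ?X"
      have "\<bar>(v - mbulk m) $ i - (v - mbulk n) $ i\<bar> \<le> C * dist m n * 1"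
        using C(3)[OF \<open>m \<in> ?X\<close> \<open>n \<in> ?X\<close>] by simp
      also have "\<dots> \<le> C * dist m n * (1 + norm v)" using C(1) by (intro mult_left_mono) auto
      finally show "\<bar>(v - mbulk m) $ i - (v - mbulk n) $ i\<bar> \<le> C * (1 + norm v) * dist m n"
        by (simp add: mult_ac)
    qed (use C in auto)
  qed
  have q: "bounded_lipschitz ?X (\<lambda>v. (1 + norm v)\<^sup>2) (\<lambda>m v. 1 / 2 * ?q m v)"
  proof -
    have "bounded_lipschitz ?X (\<lambda>v. (1 + norm v) * (1 * (1 + norm v)))
        (\<lambda>m v. (v - mbulk m) $ i * (1 / 2 * matrix_inv (mtensor \<nu> m) $ i $ j * (v - mbulk m) $ j))" for i j
      by (intro bounded_lipschitz_mult bounded_lipschitz_mult_1 bounded_lipschitz_number inv shift) auto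
    then have "bounded_lipschitz ?X (\<lambda>v. (1 + norm v)\<^sup>2)
        (\<lambda>m v. (v - mbulk m) $ i * (1 / 2 * matrix_inv (mtensor \<nu> m) $ i $ j * (v - mbulk m) $ j))" for i j
      by (simp add: power2_eq_square)
    then have "bounded_lipschitz ?X (\<lambda>v. (1 + norm v)\<^sup>2)
        (\<lambda>m v. \<Sum>i\<in>UNIV. \<Sum>j\<in>UNIV. (v - mbulk m) $ i * (1 / 2 * matrix_inv (mtensor \<nu> m) $ i $ j * (v - mbulk m) $ j))"
      unfolding sum_3 by (intro bounded_lipschitz_add) auto
    moreover have "1 / 2 * ?q m v = (\<Sum>i\<in>UNIV. \<Sum>j\<in>UNIV.
       (v - mbulk m) $ i * (1 / 2 * matrix_inv (mtensor \<nu> m) $ i $ j * (v - mbulk m) $ j))" for m v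
      by (simp only: inner_vec_def matrix_vector_mult_def vec_lambda_beta inner_real_def
          sum_distrib_left) (simp add: mult_ac)
    ultimately show ?thesis by simp
  qed
  obtain T where T: "0 < T" "\<And>m i j. m \<in> ?X \<Longrightarrow> \<bar>mtensor \<nu> m $ i $ j\<bar> \<le> T"
  proof -
    have "\<forall>i j. \<exists>C\<ge>0. \<forall>m\<in>?X. \<bar>mtensor \<nu> m $ i $ j\<bar> \<le> C"
      \<comment> \<open>\<open>unit\<close> fills the type of the weight variable, on which the
        tensor does not depend.\<close>
      using tensor[where 'a=unit] unfolding bounded_lipschitz_def by fastforce
    then obtain C where C: "\<And>i j. 0 \<le> C i j" "\<And>i j m. m \<in> ?X \<Longrightarrow> \<bar>mtensor \<nu> m $ i $ j\<bar> \<le> C i j"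
      by metis
    have le: "C i j \<le> (\<Sum>i\<in>UNIV. \<Sum>j\<in>UNIV. C i j)" for i j
    proof -
      have "C i j \<le> (\<Sum>j\<in>UNIV. C i j)" by (rule member_le_sum) (use C in auto)
      also have "\<dots> \<le> (\<Sum>i\<in>UNIV. \<Sum>j\<in>UNIV. C i j)"
        by (rule member_le_sum[where f="\<lambda>i. \<Sum>j\<in>UNIV. C i j"]) (use C in \<open>auto intro: sum_nonneg\<close>)
      finally show ?thesis .
    qed
    show ?thesis
    \<comment> \<open>The summand 1 makes \<open>T\<close> strictly positive, as it becomes a
      divisor.\<close>
    proof (rule that[of "(\<Sum>i\<in>UNIV. \<Sum>j\<in>UNIV. C i j) + 1"])
      show "0 < (\<Sum>i\<in>UNIV. \<Sum>j\<in>UNIV. C i j) + 1"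
        using C by (smt (verit) sum_nonneg)
      fix m i j assume "m \<in> ?X"
      show "\<bar>mtensor \<nu> m $ i $ j\<bar> \<le> (\<Sum>i\<in>UNIV. \<Sum>j\<in>UNIV. C i j) + 1"
        using C(2)[OF \<open>m \<in> ?X\<close>, of i j] le[of i j] by linarith
    qed
  qed
  \<comment> \<open>Let \<open>y\<close> be the inverse tensor \<open>A\<close> applied to
    \<open>w = v - mbulk m\<close>. The form equals \<open>y \<bullet> (A *v y)\<close>, hence is at
    least \<open>\<alpha>\<close> times the squared norm of \<open>y\<close>, and
    \<open>norm w \<le> 9 * T * norm y\<close> with 9 the number of entries; this gives the rate
    \<open>k\<close>. It is halved by the factor 1/2 in the exponent and once more by splitting
    \<open>v\<close> into \<open>w\<close> and the bulk velocity, whose norm is at most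
    \<open>R / al\<close>; what remains is \<open>e\<close> and the shift \<open>d\<close>.\<close>
  define k where "k = \<alpha> / (9 * T)\<^sup>2"
  define e where "e = k / 4"
  define d where "d = k / 2 * (R / al)\<^sup>2"
  have k: "0 < k" and e: "0 < e" using assms T by (simp_all add: k_def e_def)
  have q_ge: "e * (norm v)\<^sup>2 - d \<le> 1 / 2 * ?q m v" if m: "m \<in> ?X" for m v
  proof -
    let ?A = "mtensor \<nu> m"
    define w where "w = v - mbulk m"
    define y where "y = matrix_inv ?A *v w"
    have w: "?A *v y = w" unfolding y_def
      by (simp add: matrix_vector_mul_assoc coercive_inv_mult[OF admissibleD(4)[OF m] assms(2)])
    have "norm w \<le> (9 * T) * norm y"
      using norm_matrix_vector_le[OF T(2)[OF m], of y] w by simp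
    then have "(norm w)\<^sup>2 \<le> ((9 * T) * norm y)\<^sup>2" by (rule power_mono) auto
    then have "(norm w)\<^sup>2 / (9 * T)\<^sup>2 \<le> (norm y)\<^sup>2" using T by (simp add: field_simps)
    then have "\<alpha> * ((norm w)\<^sup>2 / (9 * T)\<^sup>2) \<le> \<alpha> * (norm y)\<^sup>2" using assms by (intro mult_left_mono) auto
    also have "\<dots> \<le> y \<bullet> (?A *v y)" using admissibleD(4)[OF m] by (simp add: coercive_def)
    finally have 1: "\<alpha> * ((norm w)\<^sup>2 / (9 * T)\<^sup>2) \<le> ?q m v"
      by (simp add: w inner_commute) (simp add: w_def y_def)
    have "norm (mbulk m) \<le> R / al"
    proof -
      have "norm (fst (snd m)) \<le> norm m"
        using norm_snd_le[of "snd m" "fst m"] norm_fst_le[of "fst (snd m)" "snd (snd m)"] by simp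
      then have "norm (fst (snd m)) / \<bar>fst m\<bar> \<le> R / al"
        using admissibleD[OF m] assms by (intro frac_le) auto
      then show ?thesis by (simp add: mbulk_def)
    qed
    then have "(norm (mbulk m))\<^sup>2 \<le> (R / al)\<^sup>2" by (rule power_mono) auto
    moreover have "(norm v)\<^sup>2 \<le> 2 * (norm w)\<^sup>2 + 2 * (norm (mbulk m))\<^sup>2"
    proof -
      have "norm v \<le> norm w + norm (mbulk m)" using norm_triangle_sub[of v "mbulk m"] by (simp add: w_def)
      then have "(norm v)\<^sup>2 \<le> (norm w + norm (mbulk m))\<^sup>2" by (rule power_mono) auto
      also have "\<dots> \<le> 2 * (norm w)\<^sup>2 + 2 * (norm (mbulk m))\<^sup>2"
        using sum_squares_bound[of "norm w" "norm (mbulk m)"] by (simp add: power2_sum)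
      finally show ?thesis .
    qed
    ultimately have "(norm v)\<^sup>2 / 2 - (R / al)\<^sup>2 \<le> (norm w)\<^sup>2" by linarith
    then have "k * ((norm v)\<^sup>2 / 2 - (R / al)\<^sup>2) \<le> k * (norm w)\<^sup>2"
      using k by (intro mult_left_mono) auto
    moreover have "k * ((norm v)\<^sup>2 / 2 - (R / al)\<^sup>2) = 2 * (e * (norm v)\<^sup>2 - d)"
      unfolding e_def d_def by (simp add: algebra_simps)
    moreover have "k * (norm w)\<^sup>2 \<le> ?q m v" using 1 by (simp add: k_def)
    ultimately show ?thesis by simp
  qed
  have "bounded_lipschitz ?X (\<lambda>v. (1 + (1 + norm v)\<^sup>2) * exp (- (e * (norm v)\<^sup>2 - d)))
      (\<lambda>m v. exp (- (1 / 2 * ?q m v)))"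
    by (intro bounded_lipschitz_exp q q_ge) auto
  moreover have "bounded_lipschitz ?X (\<lambda>b. 1) (\<lambda>m b. fst m * (1 / sqrt ((2 * pi) ^ 3 * det (mtensor \<nu> m))))"
  proof (intro bounded_lipschitz_mult_1 bounded_lipschitz_moments(1)[of _ R] admissibleD assms
      bounded_lipschitz_inverse bounded_lipschitz_sqrt)
    show "0 < sqrt ((2 * pi) ^ 3 * (\<alpha> ^ 3 / 6))" "0 < (2 * pi) ^ 3 * (\<alpha> ^ 3 / 6)" using assms by auto
    fix m assume m: "m \<in> ?X"
    show "(2 * pi) ^ 3 * (\<alpha> ^ 3 / 6) \<le> (2 * pi) ^ 3 * det (mtensor \<nu> m)"
      by (intro mult_left_mono coercive_det_ge[OF admissibleD(4)[OF m] assms(2)]) auto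
    then show "sqrt ((2 * pi) ^ 3 * (\<alpha> ^ 3 / 6)) \<le> sqrt ((2 * pi) ^ 3 * det (mtensor \<nu> m))"
      by simp
  qed (assumption | rule bounded_lipschitz_number bounded_lipschitz_det tensor)+
  ultimately have *: "bounded_lipschitz ?X (\<lambda>v. 1 * ((1 + (1 + norm v)\<^sup>2) * exp (- (e * (norm v)\<^sup>2 - d))))
      (\<lambda>m v. fst m * (1 / sqrt ((2 * pi) ^ 3 * det (mtensor \<nu> m))) * exp (- (1 / 2 * ?q m v)))"
    by (intro bounded_lipschitz_mult) auto
  have eq: "mgaussian \<nu> = (\<lambda>m v. fst m * (1 / sqrt ((2 * pi) ^ 3 * det (mtensor \<nu> m))) * exp (- (1 / 2 * ?q m v)))"
    by (intro ext) (simp add: mgaussian_def det_scaleR_3)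
  obtain C where C: "0 \<le> C"
    "\<And>m v. m \<in> ?X \<Longrightarrow> \<bar>mgaussian \<nu> m v\<bar> \<le> C * (1 * ((1 + (1 + norm v)\<^sup>2) * exp (- (e * (norm v)\<^sup>2 - d))))"
    "\<And>m n v. m \<in> ?X \<Longrightarrow> n \<in> ?X \<Longrightarrow> \<bar>mgaussian \<nu> m v - mgaussian \<nu> n v\<bar>
      \<le> C * (1 * ((1 + (1 + norm v)\<^sup>2) * exp (- (e * (norm v)\<^sup>2 - d)))) * dist m n"
    using *[folded eq] unfolding bounded_lipschitz_def by blast
  \<comment> \<open>The shift goes into the constant \<open>exp d\<close> and the extra 1 into a
    factor 2, so that a clean weight remains.\<close>
  have w: "1 * ((1 + (1 + norm v)\<^sup>2) * exp (- (e * (norm v)\<^sup>2 - d)))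
      \<le> (2 * exp d) * ((1 + norm v)\<^sup>2 * exp (- e * (norm v)\<^sup>2))" for v :: vel
  proof -
    have "exp (- (e * (norm v)\<^sup>2 - d)) = exp d * exp (- e * (norm v)\<^sup>2)"
      by (simp flip: exp_add)
    moreover have "1 + (1 + norm v)\<^sup>2 \<le> 2 * (1 + norm v)\<^sup>2"
      using power_mono[of 1 "1 + norm v" 2] by simp
    then have "(1 + (1 + norm v)\<^sup>2) * (exp d * exp (- e * (norm v)\<^sup>2)) \<le>
      2 * (1 + norm v)\<^sup>2 * (exp d * exp (- e * (norm v)\<^sup>2))"
      by (intro mult_right_mono) auto
    ultimately show ?thesis by (simp add: algebra_simps)
  qed
  have "bounded_lipschitz ?X (\<lambda>v. (1 + norm v)\<^sup>2 * exp (- e * (norm v)\<^sup>2)) (mgaussian \<nu>)"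
  proof (rule bounded_lipschitzI[of "C * (2 * exp d)" "C * (2 * exp d)"])
    fix m and v :: vel assume "m \<in> ?X"
    show "\<bar>mgaussian \<nu> m v\<bar> \<le> C * (2 * exp d) * ((1 + norm v)\<^sup>2 * exp (- e * (norm v)\<^sup>2))"
      using C(2)[OF \<open>m \<in> ?X\<close>, of v] mult_left_mono[OF w[of v] C(1)] by (simp add: mult.assoc)
  next
    fix m n and v :: vel assume mn: "m \<in> ?X" "n \<in> ?X"
    show "\<bar>mgaussian \<nu> m v - mgaussian \<nu> n v\<bar>
        \<le> C * (2 * exp d) * ((1 + norm v)\<^sup>2 * exp (- e * (norm v)\<^sup>2)) * dist m n"
      using C(3)[OF mn, of v] mult_right_mono[OF mult_left_mono[OF w[of v] C(1)], of "dist m n"]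
      by (simp add: mult.assoc)
  qed (use C in auto)
  then show ?thesis using that e by blast
qed

text \<open>For a fixed \<open>\<xi>\<close> the coercivity inequality is a closed condition once
  the density is kept above \<open>al\<close>, where the division in the tensor is continuous.
  Closedness lets profiles pass to pointwise limits and gives measurability of the Gaussian.\<close>

lemma closed_admissible:
  assumes "0 < al"
  shows "closed (admissible \<nu> \<alpha> al au R)"
proof -
  let ?S = "{m :: moments. al \<le> fst m}"
  have S: "closed ?S" by (intro closed_Collect_le continuous_intros)
  have cont: "continuous_on ?S (\<lambda>m. \<xi> \<bullet> (mtensor \<nu> m *v \<xi>))" for \<xi>
    unfolding mtensor_def mstress_def mbulk_def trace_def inner_vec_def matrix_vector_mult_def
    using assms by (simp, intro continuous_intros) auto
  have "closed {m \<in> ?S. \<alpha> * (norm \<xi>)\<^sup>2 \<le> \<xi> \<bullet> (mtensor \<nu> m *v \<xi>)}" for \<xi>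
    by (intro continuous_on_closed_Collect_le cont S continuous_intros)
  then have "closed (\<Inter>\<xi>. {m \<in> ?S. \<alpha> * (norm \<xi>)\<^sup>2 \<le> \<xi> \<bullet> (mtensor \<nu> m *v \<xi>)})"
    by auto
  moreover have "closed {m :: moments. fst m \<le> au}" "closed {m :: moments. norm m \<le> R}"
    by (intro closed_Collect_le continuous_intros)+
  moreover have "admissible \<nu> \<alpha> al au R = (\<Inter>\<xi>. {m \<in> ?S. \<alpha> * (norm \<xi>)\<^sup>2 \<le> \<xi> \<bullet> (mtensor \<nu> m *v \<xi>)})
      \<inter> {m. fst m \<le> au} \<inter> {m. norm m \<le> R}"
    by (auto simp: admissible_def coercive_def)
  ultimately show ?thesis by auto
qed

text \<open>Joint continuity splits into the Lipschitz estimate in the moments, whose weight is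
  continuous in the velocity, and continuity in \<open>v\<close> at fixed moments.\<close>

lemma continuous_on_mgaussian:
  assumes "0 < al" "0 < \<alpha>" "0 \<le> R"
  shows "continuous_on (admissible \<nu> \<alpha> al au R \<times> UNIV) (\<lambda>(m, v). mgaussian \<nu> m v)"
proof -
  let ?X = "admissible \<nu> \<alpha> al au R"
  obtain e where "0 < e" and "bounded_lipschitz ?X (\<lambda>v. (1 + norm v)\<^sup>2 * exp (- e * (norm v)\<^sup>2)) (mgaussian \<nu>)"
    by (rule bounded_lipschitz_mgaussian[OF assms])
  then obtain C where C: "\<And>m n v. m \<in> ?X \<Longrightarrow> n \<in> ?X \<Longrightarrow>
      \<bar>mgaussian \<nu> m v - mgaussian \<nu> n v\<bar> \<le> C * ((1 + norm v)\<^sup>2 * exp (- e * (norm v)\<^sup>2)) * dist m n"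
    unfolding bounded_lipschitz_def by blast
  show ?thesis
    unfolding continuous_on_def
  proof
    fix p assume p: "p \<in> ?X \<times> (UNIV :: vel set)"
    let ?F = "at p within ?X \<times> (UNIV :: vel set)"
    let ?w = "\<lambda>q. C * ((1 + norm (snd q))\<^sup>2 * exp (- e * (norm (snd q))\<^sup>2)) * dist (fst q) (fst p)"
    have "(?w \<longlongrightarrow> C * ((1 + norm (snd p))\<^sup>2 * exp (- e * (norm (snd p))\<^sup>2)) * dist (fst p) (fst p)) ?F"
      by (intro tendsto_intros)
    then have "(?w \<longlongrightarrow> 0) ?F" by simp
    moreover have "\<forall>\<^sub>F q in ?F. norm (mgaussian \<nu> (fst q) (snd q) - mgaussian \<nu> (fst p) (snd q)) \<le> ?w q"
      unfolding eventually_at_filter using C p by (auto intro!: always_eventually)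
    ultimately have 1: "((\<lambda>q. mgaussian \<nu> (fst q) (snd q) - mgaussian \<nu> (fst p) (snd q)) \<longlongrightarrow> 0) ?F"
      by (rule Lim_null_comparison[rotated])
    have "continuous_on UNIV (mgaussian \<nu> (fst p))"
      unfolding mgaussian_def
      by (intro continuous_intros bounded_linear.continuous_on[OF matrix_vector_mul_bounded_linear])
    then have "isCont (mgaussian \<nu> (fst p)) (snd p)" by (simp add: continuous_on_eq_continuous_at)
    then have 2: "((\<lambda>q. mgaussian \<nu> (fst p) (snd q)) \<longlongrightarrow> mgaussian \<nu> (fst p) (snd p)) ?F"
      by (rule isCont_tendsto_compose) (intro tendsto_intros)
    from tendsto_add[OF 1 2]
    show "((\<lambda>(m, v). mgaussian \<nu> m v) \<longlongrightarrow> (\<lambda>(m, v). mgaussian \<nu> m v) p) ?F"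
      by (simp add: case_prod_unfold)
  qed
qed

text \<open>Continuity is available only on the admissible set, so the Gaussian is extended by zero
  off this closed set and the composition is compared with the extension.\<close>

lemma borel_measurable_mgaussian:
  assumes "0 < al" "0 < \<alpha>" "0 \<le> R"
    and m [measurable]: "m \<in> borel_measurable M" and v [measurable]: "v \<in> borel_measurable M"
    and mem: "\<And>x. x \<in> space M \<Longrightarrow> m x \<in> admissible \<nu> \<alpha> al au R"
  shows "(\<lambda>x. mgaussian \<nu> (m x) (v x)) \<in> borel_measurable M"
proof -
  let ?S = "admissible \<nu> \<alpha> al au R \<times> (UNIV :: vel set)"
  have "closed ?S" using closed_admissible[OF assms(1)] by (intro closed_Times) auto
  then have "?S \<in> sets borel" by (rule borel_closed)
  then have meas: "(\<lambda>p. indicator ?S p *\<^sub>R (\<lambda>(m, v). mgaussian \<nu> m v) p) \<in> borel_measurable borel"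
    by (rule borel_measurable_continuous_on_indicator[OF _ continuous_on_mgaussian[OF assms(1-3)]])
  have "(\<lambda>x. (m x, v x)) \<in> borel_measurable M" by measurable
  from measurable_compose[OF this meas]
  have "(\<lambda>x. indicator ?S (m x, v x) *\<^sub>R mgaussian \<nu> (m x) (v x)) \<in> borel_measurable M"
    by simp
  moreover have "(\<lambda>x. indicator ?S (m x, v x) *\<^sub>R mgaussian \<nu> (m x) (v x)) \<in> borel_measurable M
    \<longleftrightarrow> ?thesis" by (rule measurable_cong) (use mem in auto)
  ultimately show ?thesis by simp
qed

section \<open>Moments of velocity distributions\<close>

text \<open>Collecting mass, momentum and second moments in one vector makes \<open>moment\<close> a
  single Bochner integral, to which norm estimates apply at once.\<close>

definition mvec :: "vel \<Rightarrow> moments" where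
  "mvec v = (1, v, \<chi> i j. v $ i * v $ j)"

definition moment :: "(vel \<Rightarrow> real) \<Rightarrow> moments" where
  "moment g = (LINT v|lborel. g v *\<^sub>R mvec v)"

lemma borel_measurable_mvec [measurable]: "mvec \<in> borel_measurable borel"
  unfolding mvec_def by (intro borel_measurable_continuous_onI continuous_intros)

text \<open>With \<open>s\<close> the squared speed, the squared norm is
  \<open>1 + s + s * s\<close>, at most the square of \<open>1 + s\<close>. The weight of
  \<open>L12\<close> thus controls all moments together.\<close>

lemma norm_mvec_le: "norm (mvec v) \<le> 1 + (norm v)\<^sup>2"
proof -
  have "(norm (\<chi> i j. v $ i * v $ j))\<^sup>2 = (\<Sum>i\<in>UNIV. \<Sum>j\<in>UNIV. (v $ i)\<^sup>2 * (v $ j)\<^sup>2)"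
    by (simp add: norm_vec_def L2_set_def sum_nonneg power_mult_distrib)
  also have "\<dots> = (norm v)\<^sup>2 * (norm v)\<^sup>2"
    by (simp add: norm_vec_def L2_set_def sum_nonneg sum_product)
  finally have *: "(norm (\<chi> i j. v $ i * v $ j))\<^sup>2 = (norm v)\<^sup>2 * (norm v)\<^sup>2" .
  have "(norm (mvec v))\<^sup>2 = 1 + (norm v)\<^sup>2 + (norm v)\<^sup>2 * (norm v)\<^sup>2"
    by (simp add: mvec_def norm_Pair *)
  also have "\<dots> \<le> (1 + (norm v)\<^sup>2)\<^sup>2" by (simp add: power2_eq_square algebra_simps)
  finally show ?thesis by (rule power2_le_imp_le) auto
qed

lemma L12_measurable:
  assumes "g \<in> L12" shows "g \<in> borel_measurable lborel"
proof -
  have "(\<lambda>v. (1 + (norm v)\<^sup>2) * g v) \<in> borel_measurable lborel"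
    using assms by (auto simp: L12_def)
  then have "(\<lambda>v. (1 + (norm v)\<^sup>2) * g v / (1 + (norm v)\<^sup>2)) \<in> borel_measurable lborel"
    by measurable
  moreover have "1 + (norm v)\<^sup>2 \<noteq> 0" for v :: vel by (smt (verit) zero_le_power2)
  ultimately show ?thesis by simp
qed

lemma L12_integrable_scaleR:
  fixes p :: "vel \<Rightarrow> 'b::{banach, second_countable_topology}"
  assumes "g \<in> L12" "p \<in> borel_measurable borel" "\<And>v. norm (p v) \<le> C * (1 + (norm v)\<^sup>2)"
  shows "integrable lborel (\<lambda>v. g v *\<^sub>R p v)"
proof (rule Bochner_Integration.integrable_bound)
  show "integrable lborel (\<lambda>v. C * ((1 + (norm v)\<^sup>2) * g v))"
    using assms(1) by (auto simp: L12_def)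
  show "(\<lambda>v. g v *\<^sub>R p v) \<in> borel_measurable lborel"
    using assms L12_measurable[OF assms(1)] by (intro borel_measurable_scaleR) auto
  have "norm (g v *\<^sub>R p v) \<le> norm (C * ((1 + (norm v)\<^sup>2) * g v))" for v
  proof -
    have "\<bar>g v\<bar> * norm (p v) \<le> \<bar>g v\<bar> * (C * (1 + (norm v)\<^sup>2))"
      using assms(3) by (intro mult_left_mono) auto
    also have "\<dots> = norm (C * ((1 + (norm v)\<^sup>2) * g v))"
    proof -
      have "0 \<le> C * (1 + (norm v)\<^sup>2)" using assms(3)[of v] norm_ge_zero[of "p v"] by linarith
      then show ?thesis by (metis abs_mult abs_of_nonneg mult.assoc mult.commute real_norm_def)
    qed
    finally show ?thesis by simp
  qed
  then show "AE v in lborel. norm (g v *\<^sub>R p v) \<le> norm (C * ((1 + (norm v)\<^sup>2) * g v))" by simp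
qed

lemma abs_le_one_plus_square: "\<bar>x\<bar> \<le> 1 + y\<^sup>2" if "\<bar>x\<bar> \<le> y" for x y :: real
proof -
  have "0 \<le> (1 - y)\<^sup>2" "0 \<le> y\<^sup>2" by auto
  then show ?thesis using that by (auto simp: power2_eq_square algebra_simps)
qed

lemma abs_mult_component_le: "\<bar>v $ i * v $ j\<bar> \<le> (norm (v::real^'n))\<^sup>2"
  unfolding abs_mult power2_eq_square
  by (intro mult_mono component_le_norm_cart) auto

lemma L12_integrable:
  assumes "g \<in> L12"
  shows "integrable lborel g" "integrable lborel (\<lambda>v. g v * (norm v)\<^sup>2)"
    "integrable lborel (\<lambda>v. g v * v $ i)" "integrable lborel (\<lambda>v. g v * (v $ i * v $ j))"
    "integrable lborel (\<lambda>v. g v * \<bar>v $ i\<bar>)"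
    "integrable lborel (\<lambda>v. g v *\<^sub>R v)" "integrable lborel (\<lambda>v. g v *\<^sub>R mvec v)"
proof -
  note * = L12_integrable_scaleR[OF assms, of _ 1]
  show "integrable lborel g" using *[of "\<lambda>v. 1 :: real"] by simp
  show "integrable lborel (\<lambda>v. g v * (norm v)\<^sup>2)" using *[of "\<lambda>v. (norm v)\<^sup>2"] by simp
  show "integrable lborel (\<lambda>v. g v * v $ i)" "integrable lborel (\<lambda>v. g v * \<bar>v $ i\<bar>)"
    using *[of "\<lambda>v. v $ i"] *[of "\<lambda>v. \<bar>v $ i\<bar>"] abs_le_one_plus_square[OF component_le_norm_cart]
    by auto
  show "integrable lborel (\<lambda>v. g v * (v $ i * v $ j))"
  proof (rule *[of "\<lambda>v. v $ i * v $ j", unfolded real_scaleR_def])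
    show "norm (v $ i * v $ j) \<le> 1 * (1 + (norm v)\<^sup>2)" for v :: vel
      using abs_mult_component_le[of v i j] by simp
  qed auto
  show "integrable lborel (\<lambda>v. g v *\<^sub>R v)"
  proof (rule *)
    show "norm v \<le> 1 * (1 + (norm v)\<^sup>2)" for v :: vel
      using abs_le_one_plus_square[of "norm v" "norm v"] by simp
  qed auto
  show "integrable lborel (\<lambda>v. g v *\<^sub>R mvec v)"
    using *[of mvec] norm_mvec_le by auto
qed

lemma moment_components:
  assumes "g \<in> L12"
  shows "fst (moment g) = (LINT v|lborel. g v)"
    "fst (snd (moment g)) = (LINT v|lborel. g v *\<^sub>R v)"
    "snd (snd (moment g)) $ i $ j = (LINT v|lborel. g v * (v $ i * v $ j))"
proof -
  note i = L12_integrable(7)[OF assms]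
  show "fst (moment g) = (LINT v|lborel. g v)"
    using integral_bounded_linear[OF bounded_linear_fst i] by (simp add: moment_def mvec_def)
  have "bounded_linear (\<lambda>m :: moments. fst (snd m))"
    by (intro bounded_linear_intros)
  from integral_bounded_linear[OF this i]
  show "fst (snd (moment g)) = (LINT v|lborel. g v *\<^sub>R v)"
    by (simp add: moment_def mvec_def)
  have "bounded_linear (\<lambda>m :: moments. snd (snd m) $ i $ j)"
    by (intro bounded_linear_compose[OF bounded_linear_vec_nth]
        bounded_linear_compose[OF bounded_linear_snd] bounded_linear_snd)
  from integral_bounded_linear[OF this i]
  show "snd (snd (moment g)) $ i $ j = (LINT v|lborel. g v * (v $ i * v $ j))"
    by (simp add: moment_def mvec_def)
qed

lemma density_eq_moment: "g \<in> L12 \<Longrightarrow> density g = fst (moment g)"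
  by (simp add: density_def moment_components)

lemma bulk_eq_mbulk: "g \<in> L12 \<Longrightarrow> bulk g = mbulk (moment g)"
  by (simp add: bulk_def mbulk_def moment_components density_def)

lemma integral_centered:
  assumes "g \<in> L12" "density g \<noteq> 0"
  shows "integrable lborel (\<lambda>v. g v * ((v - bulk g) $ i * (v - bulk g) $ j))"
    "(LINT v|lborel. g v * ((v - bulk g) $ i * (v - bulk g) $ j)) = density g * mstress (moment g) $ i $ j"
proof -
  let ?U = "bulk g"
  note int = L12_integrable[OF assms(1)]
  have eq: "g v * ((v - ?U) $ i * (v - ?U) $ j) =
      g v * (v $ i * v $ j) - ?U $ j * (g v * v $ i) - ?U $ i * (g v * v $ j) + ?U $ i * ?U $ j * g v" for v
    by (simp add: algebra_simps)
  show "integrable lborel (\<lambda>v. g v * ((v - ?U) $ i * (v - ?U) $ j))"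
    unfolding eq using int by auto
  have U: "(LINT v|lborel. g v * v $ i) = density g * ?U $ i" for i
    using integral_bounded_linear[OF bounded_linear_vec_nth int(6), of i] assms(2)
    by (simp add: bulk_def)
  have "(LINT v|lborel. g v * ((v - ?U) $ i * (v - ?U) $ j)) =
      (LINT v|lborel. g v * (v $ i * v $ j)) - ?U $ j * (LINT v|lborel. g v * v $ i)
      - ?U $ i * (LINT v|lborel. g v * v $ j) + ?U $ i * ?U $ j * (LINT v|lborel. g v)"
    unfolding eq using int by simp
  also have "\<dots> = (LINT v|lborel. g v * (v $ i * v $ j)) - density g * (?U $ i * ?U $ j)"
    unfolding U by (simp add: density_def)
  also have "\<dots> = density g * mstress (moment g) $ i $ j"
    using assms by (simp add: mstress_def moment_components bulk_eq_mbulk density_def field_simps)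
  finally show "(LINT v|lborel. g v * ((v - ?U) $ i * (v - ?U) $ j)) = density g * mstress (moment g) $ i $ j" .
qed

lemma integral_norm_centered:
  assumes "g \<in> L12" "density g \<noteq> 0"
  shows "integrable lborel (\<lambda>v. g v * (norm (v - bulk g))\<^sup>2)"
    "(LINT v|lborel. g v * (norm (v - bulk g))\<^sup>2) = density g * trace (mstress (moment g))"
proof -
  have eq: "g v * (norm (v - bulk g))\<^sup>2 = (\<Sum>i\<in>UNIV. g v * ((v - bulk g) $ i * (v - bulk g) $ i))" for v
    by (simp add: power2_norm_eq_inner inner_vec_def sum_distrib_left)
  show "integrable lborel (\<lambda>v. g v * (norm (v - bulk g))\<^sup>2)"
    unfolding eq by (intro Bochner_Integration.integrable_sum integral_centered assms)
  show "(LINT v|lborel. g v * (norm (v - bulk g))\<^sup>2) = density g * trace (mstress (moment g))"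
    unfolding eq
    by (simp add: Bochner_Integration.integral_sum integral_centered[OF assms] trace_def sum_distrib_left
        del: vector_minus_component)
qed

lemma temperature_tensor_eq:
  assumes "g \<in> L12" "density g \<noteq> 0"
  shows "temperature_tensor \<nu> g = mtensor \<nu> (moment g)"
proof -
  have "stress g = mstress (moment g)"
    using assms(2) by (simp add: stress_def vec_eq_iff integral_centered[OF assms] del: vector_minus_component)
  moreover have "temperature g = trace (mstress (moment g)) / 3"
    using assms(2) by (simp add: temperature_def integral_norm_centered[OF assms])
  ultimately show ?thesis by (simp add: temperature_tensor_def mtensor_def)
qed

lemma gaussian_eq_mgaussian:
  assumes "g \<in> L12" "density g \<noteq> 0"
  shows "gaussian \<nu> g v = mgaussian \<nu> (moment g) v"
  unfolding gaussian_def mgaussian_def temperature_tensor_eq[OF assms] bulk_eq_mbulk[OF assms(1)]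
    density_eq_moment[OF assms(1)] ..

section \<open>Lower bounds on temperature and tensor, and continuity of the moments\<close>

lemma quadratic_form_mstress:
  assumes "g \<in> L12" "density g \<noteq> 0"
  shows "integrable lborel (\<lambda>v. g v * (\<xi> \<bullet> (v - bulk g))\<^sup>2)"
    "(LINT v|lborel. g v * (\<xi> \<bullet> (v - bulk g))\<^sup>2) = density g * (\<xi> \<bullet> (mstress (moment g) *v \<xi>))"
proof -
  have eq: "g v * (\<xi> \<bullet> (v - bulk g))\<^sup>2 =
      (\<Sum>i\<in>UNIV. \<Sum>j\<in>UNIV. \<xi> $ i * \<xi> $ j * (g v * ((v - bulk g) $ i * (v - bulk g) $ j)))" for v
    unfolding power2_eq_square inner_vec_def sum_product
    by (simp add: sum_distrib_left mult_ac del: vector_minus_component)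
  show "integrable lborel (\<lambda>v. g v * (\<xi> \<bullet> (v - bulk g))\<^sup>2)"
    unfolding eq by (intro Bochner_Integration.integrable_sum integrable_mult_right integral_centered assms)
  have "(LINT v|lborel. g v * (\<xi> \<bullet> (v - bulk g))\<^sup>2) =
      (\<Sum>i\<in>UNIV. \<Sum>j\<in>UNIV. \<xi> $ i * \<xi> $ j * (density g * mstress (moment g) $ i $ j))"
    unfolding eq
    by (simp add: Bochner_Integration.integral_sum Bochner_Integration.integrable_sum
        integral_centered[OF assms] del: vector_minus_component)
  also have "\<dots> = density g * (\<xi> \<bullet> (mstress (moment g) *v \<xi>))"
    unfolding inner_vec_def matrix_vector_mult_def vec_lambda_beta inner_real_def sum_distrib_left
    by (simp add: mult_ac)
  finally show "(LINT v|lborel. g v * (\<xi> \<bullet> (v - bulk g))\<^sup>2) = density g * (\<xi> \<bullet> (mstress (moment g) *v \<xi>))" .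
qed

text \<open>For a nonnegative distribution, \<open>\<xi> \<bullet> \<Theta>\<xi>\<close> lies between \<open>0\<close> and \<open>3T \<bar>\<xi>\<bar>\<^sup>2\<close>, so the
  convex (or, for \<open>\<nu> < 0\<close>, merely affine) combination with \<open>T\<close> stays above a multiple of \<open>T\<close>.\<close>

lemma coercive_mtensor:
  assumes g: "g \<in> L12" "AE v in lborel. 0 \<le> g v" "0 < density g"
    and \<nu>: "- 1 / 2 < \<nu>" "\<nu> < 1"
  shows "coercive (min (1 - \<nu>) (1 + 2 * \<nu>) * (trace (mstress (moment g)) / 3)) (mtensor \<nu> (moment g))"
  unfolding coercive_def
proof
  fix \<xi> :: vel
  have d: "density g \<noteq> 0" using g by simp
  let ?T = "trace (mstress (moment g)) / 3" and ?Q = "\<xi> \<bullet> (mstress (moment g) *v \<xi>)"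
  have "0 \<le> density g * ?Q"
    unfolding quadratic_form_mstress(2)[OF g(1) d, symmetric]
    by (rule integral_nonneg_AE) (use g(2) in auto)
  then have Q0: "0 \<le> ?Q" using g(3) by (simp add: zero_le_mult_iff)
  have "density g * ?Q \<le> (LINT v|lborel. (norm \<xi>)\<^sup>2 * (g v * (norm (v - bulk g))\<^sup>2))"
    unfolding quadratic_form_mstress(2)[OF g(1) d, symmetric]
  proof (intro integral_mono_AE quadratic_form_mstress integrable_mult_right integral_norm_centered g(1) d)
    show "AE v in lborel. g v * (\<xi> \<bullet> (v - bulk g))\<^sup>2 \<le> (norm \<xi>)\<^sup>2 * (g v * (norm (v - bulk g))\<^sup>2)"
      using g(2)
    proof eventually_elim
      case (elim v)
      have "(\<xi> \<bullet> (v - bulk g))\<^sup>2 \<le> (norm \<xi> * norm (v - bulk g))\<^sup>2"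
        using Cauchy_Schwarz_ineq2[of \<xi> "v - bulk g"] by (metis abs_ge_zero power2_abs power_mono)
      then have "g v * (\<xi> \<bullet> (v - bulk g))\<^sup>2 \<le> g v * (norm \<xi> * norm (v - bulk g))\<^sup>2"
        using elim by (rule mult_left_mono)
      then show ?case by (simp add: power_mult_distrib mult_ac)
    qed
  qed
  then have "density g * ?Q \<le> density g * (3 * ?T * (norm \<xi>)\<^sup>2)"
    unfolding integral_mult_right_zero integral_norm_centered[OF g(1) d] by (simp add: mult_ac)
  then have Q1: "?Q \<le> 3 * ?T * (norm \<xi>)\<^sup>2" using g(3) by simp
  have eq: "\<xi> \<bullet> (mtensor \<nu> (moment g) *v \<xi>) = (1 - \<nu>) * ?T * (norm \<xi>)\<^sup>2 + \<nu> * ?Q"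
    by (simp add: mtensor_def matrix_vector_mult_add_rdistrib inner_add_right power2_norm_eq_inner
        flip: scaleR_matrix_vector_assoc)
  have T: "0 \<le> ?T * (norm \<xi>)\<^sup>2" using Q0 Q1 by simp
  show "min (1 - \<nu>) (1 + 2 * \<nu>) * ?T * (norm \<xi>)\<^sup>2 \<le> \<xi> \<bullet> (mtensor \<nu> (moment g) *v \<xi>)"
  proof (cases "0 \<le> \<nu>")
    case True
    have "min (1 - \<nu>) (1 + 2 * \<nu>) * (?T * (norm \<xi>)\<^sup>2) \<le> (1 - \<nu>) * (?T * (norm \<xi>)\<^sup>2)"
      using T by (intro mult_right_mono) auto
    then show ?thesis unfolding eq using Q0 True by (simp add: mult_ac add_increasing2)
  next
    case False
    have "min (1 - \<nu>) (1 + 2 * \<nu>) * (?T * (norm \<xi>)\<^sup>2) \<le> (1 + 2 * \<nu>) * (?T * (norm \<xi>)\<^sup>2)"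
      using T by (intro mult_right_mono) auto
    also have "\<dots> = (1 - \<nu>) * ?T * (norm \<xi>)\<^sup>2 + \<nu> * (3 * ?T * (norm \<xi>)\<^sup>2)"
      by (simp add: field_simps)
    also have "\<dots> \<le> \<xi> \<bullet> (mtensor \<nu> (moment g) *v \<xi>)"
      unfolding eq using Q1 False by (intro add_left_mono mult_left_mono_neg) auto
    finally show ?thesis by (simp add: mult_ac)
  qed
qed

text \<open>A vanishing variance would confine \<open>g\<close> to the single velocity
  \<open>bulk g\<close>, a null set, and so make its density zero.\<close>

lemma mtensor_trace_pos:
  assumes g: "g \<in> L12" "AE v in lborel. 0 \<le> g v" "0 < density g"
  shows "0 < trace (mstress (moment g))"
proof -
  have d: "density g \<noteq> 0" using g by simp
  have nn: "AE v in lborel. 0 \<le> g v * (norm (v - bulk g))\<^sup>2" using g(2) by eventually_elim auto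
  have "(LINT v|lborel. g v * (norm (v - bulk g))\<^sup>2) \<noteq> 0"
  proof
    assume "(LINT v|lborel. g v * (norm (v - bulk g))\<^sup>2) = 0"
    then have "AE v in lborel. g v * (norm (v - bulk g))\<^sup>2 = 0"
      using integral_nonneg_eq_0_iff_AE[OF integral_norm_centered(1)[OF g(1) d] nn] by simp
    moreover have "AE v in lborel. v \<noteq> bulk g" by (rule AE_lborel_singleton)
    ultimately have "AE v in lborel. g v = 0" by eventually_elim auto
    then have "density g = 0" unfolding density_def by (rule integral_eq_zero_AE)
    then show False using g by simp
  qed
  moreover have "0 \<le> (LINT v|lborel. g v * (norm (v - bulk g))\<^sup>2)"
    using nn by (rule integral_nonneg_AE)
  ultimately have "0 < density g * trace (mstress (moment g))"
    unfolding integral_norm_centered(2)[OF g(1) d] by linarith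
  then show ?thesis using g(3) by (simp add: zero_less_mult_iff)
qed

text \<open>Qualitative positivity of the temperature is enough here. This serves for solutions not
  yet known to satisfy a quantitative lower bound.\<close>

lemma gaussian_nonneg:
  assumes g: "g \<in> L12" "AE v in lborel. 0 \<le> g v" "0 < density g"
    and \<nu>: "- 1 / 2 < \<nu>" "\<nu> < 1"
  shows "0 \<le> gaussian \<nu> g v"
proof -
  have "0 < mgaussian \<nu> (moment g) v"
    using coercive_mtensor[OF g \<nu>] 
  proof (rule mgaussian_pos)
    show "0 < min (1 - \<nu>) (1 + 2 * \<nu>) * (trace (mstress (moment g)) / 3)"
      using mtensor_trace_pos[OF g] \<nu> by (intro mult_pos_pos) auto
    show "0 < fst (moment g)" using g density_eq_moment by simp
  qed
  then show ?thesis using gaussian_eq_mgaussian[OF g(1)] g(3) by simp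
qed

lemma moment_dist_le:
  assumes "g \<in> L12" "h \<in> L12"
  shows "integrable lborel (\<lambda>v. \<bar>g v - h v\<bar> * (1 + (norm v)\<^sup>2))"
    "dist (moment g) (moment h) \<le> (LINT v|lborel. \<bar>g v - h v\<bar> * (1 + (norm v)\<^sup>2))"
proof -
  have "integrable lborel (\<lambda>v. (1 + (norm v)\<^sup>2) * g v - (1 + (norm v)\<^sup>2) * h v)"
    using assms by (intro Bochner_Integration.integrable_diff) (auto simp: L12_def)
  then have "integrable lborel (\<lambda>v. \<bar>(1 + (norm v)\<^sup>2) * g v - (1 + (norm v)\<^sup>2) * h v\<bar>)" by simp
  moreover have "\<bar>(1 + (norm v)\<^sup>2) * g v - (1 + (norm v)\<^sup>2) * h v\<bar> = \<bar>g v - h v\<bar> * (1 + (norm v)\<^sup>2)" for v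
  proof -
    have "(1 + (norm v)\<^sup>2) * g v - (1 + (norm v)\<^sup>2) * h v = (g v - h v) * (1 + (norm v)\<^sup>2)"
      by (simp add: algebra_simps)
    then show ?thesis by (simp add: abs_mult)
  qed
  ultimately show int: "integrable lborel (\<lambda>v. \<bar>g v - h v\<bar> * (1 + (norm v)\<^sup>2))" by simp
  have "moment g - moment h = (LINT v|lborel. (g v - h v) *\<^sub>R mvec v)"
    using L12_integrable(7)[OF assms(1)] L12_integrable(7)[OF assms(2)]
    by (simp add: moment_def scaleR_diff_left)
  then have "dist (moment g) (moment h) \<le> (LINT v|lborel. norm ((g v - h v) *\<^sub>R mvec v))"
    by (simp add: dist_norm integral_norm_bound del: norm_scaleR)
  also have "\<dots> \<le> (LINT v|lborel. \<bar>g v - h v\<bar> * (1 + (norm v)\<^sup>2))"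
  proof (rule integral_mono)
    show "integrable lborel (\<lambda>v. norm ((g v - h v) *\<^sub>R mvec v))"
      using L12_integrable(7)[OF assms(1)] L12_integrable(7)[OF assms(2)]
      by (intro integrable_norm) (simp add: scaleR_diff_left)
    show "norm ((g v - h v) *\<^sub>R mvec v) \<le> \<bar>g v - h v\<bar> * (1 + (norm v)\<^sup>2)" for v
      using norm_mvec_le[of v] by (simp add: mult_left_mono)
  qed (rule int)
  finally show "dist (moment g) (moment h) \<le> (LINT v|lborel. \<bar>g v - h v\<bar> * (1 + (norm v)\<^sup>2))" .
qed

lemma norm_moment_le:
  assumes "g \<in> L12" "AE v in lborel. 0 \<le> g v"
  shows "norm (moment g) \<le> (LINT v|lborel. g v) + (LINT v|lborel. g v * (norm v)\<^sup>2)"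
proof -
  have "(\<lambda>v. 0) \<in> L12" by (simp add: L12_def)
  from moment_dist_le(2)[OF assms(1) this]
  have "norm (moment g) \<le> (LINT v|lborel. \<bar>g v\<bar> * (1 + (norm v)\<^sup>2))"
    by (simp add: moment_def)
  also have "\<dots> = (LINT v|lborel. g v + g v * (norm v)\<^sup>2)"
    using L12_measurable[OF assms(1)] assms(2)
    by (intro integral_cong_AE) (auto simp: algebra_simps)
  also have "\<dots> = (LINT v|lborel. g v) + (LINT v|lborel. g v * (norm v)\<^sup>2)"
    using L12_integrable[OF assms(1)] by simp
  finally show ?thesis .
qed

text \<open>Cauchy--Schwarz gives \<open>(P + N)\<^sup>2 \<le> \<rho> \<integral>g v\<^sub>1\<^sup>2\<close> for the two half-space fluxes
  \<open>P\<close> and \<open>N\<close>, whereas the momentum is \<open>P - N\<close>.\<close>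

lemma flux_product_le:
  fixes k :: 3
  assumes g: "g \<in> L12" "AE v in lborel. 0 \<le> g v" "0 < density g"
  shows "4 * ((LINT v|lborel. g v * \<bar>v $ k\<bar> * indicator {v. 0 < v $ k} v) *
      (LINT v|lborel. g v * \<bar>v $ k\<bar> * indicator {v. v $ k < 0} v))
    \<le> (LINT v|lborel. g v) * (LINT v|lborel. g v * (v $ k * v $ k)) - (LINT v|lborel. g v * v $ k)\<^sup>2"
proof -
  note int = L12_integrable[OF g(1)]
  let ?P = "LINT v|lborel. g v * \<bar>v $ k\<bar> * indicator {v. 0 < v $ k} v"
  let ?N = "LINT v|lborel. g v * \<bar>v $ k\<bar> * indicator {v. v $ k < 0} v"
  let ?S = "LINT v|lborel. g v * (v $ k * v $ k)"
  have iP: "integrable lborel (\<lambda>v. g v * \<bar>v $ k\<bar> * indicator {v. 0 < v $ k} v)"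
    and iN: "integrable lborel (\<lambda>v. g v * \<bar>v $ k\<bar> * indicator {v. v $ k < 0} v)"
    by (intro integrable_real_mult_indicator int(5); measurable)+
  have sum: "(LINT v|lborel. g v * \<bar>v $ k\<bar>) = ?P + ?N"
    by (subst Bochner_Integration.integral_add[OF iP iN, symmetric])
      (intro Bochner_Integration.integral_cong, auto simp: indicator_def)
  have diff: "(LINT v|lborel. g v * v $ k) = ?P - ?N"
    by (subst Bochner_Integration.integral_diff[OF iP iN, symmetric])
      (intro Bochner_Integration.integral_cong, auto simp: indicator_def)
  define \<rho> where "\<rho> = (LINT v|lborel. g v)"
  have \<rho>: "0 < \<rho>" using g(3) by (simp add: \<rho>_def density_def)
  \<comment> \<open>The minimiser of the quadratic in \<open>t\<close>, namely the mean of
    \<open>\<bar>v $ k\<bar>\<close>; inserting it turns nonnegativity into Cauchy-Schwarz.\<close>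
  define t where "t = (?P + ?N) / \<rho>"
  have "0 \<le> (LINT v|lborel. g v * (\<bar>v $ k\<bar> - t)\<^sup>2)"
    by (rule integral_nonneg_AE) (use g(2) in auto)
  also have "\<dots> = (LINT v|lborel. g v * (v $ k * v $ k) - 2 * t * (g v * \<bar>v $ k\<bar>) + t\<^sup>2 * g v)"
    by (intro Bochner_Integration.integral_cong) (auto simp: power2_eq_square algebra_simps)
  also have "\<dots> = ?S - 2 * t * (?P + ?N) + t\<^sup>2 * \<rho>"
    using int by (simp add: sum \<rho>_def)
  finally have "0 \<le> \<rho> * (?S - 2 * t * (?P + ?N) + t\<^sup>2 * \<rho>)" using \<rho> by simp
  also have "\<dots> = \<rho> * ?S - (?P + ?N)\<^sup>2"
    using \<rho> by (simp add: t_def power2_eq_square field_simps)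
  finally have "(?P + ?N)\<^sup>2 \<le> \<rho> * ?S" by simp
  then show ?thesis unfolding diff \<rho>_def[symmetric] by (simp add: power2_eq_square algebra_simps)
qed

text \<open>Dividing the hypothesis on direction \<open>k\<close> by the squared density bounds one
  diagonal stress entry below by \<open>\<gamma> / au\<^sup>2\<close>; the other diagonal entries
  are nonnegative, so the trace is no smaller, and the temperature is a third of it. The factor
  \<open>min (1 - \<nu>) (1 + 2 * \<nu>)\<close> is the loss in passing from temperature to
  tensor.\<close>

lemma moment_admissible:
  assumes g: "g \<in> L12" "AE v in lborel. 0 \<le> g v"
    and \<nu>: "- 1 / 2 < \<nu>" "\<nu> < 1" and pos: "0 < al" "0 < \<gamma>"
    and bounds: "al \<le> (LINT v|lborel. g v)" "(LINT v|lborel. g v) \<le> au"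
      "(LINT v|lborel. g v * (norm v)\<^sup>2) \<le> cu"
    and \<gamma>: "\<gamma> \<le> (LINT v|lborel. g v) * (LINT v|lborel. g v * (v $ k * v $ k)) - (LINT v|lborel. g v * v $ k)\<^sup>2"
  shows "moment g \<in> admissible \<nu> (min (1 - \<nu>) (1 + 2 * \<nu>) * (\<gamma> / (3 * au\<^sup>2))) al au (au + cu)"
proof -
  define \<rho> where "\<rho> = (LINT v|lborel. g v)"
  have \<rho>: "0 < \<rho>" "\<rho> \<le> au" "density g = \<rho>" using pos bounds by (auto simp: \<rho>_def density_def)
  then have d: "density g \<noteq> 0" "0 < density g" by auto
  have mb: "mbulk (moment g) $ k = (LINT v|lborel. g v * v $ k) / \<rho>"
    using integral_bounded_linear[OF bounded_linear_vec_nth L12_integrable(6)[OF g(1)], of k]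
    by (simp add: mbulk_def moment_components[OF g(1)] \<rho>_def)
  have "mstress (moment g) $ k $ k = ((LINT v|lborel. g v) * (LINT v|lborel. g v * (v $ k * v $ k))
      - (LINT v|lborel. g v * v $ k)\<^sup>2) / \<rho>\<^sup>2"
    using \<rho>(1) by (simp add: mstress_def mb moment_components[OF g(1)] \<rho>_def[symmetric] field_simps power2_eq_square)
  also have "\<dots> \<ge> \<gamma> / au\<^sup>2"
    using \<gamma> \<rho> pos by (intro frac_le power_mono) auto
  finally have kk: "\<gamma> / au\<^sup>2 \<le> mstress (moment g) $ k $ k" .
  have "0 \<le> mstress (moment g) $ i $ i" for i
  proof -
    have "0 \<le> density g * mstress (moment g) $ i $ i"
      unfolding integral_centered(2)[OF g(1) d(1), symmetric]
      by (rule integral_nonneg_AE) (use g(2) in auto)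
    then show ?thesis using d(2) by (simp add: zero_le_mult_iff)
  qed
  then have "mstress (moment g) $ k $ k \<le> trace (mstress (moment g))"
    unfolding trace_def by (intro member_le_sum) auto
  with kk have "min (1 - \<nu>) (1 + 2 * \<nu>) * (\<gamma> / au\<^sup>2 / 3) \<le>
      min (1 - \<nu>) (1 + 2 * \<nu>) * (trace (mstress (moment g)) / 3)"
    using \<nu> by (intro mult_left_mono) auto
  then have "min (1 - \<nu>) (1 + 2 * \<nu>) * (\<gamma> / (3 * au\<^sup>2)) \<le>
      min (1 - \<nu>) (1 + 2 * \<nu>) * (trace (mstress (moment g)) / 3)" by (simp add: mult.commute)
  then have "coercive (min (1 - \<nu>) (1 + 2 * \<nu>) * (\<gamma> / (3 * au\<^sup>2))) (mtensor \<nu> (moment g))"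
    using coercive_mtensor[OF g d(2) \<nu>] unfolding coercive_def
    by (meson mult_right_mono order_trans zero_le_power2)
  moreover have "norm (moment g) \<le> au + cu" using norm_moment_le[OF g] bounds by linarith
  ultimately show ?thesis using bounds by (simp add: admissible_def moment_components[OF g(1)])
qed

section \<open>Gaussian weights\<close>

lemma integrable_exp_norm_square:
  assumes "0 < e"
  shows "integrable lborel (\<lambda>v :: 'a::euclidean_space. exp (- e * (norm v)\<^sup>2))"
proof (rule integrableI_bounded)
  have "exp (- e * (norm v)\<^sup>2) = (\<Prod>b\<in>Basis. exp (- e * (v \<bullet> b)\<^sup>2))" for v :: 'a
  proof -
    have "(norm v)\<^sup>2 = (\<Sum>b\<in>Basis. (v \<bullet> b)\<^sup>2)"
      unfolding power2_norm_eq_inner by (subst euclidean_inner) (simp add: power2_eq_square)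
    then show ?thesis by (simp add: exp_sum sum_distrib_left flip: sum_negf)
  qed
  then have "(\<integral>\<^sup>+v. ennreal (norm (exp (- e * (norm v)\<^sup>2))) \<partial>(lborel :: 'a measure))
      = (\<integral>\<^sup>+v. (\<Prod>b\<in>Basis. ennreal (exp (- e * (v \<bullet> b)\<^sup>2))) \<partial>(lborel :: 'a measure))"
    by (simp add: prod_ennreal abs_prod)
  also have "\<dots> = (\<Prod>b\<in>(Basis::'a set). \<integral>\<^sup>+x. ennreal (exp (- e * x\<^sup>2)) \<partial>lborel)"
    by (rule nn_integral_lborel_prod[of "\<lambda>_ x. ennreal (exp (- e * x\<^sup>2))"]) auto
  also have "\<dots> < \<infinity>"
  proof -
    \<comment> \<open>The standard deviation for which the normal density has exponent
      \<open>- e * x\<^sup>2\<close>.\<close>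
    define \<sigma> where "\<sigma> = sqrt (1 / (2 * e))"
    have \<sigma>: "0 < \<sigma>" "\<sigma>\<^sup>2 = 1 / (2 * e)" using assms by (simp_all add: \<sigma>_def)
    have "integrable lborel (\<lambda>x. sqrt (2 * pi * \<sigma>\<^sup>2) * normal_density 0 \<sigma> x)"
      using \<sigma>(1) by simp
    moreover have "sqrt (2 * pi * \<sigma>\<^sup>2) * normal_density 0 \<sigma> x = exp (- e * x\<^sup>2)" for x
      using assms \<sigma>(1) unfolding normal_density_def \<sigma>(2) by simp
    ultimately have "integrable lborel (\<lambda>x::real. exp (- e * x\<^sup>2))" by simp
    then have "(\<integral>\<^sup>+x. ennreal (exp (- e * x\<^sup>2)) \<partial>(lborel :: real measure)) < \<infinity>"
      by (simp add: integrable_iff_bounded)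
    then show ?thesis by (simp add: power_less_top_ennreal)
  qed
  finally show "(\<integral>\<^sup>+v. ennreal (norm (exp (- e * (norm v)\<^sup>2))) \<partial>(lborel :: 'a measure)) < \<infinity>" .
qed measurable

definition weight :: "real \<Rightarrow> vel \<Rightarrow> real" where
  "weight e v = (1 + norm v)\<^sup>2 * exp (- e * (norm v)\<^sup>2)"

lemma weight_nonneg [simp]: "0 \<le> weight e v"
  by (simp add: weight_def)

lemma borel_measurable_weight [measurable]: "weight e \<in> borel_measurable borel"
  unfolding weight_def by measurable

lemma weight_L12:
  assumes "0 < e"
  shows "weight e \<in> L12"
proof -
  \<comment> \<open>Chosen so that
    \<open>1 + s \<le> K * (1 + e * s / 4) \<le> K * exp (e * s / 4)\<close> for the squared speed
    \<open>s\<close>; after squaring, the polynomial factors cost half of the Gaussian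
    decay.\<close>
  define K where "K = max 1 (4 / e)"
  have K: "1 \<le> K" "4 / e \<le> K" by (auto simp: K_def)
  have "integrable lborel (\<lambda>v :: vel. 2 * K\<^sup>2 * exp (- (e / 2) * (norm v)\<^sup>2))"
    using assms by (intro integrable_mult_right integrable_exp_norm_square) auto
  then have "integrable lborel (\<lambda>v. (1 + (norm v)\<^sup>2) * weight e v)"
  proof (rule Bochner_Integration.integrable_bound)
    have "norm ((1 + (norm v)\<^sup>2) * weight e v) \<le> norm (2 * K\<^sup>2 * exp (- (e / 2) * (norm v)\<^sup>2))" for v
    proof -
      let ?s = "(norm v)\<^sup>2"
      have "4 \<le> e * K" using K(2) assms by (simp add: field_simps)
      then have "4 * ?s \<le> e * K * ?s" by (intro mult_right_mono) auto
      then have "1 + ?s \<le> K * (1 + e * ?s / 4)" using K(1) by (simp add: algebra_simps)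
      also have "\<dots> \<le> K * exp (e * ?s / 4)" using K by (intro mult_left_mono exp_ge_add_one_self) auto
      finally have "(1 + ?s)\<^sup>2 \<le> (K * exp (e * ?s / 4))\<^sup>2" by (rule power_mono) auto
      also have "\<dots> = K\<^sup>2 * exp (e * ?s / 2)" by (simp add: power_mult_distrib flip: exp_double)
      finally have 1: "(1 + ?s)\<^sup>2 \<le> K\<^sup>2 * exp (e * ?s / 2)" .
      have "(1 + norm v)\<^sup>2 \<le> 2 * (1 + ?s)"
        using zero_le_power2[of "1 - norm v"] by (simp add: power2_eq_square algebra_simps)
      then have "(1 + ?s) * (1 + norm v)\<^sup>2 \<le> (1 + ?s) * (2 * (1 + ?s))"
        by (intro mult_left_mono) auto
      also have "\<dots> \<le> 2 * K\<^sup>2 * exp (e * ?s / 2)" using 1 by (simp add: power2_eq_square[of "1 + ?s"] algebra_simps)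
      finally have "(1 + ?s) * (1 + norm v)\<^sup>2 * exp (- e * ?s) \<le> 2 * K\<^sup>2 * exp (e * ?s / 2) * exp (- e * ?s)"
        by (intro mult_right_mono) auto
      also have "\<dots> = 2 * K\<^sup>2 * exp (- (e / 2) * ?s)" by (simp add: mult.assoc flip: exp_add)
      finally show ?thesis by (simp add: weight_def abs_mult mult.assoc)
    qed
    then show "AE v in lborel. norm ((1 + (norm v)\<^sup>2) * weight e v) \<le> norm (2 * K\<^sup>2 * exp (- (e / 2) * (norm v)\<^sup>2))"
      by simp
  qed measurable
  then show ?thesis by (simp add: L12_def)
qed

text \<open>Up to constants, \<open>min (1/a) (1/(\<tau>\<bar>v\<^sub>1\<bar>))\<close> is the total mass along a characteristic of the kernel
  of the gain term, whose density decays at rate \<open>a\<close> in the rescaled time \<open>1/(\<tau>\<bar>v\<^sub>1\<bar>)\<close>.\<close>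

definition slowing :: "real \<Rightarrow> real \<Rightarrow> real \<Rightarrow> real" where
  "slowing e a \<tau> = (LINT v|lborel. weight e v * min (1 / a) (1 / (\<tau> * \<bar>v $ 1\<bar>)) * (1 + (norm v)\<^sup>2))"

lemma slowing_integrable:
  assumes "0 < e" "0 < a" "0 < \<tau>"
  shows "integrable lborel (\<lambda>v :: vel. weight e v * min (1 / a) (1 / (\<tau> * \<bar>v $ 1\<bar>)) * (1 + (norm v)\<^sup>2))"
proof (rule Bochner_Integration.integrable_bound)
  show "integrable lborel (\<lambda>v :: vel. 1 / a * ((1 + (norm v)\<^sup>2) * weight e v))"
    using weight_L12[OF assms(1)] by (simp add: L12_def)
  show "AE v in lborel. norm (weight e v * min (1 / a) (1 / (\<tau> * \<bar>v $ 1\<bar>)) * (1 + (norm v)\<^sup>2))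
      \<le> norm (1 / a * ((1 + (norm v)\<^sup>2) * weight e v))"
  proof (intro AE_I2)
    fix v :: vel
    have "\<bar>min (1 / a) (1 / (\<tau> * \<bar>v $ 1\<bar>))\<bar> \<le> 1 / a" using assms by (auto simp: min_def)
    then have "weight e v * \<bar>min (1 / a) (1 / (\<tau> * \<bar>v $ 1\<bar>))\<bar> * (1 + (norm v)\<^sup>2)
      \<le> weight e v * (1 / a) * (1 + (norm v)\<^sup>2)"
      by (intro mult_right_mono mult_left_mono) auto
    then show "norm (weight e v * min (1 / a) (1 / (\<tau> * \<bar>v $ 1\<bar>)) * (1 + (norm v)\<^sup>2))
      \<le> norm (1 / a * ((1 + (norm v)\<^sup>2) * weight e v))"
      using assms by (simp add: abs_mult mult_ac)
  qed
qed measurable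

lemma slowing_tendsto_0:
  assumes "0 < e" "0 < a"
  shows "(slowing e a \<longlongrightarrow> 0) at_top"
proof -
  have "((\<lambda>\<tau>. LINT v|lborel. weight e v * min (1 / a) (1 / (\<tau> * \<bar>v $ 1\<bar>)) * (1 + (norm v)\<^sup>2))
      \<longlongrightarrow> (LINT v|(lborel :: vel measure). 0)) at_top"
  proof (rule integral_dominated_convergence_at_top)
    show "integrable lborel (\<lambda>v :: vel. 1 / a * ((1 + (norm v)\<^sup>2) * weight e v))"
      using weight_L12[OF assms(1)] by (simp add: L12_def)
    show "\<forall>\<^sub>F \<tau> in at_top. AE v in lborel. norm (weight e v * min (1 / a) (1 / (\<tau> * \<bar>v $ 1\<bar>)) * (1 + (norm v)\<^sup>2))
      \<le> 1 / a * ((1 + (norm v)\<^sup>2) * weight e v)"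
      using eventually_gt_at_top[of 0]
    proof eventually_elim
      case (elim \<tau>)
      show ?case
      proof (intro AE_I2)
        fix v :: vel
        have "\<bar>min (1 / a) (1 / (\<tau> * \<bar>v $ 1\<bar>))\<bar> \<le> 1 / a" using assms elim by (auto simp: min_def)
        then have "weight e v * \<bar>min (1 / a) (1 / (\<tau> * \<bar>v $ 1\<bar>))\<bar> * (1 + (norm v)\<^sup>2)
          \<le> weight e v * (1 / a) * (1 + (norm v)\<^sup>2)"
          by (intro mult_right_mono mult_left_mono) auto
        then show "norm (weight e v * min (1 / a) (1 / (\<tau> * \<bar>v $ 1\<bar>)) * (1 + (norm v)\<^sup>2))
          \<le> 1 / a * ((1 + (norm v)\<^sup>2) * weight e v)"
          using assms by (simp add: abs_mult mult_ac)
      qed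
    qed
    show "AE v :: vel in lborel. ((\<lambda>\<tau>. weight e v * min (1 / a) (1 / (\<tau> * \<bar>v $ 1\<bar>)) * (1 + (norm v)\<^sup>2)) \<longlongrightarrow> 0) at_top"
    proof (intro AE_I2)
      fix v :: vel
      have "((\<lambda>\<tau>. 1 / (\<tau> * \<bar>v $ 1\<bar>)) \<longlongrightarrow> 0) at_top"
      \<comment> \<open>On the plane \<open>v $ 1 = 0\<close> the quotient is 0 by the convention
        for division, so the limit holds at every velocity.\<close>
      proof (cases "v $ 1 = 0")
        case False
        then have "filterlim (\<lambda>\<tau>. \<tau> * \<bar>v $ 1\<bar>) at_top at_top"
          by (intro filterlim_at_top_mult_tendsto_pos[of _ "\<bar>v $ 1\<bar>"] filterlim_ident tendsto_const) auto
        then show ?thesis by (intro tendsto_divide_0[OF tendsto_const] filterlim_at_top_imp_at_infinity)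
      qed auto
      from tendsto_min[OF tendsto_const[of "1 / a"] this]
      have "((\<lambda>\<tau>. min (1 / a) (1 / (\<tau> * \<bar>v $ 1\<bar>))) \<longlongrightarrow> 0) at_top" using assms by simp
      from tendsto_mult_left_zero[OF tendsto_mult_right_zero[OF this]]
      show "((\<lambda>\<tau>. weight e v * min (1 / a) (1 / (\<tau> * \<bar>v $ 1\<bar>)) * (1 + (norm v)\<^sup>2)) \<longlongrightarrow> 0) at_top" .
    qed
  qed measurable
  then show ?thesis by (simp add: slowing_def[abs_def])
qed

section \<open>Transport along characteristics\<close>

text \<open>The bound \<open>s\<close> comes from the length of the interval, at most 1; the bound
  \<open>1 / r\<close> from integrating the exponential. The factor \<open>s\<close> stays under the
  integral, so the antiderivative divides by \<open>r\<close> alone and \<open>s = 0\<close> is no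
  special case.\<close>

lemma integral_exp_decay:
  fixes s r x :: real
  assumes "0 \<le> s" "0 < r" "a \<le> b" "b \<le> a + 1" "x = a \<or> x = b"
  shows "s * (LINT y:{a..b}|lborel. exp (- (s * r * \<bar>x - y\<bar>))) \<le> min (1 / r) s"
proof -
  let ?k = "LINT y:{a..b}|lborel. exp (- (s * r * \<bar>x - y\<bar>))"
  have int: "set_integrable lborel {a..b} (\<lambda>y. exp (- (s * r * \<bar>x - y\<bar>)))"
    by (intro borel_integrable_atLeastAtMost' continuous_intros)
  have "?k \<le> (LINT y:{a..b}|lborel. 1)"
    using assms(1,2) by (intro set_integral_mono int borel_integrable_atLeastAtMost' continuous_intros) auto
  also have "\<dots> = b - a" using assms by (simp add: set_lebesgue_integral_def)
  finally have "s * ?k \<le> s * 1" using assms by (intro mult_left_mono) auto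
  moreover have "s * ?k \<le> 1 / r"
    using assms(5)
  proof
    assume x: "x = a"
    have "s * ?k = (LINT y|lborel. indicator {a..b} y *\<^sub>R (s * exp (- (s * r * (y - a)))))"
      unfolding set_lebesgue_integral_def x integral_mult_right_zero[symmetric]
      by (intro Bochner_Integration.integral_cong) (auto simp: indicator_def abs_if)
    also have "\<dots> = - exp (- (s * r * (b - a))) / r - (- exp (- (s * r * (a - a))) / r)"
      using assms(2,3)
      by (intro integral_FTC_atLeastAtMost[where F="\<lambda>y. - exp (- (s * r * (y - a))) / r"])
        (auto intro!: continuous_intros derivative_eq_intros
          simp: has_real_derivative_iff_has_vector_derivative[symmetric])
    also have "\<dots> \<le> 1 / r" using assms(2) by simp
    finally show ?thesis .
  next
    assume x: "x = b"
    have "s * ?k = (LINT y|lborel. indicator {a..b} y *\<^sub>R (s * exp (- (s * r * (b - y)))))"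
      unfolding set_lebesgue_integral_def x integral_mult_right_zero[symmetric]
      by (intro Bochner_Integration.integral_cong) (auto simp: indicator_def abs_if)
    also have "\<dots> = exp (- (s * r * (b - b))) / r - exp (- (s * r * (b - a))) / r"
      using assms(2,3)
      by (intro integral_FTC_atLeastAtMost[where F="\<lambda>y. exp (- (s * r * (b - y))) / r"])
        (auto intro!: continuous_intros derivative_eq_intros
          simp: has_real_derivative_iff_has_vector_derivative[symmetric])
    also have "\<dots> \<le> 1 / r" using assms(2) by simp
    finally show ?thesis .
  qed
  ultimately show ?thesis by simp
qed

text \<open>The part of the slab whose emission reaches \<open>x\<close> at velocity
  \<open>v\<close>. One set for both directions lets the two halves of the mild formula be estimated
  together.\<close>

definition upwind :: "real \<Rightarrow> vel \<Rightarrow> real set" where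
  "upwind x v = (if 0 < v $ 1 then {0..x} else if v $ 1 < 0 then {x..1} else {})"

lemma upwind_sets [measurable, simp]: "upwind x v \<in> sets borel"
  by (simp add: upwind_def)

text \<open>Serves for the gain term and for the difference of two gain terms alike; only the
  prefactor \<open>B\<close> changes.\<close>

lemma upwind_integral_le:
  fixes F :: "real \<Rightarrow> real"
  assumes "0 \<le> s" "0 < r" "x \<in> {0..1}" "0 \<le> B" "F \<in> borel_measurable borel"
    and F: "\<And>y. y \<in> upwind x v \<Longrightarrow> \<bar>F y\<bar> \<le> B * exp (- (s * r * \<bar>x - y\<bar>))"
  shows "set_integrable lborel (upwind x v) F"
    "\<bar>s * (LINT y:upwind x v|lborel. F y)\<bar> \<le> B * min (1 / r) s"
proof -
  let ?E = "\<lambda>y. exp (- (s * r * \<bar>x - y\<bar>))"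
  have intE: "set_integrable lborel (upwind x v) ?E"
    unfolding upwind_def
    by (auto intro!: borel_integrable_atLeastAtMost' continuous_intros simp: set_integrable_def[of _ "{}"])
  then have intBE: "set_integrable lborel (upwind x v) (\<lambda>y. B * ?E y)"
    by (rule set_integrable_mult_right)
  then show intF: "set_integrable lborel (upwind x v) F"
  proof (rule set_integrable_bound)
    show "set_borel_measurable lborel (upwind x v) F"
      unfolding set_borel_measurable_def using assms(5) by measurable
    show "AE y in lborel. y \<in> upwind x v \<longrightarrow> norm (F y) \<le> norm (B * ?E y)"
      using F assms(4) by (auto simp: abs_mult)
  qed
  have "\<bar>LINT y:upwind x v|lborel. F y\<bar> \<le> (LINT y:upwind x v|lborel. \<bar>F y\<bar>)"
    using set_integral_norm_bound[OF intF] by simp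
  also have "\<dots> \<le> (LINT y:upwind x v|lborel. B * ?E y)"
    using F set_integrable_abs[OF intF] intBE by (intro set_integral_mono) auto
  also have "\<dots> = B * (LINT y:upwind x v|lborel. ?E y)" by simp
  finally have "s * \<bar>LINT y:upwind x v|lborel. F y\<bar> \<le> s * (B * (LINT y:upwind x v|lborel. ?E y))"
    using assms(1) by (rule mult_left_mono)
  also have "\<dots> = B * (s * (LINT y:upwind x v|lborel. ?E y))" by simp
  also have "\<dots> \<le> B * min (1 / r) s"
  proof (rule mult_left_mono[OF _ assms(4)])
    show "s * (LINT y:upwind x v|lborel. ?E y) \<le> min (1 / r) s"
      using integral_exp_decay[OF assms(1,2), of 0 x x] integral_exp_decay[OF assms(1,2), of x 1 x] assms(1-3)
      by (auto simp: upwind_def set_lebesgue_integral_def[of _ "{}"])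
  qed
  finally show "\<bar>s * (LINT y:upwind x v|lborel. F y)\<bar> \<le> B * min (1 / r) s"
    using assms(1) by (simp add: abs_mult)
qed

text \<open>The optical depth of the layer, in the language of radiative transfer.\<close>

definition depth :: "(real \<Rightarrow> moments) \<Rightarrow> real \<Rightarrow> real \<Rightarrow> real" where
  "depth m a b = (LINT y:{a..b}|lborel. fst (m y))"

definition slowness :: "real \<Rightarrow> vel \<Rightarrow> real" where
  "slowness \<tau> v = 1 / (\<tau> * \<bar>v $ 1\<bar>)"

text \<open>\<open>min\<close> and \<open>max\<close> make this symmetric in \<open>x\<close> and
  \<open>y\<close>, so that one expression damps particles moving in either direction.\<close>

definition attenuation :: "real \<Rightarrow> (real \<Rightarrow> moments) \<Rightarrow> vel \<Rightarrow> real \<Rightarrow> real \<Rightarrow> real" where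
  "attenuation \<tau> m v x y = exp (- slowness \<tau> v * depth m (min x y) (max x y))"

text \<open>The end of the slab at which the characteristic enters; the choice at
  \<open>v $ 1 = 0\<close> concerns a null set.\<close>

definition inlet :: "vel \<Rightarrow> real" where
  "inlet v = (if 0 < v $ 1 then 0 else 1)"

definition emission :: "real \<Rightarrow> real \<Rightarrow> (real \<Rightarrow> moments) \<Rightarrow> real \<Rightarrow> vel \<Rightarrow> real \<Rightarrow> real" where
  "emission \<nu> \<tau> m x v y = attenuation \<tau> m v x y * fst (m y) * mgaussian \<nu> (m y) v"

definition transport :: "real \<Rightarrow> real \<Rightarrow> (vel \<Rightarrow> real) \<Rightarrow> (real \<Rightarrow> moments) \<Rightarrow> real \<Rightarrow> vel \<Rightarrow> real" where
  "transport \<nu> \<tau> g m x v = attenuation \<tau> m v x (inlet v) * g v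
     + slowness \<tau> v * (LINT y:upwind x v|lborel. emission \<nu> \<tau> m x v y)"

text \<open>The constants \<open>C\<close> and \<open>e\<close> of the Gaussian estimates are
  parameters rather than obtained inside, so that they can be fixed before \<open>\<tau>\<close> and
  the inflow are known.\<close>

locale slab =
  fixes \<nu> \<tau> al au R \<alpha> e C :: real and g :: "vel \<Rightarrow> real"
  assumes pos: "0 < \<tau>" "0 < al" "al \<le> au" "0 < \<alpha>" "0 \<le> R" "0 < e" "0 \<le> C"
    and mgaussian_le: "m \<in> admissible \<nu> \<alpha> al au R \<Longrightarrow> \<bar>mgaussian \<nu> m v\<bar> \<le> C * weight e v"
    and mgaussian_lipschitz: "m \<in> admissible \<nu> \<alpha> al au R \<Longrightarrow> m' \<in> admissible \<nu> \<alpha> al au R \<Longrightarrow>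
      \<bar>mgaussian \<nu> m v - mgaussian \<nu> m' v\<bar> \<le> C * weight e v * dist m m'"
    and g: "g \<in> L12" "(\<lambda>v. 1 / \<bar>v $ 1\<bar> * g v) \<in> L12" "AE v in lborel. 0 \<le> g v"
begin

text \<open>Functions on the whole line, constrained at every point and not just almost everywhere:
  uniform distances make sense without equivalence classes, and no continuity in \<open>x\<close>
  has to be propagated.\<close>

definition profiles :: "(real \<Rightarrow> moments) set" where
  "profiles = {m. m \<in> borel_measurable borel \<and> (\<forall>x. m x \<in> admissible \<nu> \<alpha> al au R)}"

lemma profilesD:
  assumes "m \<in> profiles"
  shows "m \<in> borel_measurable borel" "m x \<in> admissible \<nu> \<alpha> al au R"
    "al \<le> fst (m x)" "fst (m x) \<le> au" "(\<lambda>y. fst (m y)) \<in> borel_measurable borel"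
proof -
  show m: "m \<in> borel_measurable borel" and mem: "m x \<in> admissible \<nu> \<alpha> al au R"
    using assms by (auto simp: profiles_def)
  show "al \<le> fst (m x)" "fst (m x) \<le> au" using admissibleD[OF mem] by auto
  have "fst \<in> borel_measurable (borel :: moments measure)"
    by (intro borel_measurable_continuous_onI continuous_intros)
  from measurable_compose[OF m this] show "(\<lambda>y. fst (m y)) \<in> borel_measurable borel" .
qed

lemma density_abs_le: "m \<in> profiles \<Longrightarrow> \<bar>fst (m x)\<bar> \<le> au"
  using profilesD(3,4)[of m x] pos by linarith

lemma slowness_nonneg [simp]: "0 \<le> slowness \<tau> v"
  using pos by (simp add: slowness_def)

lemma borel_measurable_slowness [measurable]: "slowness \<tau> \<in> borel_measurable borel"
  unfolding slowness_def by measurable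

lemma borel_measurable_inlet [measurable]: "inlet \<in> borel_measurable borel"
  unfolding inlet_def by measurable

lemma borel_measurable_g [measurable]: "g \<in> borel_measurable borel"
  using L12_measurable[OF g(1)] by simp

section \<open>Estimates for optical depth, attenuation and emission\<close>

lemma depth_integrable:
  assumes "m \<in> profiles"
  shows "set_integrable lborel {a..b} (\<lambda>y. fst (m y))"
proof (rule set_integrable_bound)
  show "set_integrable lborel {a..b} (\<lambda>y. au)" by (intro borel_integrable_atLeastAtMost' continuous_intros)
  have [measurable]: "(\<lambda>y. fst (m y)) \<in> borel_measurable borel" using assms by (rule profilesD)
  show "set_borel_measurable lborel {a..b} (\<lambda>y. fst (m y))" unfolding set_borel_measurable_def by measurable
  show "AE y in lborel. y \<in> {a..b} \<longrightarrow> norm (fst (m y)) \<le> norm au"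
    using density_abs_le[OF assms] pos by auto
qed

lemma depth_bounds:
  assumes "m \<in> profiles" "a \<le> b"
  shows "al * (b - a) \<le> depth m a b" "depth m a b \<le> au * (b - a)"
proof -
  have c: "set_integrable lborel {a..b} (\<lambda>y. c)" for c :: real
    by (intro borel_integrable_atLeastAtMost' continuous_intros)
  have i: "(LINT y:{a..b}|lborel. c) = c * (b - a)" for c :: real
    using assms(2) by (simp add: set_lebesgue_integral_def)
  show "al * (b - a) \<le> depth m a b"
    unfolding depth_def i[symmetric]
    by (intro set_integral_mono c depth_integrable assms profilesD(3))
  show "depth m a b \<le> au * (b - a)"
    unfolding depth_def i[symmetric]
    by (intro set_integral_mono c depth_integrable assms profilesD(4))
qed

lemma depth_diff_le:
  assumes "m \<in> profiles" "m' \<in> profiles" "a \<le> b" "\<And>y. dist (m y) (m' y) \<le> d"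
  shows "\<bar>depth m a b - depth m' a b\<bar> \<le> d * (b - a)"
proof -
  note i = depth_integrable[OF assms(1), of a b] depth_integrable[OF assms(2), of a b]
  have c: "set_integrable lborel {a..b} (\<lambda>y. d)"
    by (intro borel_integrable_atLeastAtMost' continuous_intros)
  have "depth m a b - depth m' a b = (LINT y:{a..b}|lborel. fst (m y) - fst (m' y))"
    unfolding depth_def using i by (rule set_integral_diff(2)[symmetric])
  also have "\<bar>\<dots>\<bar> \<le> (LINT y:{a..b}|lborel. \<bar>fst (m y) - fst (m' y)\<bar>)"
    using set_integral_norm_bound[OF set_integral_diff(1)[OF i]] by simp
  also have "\<dots> \<le> (LINT y:{a..b}|lborel. d)"
  proof (intro set_integral_mono c set_integrable_abs set_integral_diff(1) i)
    fix y
    show "\<bar>fst (m y) - fst (m' y)\<bar> \<le> d"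
      using moments_component_le(1)[of "m y - m' y"] assms(4)[of y] by (simp add: dist_norm)
  qed
  also have "\<dots> = d * (b - a)" using assms(3) by (simp add: set_lebesgue_integral_def)
  finally show ?thesis .
qed

lemma borel_measurable_depth:
  assumes [measurable]: "a \<in> borel_measurable M" "b \<in> borel_measurable M" and m: "m \<in> profiles"
  shows "(\<lambda>w. depth m (a w) (b w)) \<in> borel_measurable M"
proof -
  define r where "r y = fst (m y)" for y
  have [measurable]: "r \<in> borel_measurable borel" unfolding r_def using m by (rule profilesD)
  have "depth m a b = (LINT y|lborel. (if a \<le> y \<and> y \<le> b then r y else 0))" for a b
    unfolding depth_def set_lebesgue_integral_def r_def
    by (intro Bochner_Integration.integral_cong) auto
  then show ?thesis by simp
qed

lemma borel_measurable_attenuation: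
  assumes [measurable]: "v \<in> borel_measurable M" "x \<in> borel_measurable M" "y \<in> borel_measurable M"
    and m: "m \<in> profiles"
  shows "(\<lambda>w. attenuation \<tau> m (v w) (x w) (y w)) \<in> borel_measurable M"
proof -
  have [measurable]: "(\<lambda>w. depth m (min (x w) (y w)) (max (x w) (y w))) \<in> borel_measurable M"
    by (intro borel_measurable_depth m) measurable
  show ?thesis unfolding attenuation_def by measurable
qed

lemma borel_measurable_emission:
  assumes [measurable]: "v \<in> borel_measurable M" "x \<in> borel_measurable M" "y \<in> borel_measurable M"
    and m: "m \<in> profiles"
  shows "(\<lambda>w. emission \<nu> \<tau> m (x w) (v w) (y w)) \<in> borel_measurable M"
proof -
  have [measurable]: "m \<in> borel_measurable borel" using m by (rule profilesD)
  have [measurable]: "(\<lambda>w. fst (m (y w))) \<in> borel_measurable M"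
    using measurable_compose[OF assms(3) profilesD(5)[OF m]] by simp
  have [measurable]: "(\<lambda>w. attenuation \<tau> m (v w) (x w) (y w)) \<in> borel_measurable M"
    by (intro borel_measurable_attenuation m) measurable
  have [measurable]: "(\<lambda>w. mgaussian \<nu> (m (y w)) (v w)) \<in> borel_measurable M"
    using pos by (intro borel_measurable_mgaussian[of al \<alpha> R _ _ _ \<nu> au] profilesD(2)[OF m]) auto
  show ?thesis unfolding emission_def by measurable
qed

lemma borel_measurable_transport:
  assumes [measurable]: "v \<in> borel_measurable M" "x \<in> borel_measurable M"
    and m: "m \<in> profiles"
  shows "(\<lambda>w. transport \<nu> \<tau> g m (x w) (v w)) \<in> borel_measurable M"
proof -
  have [measurable]: "(\<lambda>w. attenuation \<tau> m (v w) (x w) (inlet (v w))) \<in> borel_measurable M"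
    by (intro borel_measurable_attenuation m) measurable
  have [measurable]: "(\<lambda>p. emission \<nu> \<tau> m (x (fst p)) (v (fst p)) (snd p)) \<in> borel_measurable (M \<Otimes>\<^sub>M lborel)"
    by (intro borel_measurable_emission m) measurable
  \<comment> \<open>The velocity-dependent domain is moved into the integrand, so that measurability
    of a parametrised integral applies.\<close>
  have eq: "(LINT y:upwind x v|lborel. emission \<nu> \<tau> m x v y) =
     (LINT y|lborel. (if (0 < v $ 1 \<and> 0 \<le> y \<and> y \<le> x) \<or> (v $ 1 < 0 \<and> x \<le> y \<and> y \<le> 1) then emission \<nu> \<tau> m x v y else 0))" for x v
    unfolding set_lebesgue_integral_def
    by (intro Bochner_Integration.integral_cong) (auto simp: upwind_def)
  have "(\<lambda>w. LINT y:upwind (x w) (v w)|lborel. emission \<nu> \<tau> m (x w) (v w) y) \<in> borel_measurable M"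
    unfolding eq
    by (rule lborel.borel_measurable_lebesgue_integral) (simp add: case_prod_unfold)
  then show ?thesis unfolding transport_def by measurable
qed

lemma attenuation_le:
  assumes "m \<in> profiles"
  shows "attenuation \<tau> m v x y \<le> exp (- (slowness \<tau> v * al * \<bar>x - y\<bar>))"
    "exp (- (slowness \<tau> v * au * \<bar>x - y\<bar>)) \<le> attenuation \<tau> m v x y"
proof -
  have "max x y - min x y = \<bar>x - y\<bar>" by (auto simp: max_def min_def)
  then have d: "al * \<bar>x - y\<bar> \<le> depth m (min x y) (max x y)" "depth m (min x y) (max x y) \<le> au * \<bar>x - y\<bar>"
    using depth_bounds[OF assms, of "min x y" "max x y"] by auto
  from d[THEN mult_left_mono, OF slowness_nonneg[of v]]
  show "attenuation \<tau> m v x y \<le> exp (- (slowness \<tau> v * al * \<bar>x - y\<bar>))"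
    "exp (- (slowness \<tau> v * au * \<bar>x - y\<bar>)) \<le> attenuation \<tau> m v x y"
    by (simp_all add: attenuation_def mult.assoc)
qed

lemma attenuation_pos: "0 < attenuation \<tau> m v x y" by (simp add: attenuation_def)

lemma attenuation_le_1: "m \<in> profiles \<Longrightarrow> attenuation \<tau> m v x y \<le> 1"
  using attenuation_le(1)[of m v x y] pos by (smt (verit) exp_le_one_iff mult_nonneg_nonneg abs_ge_zero slowness_nonneg)

text \<open>The exponential has to survive in the difference: the slowness is unbounded near
  \<open>v $ 1 = 0\<close>, and the decay later compensates the factor
  \<open>slowness \<tau> v * \<bar>x - y\<bar>\<close>.\<close>

lemma attenuation_diff_le:
  assumes "m \<in> profiles" "m' \<in> profiles" "\<And>y. dist (m y) (m' y) \<le> d"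
  shows "\<bar>attenuation \<tau> m v x y - attenuation \<tau> m' v x y\<bar> \<le>
    slowness \<tau> v * \<bar>x - y\<bar> * d * exp (- (slowness \<tau> v * al * \<bar>x - y\<bar>))"
proof -
  let ?s = "slowness \<tau> v"
  have eq: "max x y - min x y = \<bar>x - y\<bar>" by (auto simp: max_def min_def)
  have le: "exp (- a) - exp (- b) \<le> \<bar>a - b\<bar> * exp (- c)" if "c \<le> a" for a b c :: real
  proof -
    have "1 - exp (- (b - a)) \<le> \<bar>a - b\<bar>" using exp_ge_add_one_self[of "- (b - a)"] by linarith
    then have "exp (- a) * (1 - exp (- (b - a))) \<le> exp (- a) * \<bar>a - b\<bar>"
      by (intro mult_left_mono) auto
    also have "\<dots> \<le> exp (- c) * \<bar>a - b\<bar>" using that by (intro mult_right_mono) auto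
    finally show ?thesis by (simp add: right_diff_distrib mult.commute flip: exp_add)
  qed
  let ?a = "?s * depth m (min x y) (max x y)" and ?b = "?s * depth m' (min x y) (max x y)"
    and ?c = "?s * al * \<bar>x - y\<bar>"
  have "?c \<le> ?a" "?c \<le> ?b"
    using mult_left_mono[OF depth_bounds(1)[OF assms(1), of "min x y" "max x y"] slowness_nonneg[of v]]
      mult_left_mono[OF depth_bounds(1)[OF assms(2), of "min x y" "max x y"] slowness_nonneg[of v]]
    by (auto simp: eq mult.assoc)
  then have "\<bar>attenuation \<tau> m v x y - attenuation \<tau> m' v x y\<bar> \<le> \<bar>?a - ?b\<bar> * exp (- ?c)"
    using le[of ?c ?a ?b] le[of ?c ?b ?a] by (simp add: attenuation_def abs_minus_commute abs_le_iff)
  also have "\<bar>?a - ?b\<bar> = ?s * \<bar>depth m (min x y) (max x y) - depth m' (min x y) (max x y)\<bar>"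
    by (simp add: abs_mult flip: right_diff_distrib)
  also have "\<dots> \<le> ?s * (d * \<bar>x - y\<bar>)"
    using depth_diff_le[OF assms(1,2) _ assms(3), of "min x y" "max x y"]
    by (intro mult_left_mono) (auto simp: eq)
  finally show ?thesis by (simp add: mult_right_mono mult_ac)
qed

text \<open>Only half of the available decay is kept, to share the rate, and hence the kernel mass,
  with \<open>emission_diff_le\<close>.\<close>

lemma emission_abs_le:
  assumes "m \<in> profiles"
  shows "\<bar>emission \<nu> \<tau> m x v y\<bar> \<le> au * C * weight e v * exp (- (slowness \<tau> v * (al / 2) * \<bar>x - y\<bar>))"
proof -
  have "al / 2 * (slowness \<tau> v * \<bar>x - y\<bar>) \<le> al * (slowness \<tau> v * \<bar>x - y\<bar>)"
    using pos by (intro mult_right_mono) auto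
  then have "attenuation \<tau> m v x y \<le> exp (- (slowness \<tau> v * (al / 2) * \<bar>x - y\<bar>))"
    by (intro order_trans[OF attenuation_le(1)[OF assms]]) (simp add: mult_ac)
  then have "\<bar>attenuation \<tau> m v x y\<bar> * \<bar>fst (m y)\<bar> * \<bar>mgaussian \<nu> (m y) v\<bar> \<le>
     exp (- (slowness \<tau> v * (al / 2) * \<bar>x - y\<bar>)) * au * (C * weight e v)"
    using density_abs_le[OF assms, of y] pos mgaussian_le[OF profilesD(2)[OF assms]] attenuation_pos[of m v x y]
    by (intro mult_mono) auto
  then show ?thesis by (simp add: emission_def abs_mult mult_ac)
qed

lemma emission_nonneg: "m \<in> profiles \<Longrightarrow> 0 \<le> emission \<nu> \<tau> m x v y"
  using mgaussian_pos[OF admissibleD(4)[OF profilesD(2)] pos(4), of m y v]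
    profilesD(3)[of m y] pos attenuation_pos[of m v x y] by (simp add: emission_def)

text \<open>The summands record the variation of the attenuation, of the density and of the
  Gaussian, in this order.\<close>

definition lip :: real where "lip = C * (2 * au / al + 1 + au)"

lemma lip_nonneg: "0 \<le> lip" using pos by (simp add: lip_def)

lemma emission_diff_le:
  assumes "m \<in> profiles" "m' \<in> profiles" "\<And>y. dist (m y) (m' y) \<le> d"
  shows "\<bar>emission \<nu> \<tau> m x v y - emission \<nu> \<tau> m' x v y\<bar> \<le>
    d * lip * weight e v * exp (- (slowness \<tau> v * (al / 2) * \<bar>x - y\<bar>))"
proof -
  have d: "0 \<le> d" using assms(3)[of 0] zero_le_dist[of "m 0" "m' 0"] by linarith
  let ?u = "slowness \<tau> v * \<bar>x - y\<bar>"
  let ?h = "exp (- (slowness \<tau> v * (al / 2) * \<bar>x - y\<bar>))"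
  let ?E = "attenuation \<tau> m v x y" and ?E' = "attenuation \<tau> m' v x y"
  let ?r = "fst (m y)" and ?r' = "fst (m' y)"
  let ?G = "mgaussian \<nu> (m y) v" and ?G' = "mgaussian \<nu> (m' y) v"
  let ?w = "C * weight e v"
  have u: "0 \<le> ?u" by simp
  have w: "0 \<le> ?w" using pos by simp
  \<comment> \<open>Trades half of the decay for the factor \<open>?u\<close>:
    \<open>u * exp (- (al * u)) \<le> 2 / al * exp (- (al / 2 * u))\<close>.\<close>
  have "al / 2 * ?u \<le> exp (al / 2 * ?u)" using exp_ge_add_one_self[of "al / 2 * ?u"] by linarith
  then have "?u \<le> 2 / al * exp (al / 2 * ?u)" using pos by (simp add: field_simps)
  then have "?u * exp (- (al * ?u)) \<le> 2 / al * exp (al / 2 * ?u) * exp (- (al * ?u))"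
    by (intro mult_right_mono) auto
  also have "\<dots> = 2 / al * ?h" by (simp add: mult.assoc mult_ac flip: exp_add)
  finally have "d * (?u * exp (- (al * ?u))) \<le> d * (2 / al * ?h)" using d by (rule mult_left_mono)
  then have dE: "\<bar>?E - ?E'\<bar> \<le> 2 / al * d * ?h"
    using attenuation_diff_le[OF assms, of v x y] by (simp add: mult_ac)
  have "al / 2 * ?u \<le> al * ?u" using pos by (intro mult_right_mono) auto
  then have E': "?E' \<le> ?h"
    by (intro order_trans[OF attenuation_le(1)[OF assms(2)]]) (simp add: mult_ac)
  have dr: "\<bar>?r - ?r'\<bar> \<le> d"
    using moments_component_le(1)[of "m y - m' y"] assms(3)[of y] by (simp add: dist_norm)
  have G: "\<bar>?G\<bar> \<le> ?w" by (rule mgaussian_le[OF profilesD(2)[OF assms(1)]])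
  have "\<bar>?G - ?G'\<bar> \<le> ?w * dist (m y) (m' y)"
    by (rule mgaussian_lipschitz[OF profilesD(2)[OF assms(1)] profilesD(2)[OF assms(2)]])
  also have "\<dots> \<le> ?w * d" using w assms(3) by (intro mult_left_mono) auto
  finally have dG: "\<bar>?G - ?G'\<bar> \<le> ?w * d" .
  have r: "\<bar>?r\<bar> \<le> au" "\<bar>?r'\<bar> \<le> au" by (intro density_abs_le assms)+
  have eq: "emission \<nu> \<tau> m x v y - emission \<nu> \<tau> m' x v y =
     (?E - ?E') * ?r * ?G + ?E' * (?r - ?r') * ?G + ?E' * ?r' * (?G - ?G')"
    by (simp add: emission_def algebra_simps)
  have "\<bar>emission \<nu> \<tau> m x v y - emission \<nu> \<tau> m' x v y\<bar> \<le> \<bar>?E - ?E'\<bar> * \<bar>?r\<bar> * \<bar>?G\<bar> + \<bar>?E'\<bar> * \<bar>?r - ?r'\<bar> * \<bar>?G\<bar> + \<bar>?E'\<bar> * \<bar>?r'\<bar> * \<bar>?G - ?G'\<bar>"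
    unfolding eq abs_mult[symmetric]
    by (rule order_trans[OF abs_triangle_ineq add_right_mono[OF abs_triangle_ineq]])
  also have "\<dots> \<le> (2 / al * d * ?h) * au * ?w + ?h * d * ?w + ?h * au * (?w * d)"
  proof -
    have 1: "\<bar>?E'\<bar> \<le> ?h" using E' attenuation_pos[of m' v x y] by simp
    have 2: "0 \<le> 2 / al * d * ?h" "0 \<le> 2 / al * d * ?h * au" "0 \<le> ?h * d" "0 \<le> ?h * au" "0 \<le> au" "0 \<le> ?h"
      using d pos by simp_all
    have "\<bar>?E - ?E'\<bar> * \<bar>?r\<bar> * \<bar>?G\<bar> \<le> (2 / al * d * ?h) * au * ?w"
      by (rule mult_mono[OF mult_mono[OF dE r(1) 2(1) abs_ge_zero] G 2(2) abs_ge_zero])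
    moreover have "\<bar>?E'\<bar> * \<bar>?r - ?r'\<bar> * \<bar>?G\<bar> \<le> ?h * d * ?w"
      by (rule mult_mono[OF mult_mono[OF 1 dr 2(6) abs_ge_zero] G 2(3) abs_ge_zero])
    moreover have "\<bar>?E'\<bar> * \<bar>?r'\<bar> * \<bar>?G - ?G'\<bar> \<le> ?h * au * (?w * d)"
      by (rule mult_mono[OF mult_mono[OF 1 r(2) 2(6) abs_ge_zero] dG 2(4) abs_ge_zero])
    ultimately show ?thesis by (intro add_mono)
  qed
  also have "\<dots> = d * lip * weight e v * ?h" by (simp add: lip_def algebra_simps)
  finally show ?thesis .
qed

end

section \<open>Bounds and contraction for the transport map\<close>

context slab
begin

abbreviation kernel_mass :: "vel \<Rightarrow> real" where
  "kernel_mass v \<equiv> min (1 / (al / 2)) (slowness \<tau> v)"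

lemma emission_integrable:
  assumes "m \<in> profiles" "x \<in> {0..1}"
  shows "set_integrable lborel (upwind x v) (emission \<nu> \<tau> m x v)"
    "\<bar>slowness \<tau> v * (LINT y:upwind x v|lborel. emission \<nu> \<tau> m x v y)\<bar> \<le> au * C * weight e v * kernel_mass v"
proof -
  have *: "0 < al / 2" "0 \<le> au * C * weight e v" using pos by simp_all
  have "emission \<nu> \<tau> m x v \<in> borel_measurable borel"
    by (intro borel_measurable_emission assms) simp_all
  note * = upwind_integral_le[OF slowness_nonneg *(1) assms(2) *(2) this emission_abs_le[OF assms(1)]]
  show "set_integrable lborel (upwind x v) (emission \<nu> \<tau> m x v)"
    "\<bar>slowness \<tau> v * (LINT y:upwind x v|lborel. emission \<nu> \<tau> m x v y)\<bar> \<le> au * C * weight e v * kernel_mass v"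
    by (rule *)+
qed

lemma gain_nonneg:
  assumes "m \<in> profiles"
  shows "0 \<le> slowness \<tau> v * (LINT y:upwind x v|lborel. emission \<nu> \<tau> m x v y)"
  using emission_nonneg[OF assms]
  unfolding set_lebesgue_integral_def
  by (intro mult_nonneg_nonneg slowness_nonneg integral_nonneg_AE AE_I2) auto

lemma gain_diff_le:
  assumes "m \<in> profiles" "m' \<in> profiles" "\<And>y. dist (m y) (m' y) \<le> d" "x \<in> {0..1}"
  shows "\<bar>slowness \<tau> v * (LINT y:upwind x v|lborel. emission \<nu> \<tau> m x v y)
    - slowness \<tau> v * (LINT y:upwind x v|lborel. emission \<nu> \<tau> m' x v y)\<bar> \<le> d * lip * weight e v * kernel_mass v"
proof -
  have d: "0 \<le> d" using assms(3)[of 0] zero_le_dist[of "m 0" "m' 0"] by linarith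
  have "slowness \<tau> v * (LINT y:upwind x v|lborel. emission \<nu> \<tau> m x v y)
    - slowness \<tau> v * (LINT y:upwind x v|lborel. emission \<nu> \<tau> m' x v y)
    = slowness \<tau> v * (LINT y:upwind x v|lborel. emission \<nu> \<tau> m x v y - emission \<nu> \<tau> m' x v y)"
    using set_integral_diff(2)[OF emission_integrable(1)[OF assms(1,4)] emission_integrable(1)[OF assms(2,4)]]
    by (simp add: right_diff_distrib)
  moreover have "\<bar>slowness \<tau> v * (LINT y:upwind x v|lborel. emission \<nu> \<tau> m x v y - emission \<nu> \<tau> m' x v y)\<bar>
      \<le> d * lip * weight e v * kernel_mass v"
    using pos d lip_nonneg
    by (intro upwind_integral_le(2)[where r="al / 2"] emission_diff_le borel_measurable_diff
      borel_measurable_emission assms) simp_all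
  ultimately show ?thesis by simp
qed

lemma transport_lower:
  assumes "m \<in> profiles" "x \<in> {0..1}"
  shows "AE v in lborel. exp (- (au * slowness \<tau> v)) * g v \<le> transport \<nu> \<tau> g m x v"
  using g(3)
proof eventually_elim
  case (elim v)
  have "\<bar>x - inlet v\<bar> \<le> 1" using assms(2) by (auto simp: inlet_def)
  then have "au * slowness \<tau> v * \<bar>x - inlet v\<bar> \<le> au * slowness \<tau> v * 1"
    using pos by (intro mult_left_mono) auto
  then have "exp (- (au * slowness \<tau> v)) \<le> attenuation \<tau> m v x (inlet v)"
    by (intro order_trans[OF _ attenuation_le(2)[OF assms(1)]]) (simp add: mult_ac)
  then have "exp (- (au * slowness \<tau> v)) * g v \<le> attenuation \<tau> m v x (inlet v) * g v"
    using elim by (rule mult_right_mono)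
  then show ?case using gain_nonneg[OF assms(1), of v x] by (simp add: transport_def)
qed

lemma transport_nonneg:
  assumes "m \<in> profiles" "x \<in> {0..1}"
  shows "AE v in lborel. 0 \<le> transport \<nu> \<tau> g m x v"
  using transport_lower[OF assms] g(3)
  by eventually_elim (meson exp_ge_zero mult_nonneg_nonneg order_trans)

lemma transport_upper:
  assumes "m \<in> profiles" "x \<in> {0..1}"
  shows "AE v in lborel. transport \<nu> \<tau> g m x v \<le> g v + au * C * weight e v * kernel_mass v"
  using g(3)
proof eventually_elim
  case (elim v)
  have "attenuation \<tau> m v x (inlet v) * g v \<le> 1 * g v"
    using elim attenuation_le_1[OF assms(1)] by (intro mult_right_mono) auto
  then show ?case using emission_integrable(2)[OF assms, of v] by (simp add: transport_def)
qed

lemma kernel_integrable: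
  "integrable lborel (\<lambda>v. weight e v * kernel_mass v * (1 + (norm v)\<^sup>2))"
  "(LINT v|lborel. weight e v * kernel_mass v * (1 + (norm v)\<^sup>2)) = slowing e (al / 2) \<tau>"
  using slowing_integrable[of e "al / 2" \<tau>] pos by (simp_all add: slowing_def slowness_def)

lemma kernel_mass_nonneg: "0 \<le> kernel_mass v" using pos by simp

lemma transport_L12:
  assumes "m \<in> profiles" "x \<in> {0..1}"
  shows "transport \<nu> \<tau> g m x \<in> L12"
proof -
  have "integrable lborel (\<lambda>v. (1 + (norm v)\<^sup>2) * g v + au * C * (weight e v * kernel_mass v * (1 + (norm v)\<^sup>2)))"
    using g(1) kernel_integrable(1)
    by (intro Bochner_Integration.integrable_add integrable_mult_right) (auto simp: L12_def)
  then have "integrable lborel (\<lambda>v. (1 + (norm v)\<^sup>2) * transport \<nu> \<tau> g m x v)"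
  proof (rule Bochner_Integration.integrable_bound)
    show "(\<lambda>v. (1 + (norm v)\<^sup>2) * transport \<nu> \<tau> g m x v) \<in> borel_measurable lborel"
      by (intro borel_measurable_times borel_measurable_transport assms) measurable
    show "AE v in lborel. norm ((1 + (norm v)\<^sup>2) * transport \<nu> \<tau> g m x v)
       \<le> norm ((1 + (norm v)\<^sup>2) * g v + au * C * (weight e v * kernel_mass v * (1 + (norm v)\<^sup>2)))"
      using transport_nonneg[OF assms] transport_upper[OF assms]
    proof eventually_elim
      case (elim v)
      have "(1 + (norm v)\<^sup>2) * transport \<nu> \<tau> g m x v \<le>
          (1 + (norm v)\<^sup>2) * (g v + au * C * weight e v * kernel_mass v)"
        using elim(2) by (intro mult_left_mono) auto
      also have "\<dots> = (1 + (norm v)\<^sup>2) * g v + au * C * (weight e v * kernel_mass v * (1 + (norm v)\<^sup>2))"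
        by (simp only: algebra_simps)
      finally have "(1 + (norm v)\<^sup>2) * transport \<nu> \<tau> g m x v \<le> \<dots>" .
      moreover have "0 \<le> (1 + (norm v)\<^sup>2) * transport \<nu> \<tau> g m x v"
        using elim(1) by (intro mult_nonneg_nonneg) auto
      ultimately show ?case by (simp only: real_norm_def abs_of_nonneg)
    qed
  qed
  then show ?thesis by (simp add: L12_def)
qed

text \<open>The test functions of interest are 1 and the squared norm, for mass and energy; both lie
  below the weight, so one estimate of the gain covers them.\<close>

lemma transport_integral_le:
  assumes "m \<in> profiles" "x \<in> {0..1}"
    and p: "p \<in> borel_measurable borel" "\<And>v. 0 \<le> p v" "\<And>v. p v \<le> 1 + (norm v)\<^sup>2"
  shows "(LINT v|lborel. transport \<nu> \<tau> g m x v * p v) \<le>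
    (LINT v|lborel. g v * p v) + au * C * slowing e (al / 2) \<tau>"
proof -
  have i: "integrable lborel (\<lambda>v. h v * p v)" if "h \<in> L12" for h
    using L12_integrable_scaleR[OF that p(1), of 1] p(2,3) by auto
  note int = i[OF g(1)] kernel_integrable(1)
  have "(LINT v|lborel. transport \<nu> \<tau> g m x v * p v) \<le>
     (LINT v|lborel. g v * p v + au * C * (weight e v * kernel_mass v * (1 + (norm v)\<^sup>2)))"
  proof (rule integral_mono_AE)
    show "integrable lborel (\<lambda>v. transport \<nu> \<tau> g m x v * p v)"
      by (rule i[OF transport_L12[OF assms(1,2)]])
    show "integrable lborel (\<lambda>v. g v * p v + au * C * (weight e v * kernel_mass v * (1 + (norm v)\<^sup>2)))"
      using int by (intro Bochner_Integration.integrable_add integrable_mult_right)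
    show "AE v in lborel. transport \<nu> \<tau> g m x v * p v \<le>
      g v * p v + au * C * (weight e v * kernel_mass v * (1 + (norm v)\<^sup>2))"
      using transport_upper[OF assms(1,2)]
    proof eventually_elim
      case (elim v)
      have "transport \<nu> \<tau> g m x v * p v \<le> (g v + au * C * weight e v * kernel_mass v) * p v"
        using elim p(2) by (rule mult_right_mono)
      also have "\<dots> = g v * p v + (au * C * weight e v * kernel_mass v) * p v" by (rule distrib_right)
      also have "\<dots> \<le> g v * p v + (au * C * weight e v * kernel_mass v) * (1 + (norm v)\<^sup>2)"
        using pos p(3) kernel_mass_nonneg[of v] by (intro add_left_mono mult_left_mono mult_nonneg_nonneg) auto
      finally show ?case by (simp only: mult.assoc)
    qed
  qed
  also have "\<dots> = (LINT v|lborel. g v * p v) + au * C * slowing e (al / 2) \<tau>"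
    using int by (simp only: Bochner_Integration.integral_add integrable_mult_right
      integral_mult_right_zero kernel_integrable(2))
  finally show ?thesis .
qed

text \<open>The first summand is the loss term: varying the attenuation of the inflow costs one
  factor \<open>slowness \<tau> v\<close>, which the hypothesis on
  \<open>1 / \<bar>v $ 1\<bar> * g v\<close> makes integrable. The second bounds the gain.\<close>

definition contraction_rate :: real where
  "contraction_rate = (LINT v|lborel. (1 + (norm v)\<^sup>2) * (1 / \<bar>v $ 1\<bar> * g v)) / \<tau> + lip * slowing e (al / 2) \<tau>"

lemma transport_contraction:
  assumes "m \<in> profiles" "m' \<in> profiles" "\<And>y. dist (m y) (m' y) \<le> d" "x \<in> {0..1}"
  shows "dist (moment (transport \<nu> \<tau> g m x)) (moment (transport \<nu> \<tau> g m' x)) \<le> contraction_rate * d"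
proof -
  have d: "0 \<le> d" using assms(3)[of 0] zero_le_dist[of "m 0" "m' 0"] by linarith
  note L = transport_L12[OF assms(1,4)] transport_L12[OF assms(2,4)]
  have int: "integrable lborel (\<lambda>v. (1 + (norm v)\<^sup>2) * (1 / \<bar>v $ 1\<bar> * g v))"
    using g(2) by (simp add: L12_def)
  have "dist (moment (transport \<nu> \<tau> g m x)) (moment (transport \<nu> \<tau> g m' x)) \<le>
      (LINT v|lborel. \<bar>transport \<nu> \<tau> g m x v - transport \<nu> \<tau> g m' x v\<bar> * (1 + (norm v)\<^sup>2))"
    by (rule moment_dist_le(2)[OF L])
  also have "\<dots> \<le> (LINT v|lborel. d / \<tau> * ((1 + (norm v)\<^sup>2) * (1 / \<bar>v $ 1\<bar> * g v))
     + d * lip * (weight e v * kernel_mass v * (1 + (norm v)\<^sup>2)))"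
  proof (rule integral_mono_AE)
    show "integrable lborel (\<lambda>v. \<bar>transport \<nu> \<tau> g m x v - transport \<nu> \<tau> g m' x v\<bar> * (1 + (norm v)\<^sup>2))"
      by (rule moment_dist_le(1)[OF L])
    show "integrable lborel (\<lambda>v. d / \<tau> * ((1 + (norm v)\<^sup>2) * (1 / \<bar>v $ 1\<bar> * g v))
     + d * lip * (weight e v * kernel_mass v * (1 + (norm v)\<^sup>2)))"
      using int kernel_integrable(1) by (intro Bochner_Integration.integrable_add integrable_mult_right)
    show "AE v in lborel. \<bar>transport \<nu> \<tau> g m x v - transport \<nu> \<tau> g m' x v\<bar> * (1 + (norm v)\<^sup>2)
      \<le> d / \<tau> * ((1 + (norm v)\<^sup>2) * (1 / \<bar>v $ 1\<bar> * g v))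
        + d * lip * (weight e v * kernel_mass v * (1 + (norm v)\<^sup>2))"
      using g(3)
    proof eventually_elim
      case (elim v)
      let ?a = "attenuation \<tau> m v x (inlet v)" and ?a' = "attenuation \<tau> m' v x (inlet v)"
      let ?G = "slowness \<tau> v * (LINT y:upwind x v|lborel. emission \<nu> \<tau> m x v y)"
      let ?G' = "slowness \<tau> v * (LINT y:upwind x v|lborel. emission \<nu> \<tau> m' x v y)"
      have "\<bar>x - inlet v\<bar> \<le> 1" using assms(4) by (auto simp: inlet_def)
      \<comment> \<open>Here the exponential may be bounded by 1, since the data absorb the factor
        \<open>1 / \<bar>v $ 1\<bar>\<close>.\<close>
      then have "slowness \<tau> v * \<bar>x - inlet v\<bar> * d * exp (- (slowness \<tau> v * al * \<bar>x - inlet v\<bar>)) \<le> slowness \<tau> v * 1 * d * 1"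
        using pos d by (intro mult_mono mult_nonneg_nonneg) auto
      then have "\<bar>?a - ?a'\<bar> \<le> slowness \<tau> v * d"
        using attenuation_diff_le[OF assms(1-3), of v x "inlet v"] by simp
      then have 1: "\<bar>?a - ?a'\<bar> * g v \<le> slowness \<tau> v * d * g v" using elim by (rule mult_right_mono)
      have "transport \<nu> \<tau> g m x v - transport \<nu> \<tau> g m' x v = (?a - ?a') * g v + (?G - ?G')"
        unfolding transport_def by (simp add: left_diff_distrib)
      then have "\<bar>transport \<nu> \<tau> g m x v - transport \<nu> \<tau> g m' x v\<bar> \<le> \<bar>?a - ?a'\<bar> * g v + \<bar>?G - ?G'\<bar>"
        using abs_triangle_ineq[of "(?a - ?a') * g v" "?G - ?G'"] elim by (simp add: abs_mult)
      also have "\<dots> \<le> slowness \<tau> v * d * g v + d * lip * weight e v * kernel_mass v"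
        by (intro add_mono 1 gain_diff_le assms)
      finally have "\<bar>transport \<nu> \<tau> g m x v - transport \<nu> \<tau> g m' x v\<bar> * (1 + (norm v)\<^sup>2) \<le>
        (slowness \<tau> v * d * g v + d * lip * weight e v * kernel_mass v) * (1 + (norm v)\<^sup>2)"
        by (rule mult_right_mono) auto
      also have "\<dots> = slowness \<tau> v * d * g v * (1 + (norm v)\<^sup>2) + d * lip * weight e v * kernel_mass v * (1 + (norm v)\<^sup>2)"
        by (rule distrib_right)
      also have "slowness \<tau> v * d * g v * (1 + (norm v)\<^sup>2) = d / \<tau> * ((1 + (norm v)\<^sup>2) * (1 / \<bar>v $ 1\<bar> * g v))"
        by (simp add: slowness_def)
      finally show ?case by (simp only: mult.assoc)
    qed
  qed
  also have "\<dots> = d / \<tau> * (LINT v|lborel. (1 + (norm v)\<^sup>2) * (1 / \<bar>v $ 1\<bar> * g v)) + d * lip * slowing e (al / 2) \<tau>"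
    using int kernel_integrable(1) by (simp only: Bochner_Integration.integral_add integrable_mult_right
      integral_mult_right_zero kernel_integrable(2))
  also have "\<dots> = contraction_rate * d" by (simp add: contraction_rate_def algebra_simps)
  finally show ?thesis .
qed

text \<open>Extends functions constantly from the slab to the line, so that \<open>update\<close>
  acts on total functions and a fixed point is an equation at every real \<open>x\<close>.\<close>

definition clamp01 :: "real \<Rightarrow> real" where "clamp01 x = max 0 (min 1 x)"

definition update :: "(real \<Rightarrow> moments) \<Rightarrow> real \<Rightarrow> moments" where
  "update m x = moment (transport \<nu> \<tau> g m (clamp01 x))"

lemma clamp01_mem: "clamp01 x \<in> {0..1}" by (simp add: clamp01_def)

lemma clamp01_id: "x \<in> {0..1} \<Longrightarrow> clamp01 x = x" by (simp add: clamp01_def)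

lemma borel_measurable_update:
  assumes "m \<in> profiles"
  shows "update m \<in> borel_measurable borel"
proof -
  have [measurable]: "(\<lambda>p. transport \<nu> \<tau> g m (clamp01 (fst p)) (snd p)) \<in> borel_measurable (borel \<Otimes>\<^sub>M lborel)"
    by (intro borel_measurable_transport assms) (simp_all add: clamp01_def)
  have [measurable]: "(\<lambda>p :: real \<times> vel. mvec (snd p)) \<in> borel_measurable (borel \<Otimes>\<^sub>M lborel)"
    by measurable
  have "(\<lambda>p. transport \<nu> \<tau> g m (clamp01 (fst p)) (snd p) *\<^sub>R mvec (snd p)) \<in> borel_measurable (borel \<Otimes>\<^sub>M lborel)"
    by measurable
  then show ?thesis unfolding update_def[abs_def] moment_def
    by (intro lborel.borel_measurable_lebesgue_integral) (simp add: case_prod_unfold)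
qed

lemma profiles_closed:
  assumes "\<And>n. u n \<in> profiles" "\<And>x. (\<lambda>n. u n x) \<longlonglongrightarrow> l x"
  shows "l \<in> profiles"
proof -
  have "l \<in> borel_measurable borel"
    by (rule borel_measurable_LIMSEQ_metric[OF profilesD(1)[OF assms(1)] assms(2)])
  moreover have "l x \<in> admissible \<nu> \<alpha> al au R" for x
    by (rule closed_sequentially[OF closed_admissible[OF pos(2)] profilesD(2)[OF assms(1)] assms(2)])
  ultimately show ?thesis by (simp add: profiles_def)
qed

lemma profiles_dist_le: "m \<in> profiles \<Longrightarrow> m' \<in> profiles \<Longrightarrow> dist (m x) (m' x) \<le> 2 * R"
  using norm_triangle_ineq4[of "m x" "m' x"] admissibleD(3)[OF profilesD(2), of m x]
    admissibleD(3)[OF profilesD(2), of m' x] by (simp add: dist_norm)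

end

section \<open>A contraction principle for the uniform distance\<close>

text \<open>Banach's argument, with the sup distance present only through its upper bounds
  \<open>d\<close>. Closure of \<open>A\<close> under pointwise limits takes the place of
  completeness, and \<open>B\<close> starts the geometric estimate.\<close>

lemma uniform_contraction_fixpoint:
  fixes F :: "('a \<Rightarrow> 'b::complete_space) \<Rightarrow> 'a \<Rightarrow> 'b"
  assumes m0: "m0 \<in> A" and F: "\<And>m. m \<in> A \<Longrightarrow> F m \<in> A"
    and closed: "\<And>u l. (\<And>n. u n \<in> A) \<Longrightarrow> (\<And>x. (\<lambda>n::nat. u n x) \<longlonglongrightarrow> l x) \<Longrightarrow> l \<in> A"
    and bounded: "\<And>m m' x. m \<in> A \<Longrightarrow> m' \<in> A \<Longrightarrow> dist (m x) (m' x) \<le> B"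
    and q: "0 \<le> q" "q < 1"
    and contr: "\<And>m m' d x. m \<in> A \<Longrightarrow> m' \<in> A \<Longrightarrow> (\<And>x. dist (m x) (m' x) \<le> d) \<Longrightarrow>
      dist (F m x) (F m' x) \<le> q * d"
  shows "\<exists>!m. m \<in> A \<and> F m = m"
proof -
  have iter: "(F ^^ n) m \<in> A" if "m \<in> A" for n m using that F by (induction n) auto
  have pow: "dist ((F ^^ n) m x) ((F ^^ n) m' x) \<le> q ^ n * B" if "m \<in> A" "m' \<in> A" for n m m' x
  proof (induction n arbitrary: x)
    case 0
    show ?case using bounded that by simp
  next
    case (Suc n)
    have "dist (F ((F ^^ n) m) x) (F ((F ^^ n) m') x) \<le> q * (q ^ n * B)"
      using iter that Suc by (intro contr) auto
    then show ?case by (simp add: mult.assoc)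
  qed
  have lim0: "(\<lambda>n. q ^ n * B) \<longlonglongrightarrow> 0"
    using q by (intro tendsto_mult_left_zero LIMSEQ_realpow_zero) auto
  have eq: "m x = m' x" if "\<And>n. dist (m x) (m' x) \<le> q ^ n * B" for m m' :: "'a \<Rightarrow> 'b" and x
    using LIMSEQ_le_const[OF lim0, of "dist (m x) (m' x)"] that by (simp add: order_antisym_conv)
  define u where "u n = (F ^^ n) m0" for n
  have u: "u n \<in> A" for n using iter m0 by (simp add: u_def)
  \<comment> \<open>\<open>u (n + k)\<close> is the \<open>n\<close>-th iterate started from
    \<open>u k\<close>, so two orbits are compared after the same number of steps.\<close>
  have dist_u: "dist (u n x) (u (n + k) x) \<le> q ^ n * B" for n k x
    using pow[OF m0 u[of k], of n x] by (simp add: u_def funpow_add)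
  have "Cauchy (\<lambda>n. u n x)" for x
    unfolding Cauchy_altdef
  proof (intro allI impI)
    fix \<epsilon> :: real assume "0 < \<epsilon>"
    then obtain N where N: "\<And>n. N \<le> n \<Longrightarrow> norm (q ^ n * B) < \<epsilon>"
      using LIMSEQ_D[OF lim0] by (metis diff_zero)
    have "dist (u m x) (u n x) < \<epsilon>" if "N \<le> m" "m < n" for m n
      using dist_u[of m x "n - m"] N[OF that(1)] that(2) by simp
    then show "\<exists>M. \<forall>m\<ge>M. \<forall>n>m. dist (u m x) (u n x) < \<epsilon>" by blast
  qed
  then have "\<forall>x. \<exists>l. (\<lambda>n. u n x) \<longlonglongrightarrow> l" by (simp add: Cauchy_convergent convergentD)
  then obtain l where l: "\<And>x. (\<lambda>n. u n x) \<longlonglongrightarrow> l x" by metis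
  have lA: "l \<in> A" by (rule closed[OF u l])
  have dist_l: "dist (u n x) (l x) \<le> q ^ n * B" for n x
  proof (rule LIMSEQ_le_const2)
    show "(\<lambda>k. dist (u n x) (u (k + n) x)) \<longlonglongrightarrow> dist (u n x) (l x)"
      by (intro tendsto_intros LIMSEQ_ignore_initial_segment l)
    have "dist (u n x) (u (k + n) x) \<le> q ^ n * B" for k
      using dist_u[of n x k] by (simp add: add.commute)
    then show "\<exists>N. \<forall>k\<ge>N. dist (u n x) (u (k + n) x) \<le> q ^ n * B" by blast
  qed
  have "(\<lambda>n. u (Suc n) x) \<longlonglongrightarrow> F l x" for x
  proof (rule metric_LIMSEQ_I)
    fix \<epsilon> :: real assume "0 < \<epsilon>"
    then obtain N where N: "\<And>n. N \<le> n \<Longrightarrow> norm (q ^ n * B) < \<epsilon>"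
      using LIMSEQ_D[OF lim0] by (metis diff_zero)
    have "dist (u (Suc n) x) (F l x) < \<epsilon>" if "N \<le> n" for n
    proof -
      have "dist (u (Suc n) x) (F l x) \<le> q * (q ^ n * B)"
        using contr[OF u lA dist_l, of n x] by (simp add: u_def)
      then show ?thesis using N[of "Suc n"] that by simp
    qed
    then show "\<exists>N. \<forall>n\<ge>N. dist (u (Suc n) x) (F l x) < \<epsilon>" by blast
  qed
  then have Fl: "F l = l" using LIMSEQ_unique LIMSEQ_Suc[OF l] by blast
  show ?thesis
  proof (rule ex1I[of _ l])
    show "l \<in> A \<and> F l = l" using lA Fl by simp
    fix m assume m: "m \<in> A \<and> F m = m"
    have fp: "(F ^^ n) m = m" "(F ^^ n) l = l" for n
      using m Fl by (induction n) auto
    show "m = l"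
      by (intro ext eq) (use pow[of m l] m lA fp in metis)
  qed
qed

section \<open>Solutions as fixed points\<close>

lemma AE_component_nonzero: "AE v in (lborel :: (real^'n) measure). v $ k \<noteq> 0"
proof (rule AE_I')
  have "closed {v :: real^'n. v $ k = 0}" by (intro closed_Collect_eq continuous_intros)
  then show "{v :: real^'n. v $ k = 0} \<in> null_sets lborel"
    using negligible_standard_hyperplane_cart[of k]
    by (simp add: negligible_iff_null_sets null_sets_completion_iff)
qed auto

text \<open>Everything follows from lying above the attenuated inflow \<open>E v * g v\<close>, so
  it applies alike to the iterates and to an arbitrary mild solution. Mass, energy and the
  half-space fluxes are monotone, and \<open>flux_product_le\<close> converts the fluxes. The bound
  with \<open>v $ 1 * v $ 1\<close> feeds the temperature; the one with the full energy is demanded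
  of solutions.\<close>

lemma dominating_moments:
  fixes fL fR :: "vel \<Rightarrow> real" and \<tau> \<gamma> :: real
  defines "g \<equiv> inflow fL fR"
  defines "E \<equiv> \<lambda>v :: vel. exp (- (a_u g / (\<tau> * \<bar>v $ 1\<bar>)))"
  assumes \<tau>: "0 < \<tau>" and g: "g \<in> L12" "AE v in lborel. 0 \<le> g v"
    and h: "h \<in> L12" "AE v in lborel. E v * g v \<le> h v"
    and flux: "\<gamma> < (LINT v:{v. 0 < v $ 1}|lborel. E v * fL v * \<bar>v $ 1\<bar>) *
       (LINT v:{v. v $ 1 < 0}|lborel. E v * fR v * \<bar>v $ 1\<bar>)"
    and al: "0 < a_l \<tau> g"
  shows "a_l \<tau> g \<le> (LINT v|lborel. h v)" "c_l \<tau> g \<le> (LINT v|lborel. h v * (norm v)\<^sup>2)"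
    "\<gamma> \<le> (LINT v|lborel. h v) * (LINT v|lborel. h v * (v $ 1 * v $ 1)) - (LINT v|lborel. h v * v $ 1)\<^sup>2"
    "\<gamma> \<le> (LINT v|lborel. h v) * (LINT v|lborel. h v * (norm v)\<^sup>2) - (LINT v|lborel. h v * v $ 1)\<^sup>2"
proof -
  have au: "0 \<le> a_u g" unfolding a_u_def using integral_nonneg_AE[OF g(2)] by simp
  have E: "0 \<le> E v" "E v \<le> 1" for v using au \<tau> by (auto simp: E_def)
  have meas [measurable]: "g \<in> borel_measurable borel" "E \<in> borel_measurable borel"
    using L12_measurable[OF g(1)] unfolding E_def by auto
  have Eg: "(\<lambda>v. E v * g v) \<in> L12" unfolding L12_def mem_Collect_eq
  proof (rule Bochner_Integration.integrable_bound)
    show "integrable lborel (\<lambda>v. (1 + (norm v)\<^sup>2) * g v)" using g(1) by (simp add: L12_def)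
    show "AE v in lborel. norm ((1 + (norm v)\<^sup>2) * (E v * g v)) \<le> norm ((1 + (norm v)\<^sup>2) * g v)"
    proof (intro AE_I2)
      fix v :: vel
      have "\<bar>1 + (norm v)\<^sup>2\<bar> * (\<bar>E v\<bar> * \<bar>g v\<bar>) \<le> \<bar>1 + (norm v)\<^sup>2\<bar> * (1 * \<bar>g v\<bar>)"
        using E[of v] by (intro mult_left_mono mult_right_mono) auto
      then show "norm ((1 + (norm v)\<^sup>2) * (E v * g v)) \<le> norm ((1 + (norm v)\<^sup>2) * g v)"
        by (simp add: abs_mult)
    qed
  qed measurable
  have Eg0: "AE v in lborel. 0 \<le> E v * g v" using g(2) by eventually_elim (use E in auto)
  have h0: "AE v in lborel. 0 \<le> h v" using Eg0 h(2) by eventually_elim auto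
  have a_l: "a_l \<tau> g = (LINT v|lborel. E v * g v)"
    and c_l: "c_l \<tau> g = (LINT v|lborel. E v * g v * (norm v)\<^sup>2)"
    by (simp_all add: a_l_def c_l_def E_def)
  show mass: "a_l \<tau> g \<le> (LINT v|lborel. h v)"
    unfolding a_l
    using L12_integrable(1)[OF Eg] L12_integrable(1)[OF h(1)] h(2) by (intro integral_mono_AE)
  show "c_l \<tau> g \<le> (LINT v|lborel. h v * (norm v)\<^sup>2)"
    unfolding c_l
    using L12_integrable(2)[OF Eg] L12_integrable(2)[OF h(1)] h(2)
    by (intro integral_mono_AE) (auto elim!: eventually_mono intro: mult_right_mono)
  have fluxes: "0 \<le> (LINT v|lborel. E v * g v * \<bar>v $ 1\<bar> * indicator S v)"
      "(LINT v|lborel. E v * g v * \<bar>v $ 1\<bar> * indicator S v) \<le> (LINT v|lborel. h v * \<bar>v $ 1\<bar> * indicator S v)"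
    if [measurable]: "S \<in> sets borel" for S
  proof -
    show "0 \<le> (LINT v|lborel. E v * g v * \<bar>v $ 1\<bar> * indicator S v)"
      by (rule integral_nonneg_AE) (use Eg0 in auto)
    show "(LINT v|lborel. E v * g v * \<bar>v $ 1\<bar> * indicator S v) \<le> (LINT v|lborel. h v * \<bar>v $ 1\<bar> * indicator S v)"
    proof (rule integral_mono_AE)
      show "integrable lborel (\<lambda>v. E v * g v * \<bar>v $ 1\<bar> * indicator S v)"
        "integrable lborel (\<lambda>v. h v * \<bar>v $ 1\<bar> * indicator S v)"
        using that by (intro integrable_real_mult_indicator L12_integrable(5)[OF Eg] L12_integrable(5)[OF h(1)]; simp)+
      show "AE v in lborel. E v * g v * \<bar>v $ 1\<bar> * indicator S v \<le> h v * \<bar>v $ 1\<bar> * indicator S v"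
        using h(2) by eventually_elim (intro mult_right_mono, auto)
    qed
  qed
  have S [measurable]: "{v :: vel. 0 < v $ 1} \<in> sets borel" "{v :: vel. v $ 1 < 0} \<in> sets borel" by measurable
  have "(LINT v:{v. 0 < v $ 1}|lborel. E v * fL v * \<bar>v $ 1\<bar>) = (LINT v|lborel. E v * g v * \<bar>v $ 1\<bar> * indicator {v. 0 < v $ 1} v)"
    "(LINT v:{v. v $ 1 < 0}|lborel. E v * fR v * \<bar>v $ 1\<bar>) = (LINT v|lborel. E v * g v * \<bar>v $ 1\<bar> * indicator {v. v $ 1 < 0} v)"
    unfolding set_lebesgue_integral_def g_def inflow_def
    by (intro Bochner_Integration.integral_cong; auto simp: indicator_def)+
  then have "\<gamma> < (LINT v|lborel. E v * g v * \<bar>v $ 1\<bar> * indicator {v. 0 < v $ 1} v) *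
      (LINT v|lborel. E v * g v * \<bar>v $ 1\<bar> * indicator {v. v $ 1 < 0} v)" (is "_ < ?P * ?N")
    using flux by simp
  also have "\<dots> \<le> (LINT v|lborel. h v * \<bar>v $ 1\<bar> * indicator {v. 0 < v $ 1} v) *
      (LINT v|lborel. h v * \<bar>v $ 1\<bar> * indicator {v. v $ 1 < 0} v)" (is "_ \<le> ?P' * ?N'")
    using fluxes[OF S(1)] fluxes[OF S(2)] by (intro mult_mono) auto
  finally have "\<gamma> < ?P' * ?N'" .
  moreover have "0 \<le> ?P' * ?N'"
    using fluxes[OF S(1)] fluxes[OF S(2)] by (intro mult_nonneg_nonneg) auto
  moreover have "0 < density h" using mass al by (simp add: density_def)
  \<comment> \<open>\<open>flux_product_le\<close> yields four times the product of the fluxes; the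
    product being nonnegative, the factor may be dropped.\<close>
  ultimately show *: "\<gamma> \<le> (LINT v|lborel. h v) * (LINT v|lborel. h v * (v $ 1 * v $ 1)) - (LINT v|lborel. h v * v $ 1)\<^sup>2"
    using flux_product_le[OF h(1) h0, of 1] by linarith
  have "(LINT v|lborel. h v * (v $ 1 * v $ 1)) \<le> (LINT v|lborel. h v * (norm v)\<^sup>2)"
  proof (intro integral_mono_AE L12_integrable(2,4) h(1))
    show "AE v in lborel. h v * (v $ 1 * v $ 1) \<le> h v * (norm v)\<^sup>2"
      using h0
    proof eventually_elim
      case (elim v)
      show ?case using elim abs_mult_component_le[of v 1 1] by (intro mult_left_mono) auto
    qed
  qed
  then have "(LINT v|lborel. h v) * (LINT v|lborel. h v * (v $ 1 * v $ 1)) \<le> (LINT v|lborel. h v) * (LINT v|lborel. h v * (norm v)\<^sup>2)"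
    using mass al by (intro mult_left_mono) auto
  then show "\<gamma> \<le> (LINT v|lborel. h v) * (LINT v|lborel. h v * (norm v)\<^sup>2) - (LINT v|lborel. h v * v $ 1)\<^sup>2"
    using * by linarith
qed

section \<open>The fixed point iteration for given constants\<close>

text \<open>\<open>R\<close> adds the mass and energy bounds, and \<open>\<alpha>\<close> is the
  constant produced by \<open>moment_admissible\<close>. In \<open>small\<close> the gain is granted
  half of \<open>au\<close> and of \<open>cu\<close>, because the inflow accounts for the other half
  by the definition of \<open>a_u\<close> and \<open>c_u\<close>.\<close>

locale slab_problem = slab \<nu> \<tau> al au R \<alpha> e C "inflow fL fR"
  for \<nu> \<tau> al au R \<alpha> e C :: real and fL fR :: "vel \<Rightarrow> real" +
  fixes cu \<gamma> :: real
  assumes \<nu>: "- 1 / 2 < \<nu>" "\<nu> < 1"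
    and params: "au = a_u (inflow fL fR)" "al = a_l \<tau> (inflow fL fR)" "cu = c_u (inflow fL fR)"
      "R = au + cu" "\<alpha> = min (1 - \<nu>) (1 + 2 * \<nu>) * (\<gamma> / (3 * au\<^sup>2))"
    and \<gamma>: "0 < \<gamma>"
      "\<gamma> < (LINT v:{v. 0 < v $ 1}|lborel. exp (- (a_u (inflow fL fR) / (\<tau> * \<bar>v $ 1\<bar>))) * fL v * \<bar>v $ 1\<bar>) *
       (LINT v:{v. v $ 1 < 0}|lborel. exp (- (a_u (inflow fL fR) / (\<tau> * \<bar>v $ 1\<bar>))) * fR v * \<bar>v $ 1\<bar>)"
    and small: "contraction_rate < 1" "au * C * slowing e (al / 2) \<tau> \<le> au / 2"
      "au * C * slowing e (al / 2) \<tau> \<le> cu / 2"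
begin

abbreviation "data \<equiv> inflow fL fR"

lemma dominating_admissible:
  assumes "h \<in> L12" "AE v in lborel. exp (- (a_u data / (\<tau> * \<bar>v $ 1\<bar>))) * data v \<le> h v"
    and "(LINT v|lborel. h v) \<le> au" "(LINT v|lborel. h v * (norm v)\<^sup>2) \<le> cu"
  shows "moment h \<in> admissible \<nu> \<alpha> al au R"
  unfolding params(4,5)
proof (rule moment_admissible[of h \<nu> al \<gamma> au cu 1])
  note d = dominating_moments[OF pos(1) g(1,3) assms(1,2) \<gamma>(2)]
  show "AE v in lborel. 0 \<le> h v" using assms(2) g(3)
    by eventually_elim (meson exp_ge_zero mult_nonneg_nonneg order_trans)
  show "al \<le> (LINT v|lborel. h v)" using d(1) pos(2) by (simp add: params(2))
  show "\<gamma> \<le> (LINT v|lborel. h v) * (LINT v|lborel. h v * (v $ 1 * v $ 1)) - (LINT v|lborel. h v * v $ 1)\<^sup>2"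
    using d(3) pos(2) by (simp add: params(2))
qed (use assms \<nu> pos \<gamma> in auto)

lemma transport_dominates:
  assumes "m \<in> profiles" "x \<in> {0..1}"
  shows "AE v in lborel. exp (- (a_u data / (\<tau> * \<bar>v $ 1\<bar>))) * data v \<le> transport \<nu> \<tau> data m x v"
  using transport_lower[OF assms] by (simp add: slowness_def params(1))

lemma transport_upper_bounds:
  assumes "m \<in> profiles" "x \<in> {0..1}"
  shows "(LINT v|lborel. transport \<nu> \<tau> data m x v) \<le> au"
    "(LINT v|lborel. transport \<nu> \<tau> data m x v * (norm v)\<^sup>2) \<le> cu"
proof -
  have "(LINT v|lborel. transport \<nu> \<tau> data m x v) \<le> (LINT v|lborel. data v) + au * C * slowing e (al / 2) \<tau>"
    using transport_integral_le[OF assms, of "\<lambda>v. 1"] by simp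
  then show "(LINT v|lborel. transport \<nu> \<tau> data m x v) \<le> au"
    using small(2) params(1) by (simp add: a_u_def)
  have "(LINT v|lborel. transport \<nu> \<tau> data m x v * (norm v)\<^sup>2)
      \<le> (LINT v|lborel. data v * (norm v)\<^sup>2) + au * C * slowing e (al / 2) \<tau>"
    by (rule transport_integral_le[OF assms]) auto
  then show "(LINT v|lborel. transport \<nu> \<tau> data m x v * (norm v)\<^sup>2) \<le> cu"
    using small(3) params(3) by (simp add: c_u_def)
qed

lemma update_profiles:
  assumes "m \<in> profiles"
  shows "update m \<in> profiles"
proof -
  have "update m x \<in> admissible \<nu> \<alpha> al au R" for x
    unfolding update_def
    by (intro dominating_admissible transport_L12 transport_dominates transport_upper_bounds
        assms clamp01_mem)
  then show ?thesis using borel_measurable_update[OF assms] by (simp add: profiles_def)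
qed

lemma fixed_profile: "\<exists>!m. m \<in> profiles \<and> update m = m"
proof (rule uniform_contraction_fixpoint)
  \<comment> \<open>The constant profile of the inflow moments starts the iteration: the data
    dominate their own attenuation.\<close>
  have "AE v in lborel. exp (- (a_u data / (\<tau> * \<bar>v $ 1\<bar>))) * data v \<le> data v"
    using g(3)
  proof eventually_elim
    case (elim v)
    have "exp (- (a_u data / (\<tau> * \<bar>v $ 1\<bar>))) \<le> 1" using pos by (simp flip: params(1))
    from mult_right_mono[OF this elim] show ?case by simp
  qed
  moreover have "(LINT v|lborel. data v) \<le> au" using pos params(1) by (simp add: a_u_def)
  moreover have "(LINT v|lborel. data v * (norm v)\<^sup>2) \<le> cu"
  proof -
    have "0 \<le> (LINT v|lborel. data v * (norm v)\<^sup>2)"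
      by (rule integral_nonneg_AE) (use g(3) in auto)
    then show ?thesis by (simp add: params(3) c_u_def)
  qed
  ultimately have "moment data \<in> admissible \<nu> \<alpha> al au R"
    by (intro dominating_admissible g(1))
  then show "(\<lambda>x. moment data) \<in> profiles" by (simp add: profiles_def)
  show "0 \<le> contraction_rate"
  proof -
    have "0 \<le> slowing e (al / 2) \<tau>"
      unfolding slowing_def using pos by (intro integral_nonneg_AE AE_I2) (auto intro!: mult_nonneg_nonneg)
    moreover have "0 \<le> (LINT v|lborel. (1 + (norm v)\<^sup>2) * (1 / \<bar>v $ 1\<bar> * data v))"
      by (intro integral_nonneg_AE) (use g(3) in \<open>auto intro!: mult_nonneg_nonneg\<close>)
    ultimately show ?thesis unfolding contraction_rate_def using pos lip_nonneg by simp
  qed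
  show "\<And>m m' d x. m \<in> profiles \<Longrightarrow> m' \<in> profiles \<Longrightarrow> (\<And>x. dist (m x) (m' x) \<le> d) \<Longrightarrow>
      dist (update m x) (update m' x) \<le> contraction_rate * d"
    unfolding update_def by (rule transport_contraction[OF _ _ _ clamp01_mem])
qed (fact update_profiles profiles_closed profiles_dist_le small(1))+

lemma damping_eq:
  assumes "\<And>y. y \<in> {0..1} \<Longrightarrow> density (f y) = fst (m y)" "0 \<le> a" "a \<le> b" "b \<le> 1"
  shows "damping \<tau> f v a b = attenuation \<tau> m v a b" "damping \<tau> f v a b = attenuation \<tau> m v b a"
proof -
  have "(LINT y:{a..b}|lborel. density (f y)) = depth m a b"
    unfolding depth_def using assms by (intro set_lebesgue_integral_cong) auto
  then show "damping \<tau> f v a b = attenuation \<tau> m v a b" "damping \<tau> f v a b = attenuation \<tau> m v b a"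
    using assms(3) by (simp_all add: damping_def attenuation_def slowness_def)
qed

text \<open>The integrals of the mild formula see \<open>f\<close> only through its moments, so they
  are those of the transport formula for \<open>m\<close>, and the integrability clauses hold by
  \<open>emission_integrable\<close>. One direction serves existence, the other uniqueness.\<close>

lemma mild_formula_iff:
  assumes m: "m \<in> profiles" and f: "\<And>y. y \<in> {0..1} \<Longrightarrow> f y \<in> L12 \<and> moment (f y) = m y"
    and x: "x \<in> {0..1}" and v: "v $ 1 \<noteq> 0"
  shows "((v $ 1 > 0 \<longrightarrow>
           set_integrable lborel {0..x}
             (\<lambda>y. damping \<tau> f v y x * density (f y) * gaussian \<nu> (f y) v) \<and>
           f x v = damping \<tau> f v 0 x * fL v + 1 / (\<tau> * \<bar>v $ 1\<bar>) *
             (LINT y:{0..x}|lborel. damping \<tau> f v y x * density (f y) * gaussian \<nu> (f y) v)) \<and>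
        (v $ 1 < 0 \<longrightarrow>
           set_integrable lborel {x..1}
             (\<lambda>y. damping \<tau> f v x y * density (f y) * gaussian \<nu> (f y) v) \<and>
           f x v = damping \<tau> f v x 1 * fR v + 1 / (\<tau> * \<bar>v $ 1\<bar>) *
             (LINT y:{x..1}|lborel. damping \<tau> f v x y * density (f y) * gaussian \<nu> (f y) v)))
    \<longleftrightarrow> f x v = transport \<nu> \<tau> data m x v"
proof -
  have d: "density (f y) = fst (m y)" if "y \<in> {0..1}" for y
    using f[OF that] density_eq_moment by auto
  have G: "gaussian \<nu> (f y) v = mgaussian \<nu> (m y) v" if "y \<in> {0..1}" for y
  proof -
    have "density (f y) \<noteq> 0" using d[OF that] profilesD(3)[OF m, of y] pos by simp
    then show ?thesis using gaussian_eq_mgaussian f[OF that] by auto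
  qed
  note damp = damping_eq[of f m, OF d]
  have up: "upwind x v = {0..x}" if "0 < v $ 1" using that by (simp add: upwind_def)
  have dn: "upwind x v = {x..1}" if "v $ 1 < 0" using that by (simp add: upwind_def)
  have E1: "damping \<tau> f v y x * density (f y) * gaussian \<nu> (f y) v = emission \<nu> \<tau> m x v y" if "y \<in> {0..x}" for y
    using that x damp(2)[of y x v] d[of y] G[of y] by (simp add: emission_def)
  have E2: "damping \<tau> f v x y * density (f y) * gaussian \<nu> (f y) v = emission \<nu> \<tau> m x v y" if "y \<in> {x..1}" for y
    using that x damp(1)[of x y v] d[of y] G[of y] by (simp add: emission_def)
  have I1: "set_integrable lborel {0..x} (\<lambda>y. damping \<tau> f v y x * density (f y) * gaussian \<nu> (f y) v)
      \<longleftrightarrow> set_integrable lborel {0..x} (emission \<nu> \<tau> m x v)"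
    by (intro set_integrable_cong refl E1)
  have I2: "set_integrable lborel {x..1} (\<lambda>y. damping \<tau> f v x y * density (f y) * gaussian \<nu> (f y) v)
      \<longleftrightarrow> set_integrable lborel {x..1} (emission \<nu> \<tau> m x v)"
    by (intro set_integrable_cong refl E2)
  have L1: "(LINT y:{0..x}|lborel. damping \<tau> f v y x * density (f y) * gaussian \<nu> (f y) v)
      = (LINT y:{0..x}|lborel. emission \<nu> \<tau> m x v y)"
    using E1 by (intro set_lebesgue_integral_cong) auto
  have L2: "(LINT y:{x..1}|lborel. damping \<tau> f v x y * density (f y) * gaussian \<nu> (f y) v)
      = (LINT y:{x..1}|lborel. emission \<nu> \<tau> m x v y)"
    using E2 by (intro set_lebesgue_integral_cong) auto
  note int = emission_integrable(1)[OF m x, of v]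
  show ?thesis
  proof (cases "0 < v $ 1")
    case True
    then show ?thesis
      unfolding I1 L1 using int up damp(2)[of 0 x v] x
      by (simp add: transport_def inlet_def slowness_def inflow_def)
  next
    case False
    then have "v $ 1 < 0" using v by simp
    then show ?thesis
      unfolding I2 L2 using int dn damp(1)[of x 1 v] x
      by (simp add: transport_def inlet_def slowness_def inflow_def)
  qed
qed

end

section \<open>Existence\<close>

context slab_problem
begin

definition solution_profile :: "real \<Rightarrow> moments" where
  "solution_profile = (THE m. m \<in> profiles \<and> update m = m)"

definition solution :: "real \<Rightarrow> vel \<Rightarrow> real" where
  "solution = transport \<nu> \<tau> data solution_profile"

lemma solution_profile: "solution_profile \<in> profiles" "update solution_profile = solution_profile"
  using theI'[OF fixed_profile] by (auto simp: solution_profile_def)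

lemma solution_L12: "x \<in> {0..1} \<Longrightarrow> solution x \<in> L12"
  unfolding solution_def by (rule transport_L12[OF solution_profile(1)])

lemma moment_solution:
  assumes "x \<in> {0..1}"
  shows "moment (solution x) = solution_profile x"
  using solution_profile(2)[THEN fun_cong, of x] clamp01_id[OF assms] by (simp add: update_def solution_def)

lemma solution_nonneg: "x \<in> {0..1} \<Longrightarrow> AE v in lborel. 0 \<le> solution x v"
  unfolding solution_def by (rule transport_nonneg[OF solution_profile(1)])

lemma solution_bounds: "satisfies_bounds \<tau> data \<gamma> solution"
  unfolding satisfies_bounds_def
proof (intro ballI conjI)
  fix x :: real assume x: "x \<in> {0..1}"
  note T = transport_upper_bounds[OF solution_profile(1) x] transport_dominates[OF solution_profile(1) x]
  have "0 < a_l \<tau> data" using pos params by simp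
  note D = dominating_moments[OF pos(1) g(1,3) solution_L12[OF x] T(3)[folded solution_def] \<gamma>(2) this]
  show "a_l \<tau> data \<le> (LINT v|lborel. solution x v)"
    "c_l \<tau> data \<le> (LINT v|lborel. solution x v * (norm v)\<^sup>2)"
    "\<gamma> \<le> (LINT v|lborel. solution x v) * (LINT v|lborel. solution x v * (norm v)\<^sup>2)
        - (LINT v|lborel. solution x v * v $ 1)\<^sup>2" by (fact D)+
  show "(LINT v|lborel. solution x v) \<le> a_u data" "(LINT v|lborel. solution x v * (norm v)\<^sup>2) \<le> c_u data"
    unfolding params(1,3)[symmetric] solution_def by (fact T)+
qed

text \<open>By Fubini it suffices that the weighted velocity integral is at most
  \<open>au + cu\<close> at each point of the slab.\<close>

lemma solution_integrable:
  "set_integrable (lborel :: (real \<times> vel) measure) ({0..1} \<times> UNIV) (\<lambda>(x, v). (1 + (norm v)\<^sup>2) * solution x v)"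
proof -
  let ?f = "\<lambda>p :: real \<times> vel. indicator {0..1} (fst p) * ((1 + (norm (snd p))\<^sup>2) * solution (fst p) (snd p))"
  have [measurable]: "(\<lambda>p. solution (fst p) (snd p)) \<in> borel_measurable (lborel \<Otimes>\<^sub>M lborel)"
    unfolding solution_def by (intro borel_measurable_transport solution_profile) measurable
  have meas [measurable]: "?f \<in> borel_measurable (lborel \<Otimes>\<^sub>M lborel)" by measurable
  have "integrable (lborel \<Otimes>\<^sub>M lborel) ?f"
  proof (rule lborel_pair.Fubini_integrable[OF meas])
    show "AE x in lborel. integrable lborel (\<lambda>v. ?f (x, v))"
    proof (intro AE_I2)
      fix x :: real
      show "integrable lborel (\<lambda>v. ?f (x, v))"
        using solution_L12[of x] by (cases "x \<in> {0..1}") (auto simp: L12_def)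
    qed
    show "integrable lborel (\<lambda>x. LINT v|lborel. norm (?f (x, v)))"
    proof (rule Bochner_Integration.integrable_bound)
      show "integrable lborel (\<lambda>x. (au + cu) * indicator {0..1 :: real} x)" by simp
      show "(\<lambda>x. LINT v|lborel. norm (?f (x, v))) \<in> borel_measurable lborel" by measurable
      show "AE x in lborel. norm (LINT v|lborel. norm (?f (x, v))) \<le> norm ((au + cu) * indicator {0..1} x)"
      proof (intro AE_I2)
        fix x :: real
        show "norm (LINT v|lborel. norm (?f (x, v))) \<le> norm ((au + cu) * indicator {0..1} x)"
        proof (cases "x \<in> {0..1}")
          case True
          have "(LINT v|lborel. norm (?f (x, v))) = (LINT v|lborel. solution x v + solution x v * (norm v)\<^sup>2)"
            using solution_nonneg[OF True] True L12_measurable[OF solution_L12[OF True]]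
            by (intro integral_cong_AE) (auto simp: algebra_simps elim!: eventually_mono)
          also have "\<dots> = (LINT v|lborel. solution x v) + (LINT v|lborel. solution x v * (norm v)\<^sup>2)"
            using L12_integrable[OF solution_L12[OF True]] by simp
          also have "\<dots> \<le> au + cu"
            unfolding solution_def by (intro add_mono transport_upper_bounds solution_profile True)
          finally have "(LINT v|lborel. norm (?f (x, v))) \<le> au + cu" .
          moreover have "0 \<le> (LINT v|lborel. norm (?f (x, v)))" by simp
          ultimately show ?thesis using True by simp
        qed simp
      qed
    qed
  qed
  then show ?thesis unfolding set_integrable_def lborel_prod
    by (rule back_subst[of "integrable lborel"]) (auto simp: indicator_def fun_eq_iff)
qed

lemma mild_solution_solution: "mild_solution \<nu> \<tau> fL fR solution"
  unfolding mild_solution_def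
proof (intro conjI ballI)
  show "set_integrable (lborel :: (real \<times> vel) measure) ({0..1} \<times> UNIV) (\<lambda>(x, v). (1 + (norm v)\<^sup>2) * solution x v)"
    by (rule solution_integrable)
next
  fix x :: real assume x: "x \<in> {0..1}"
  show "solution x \<in> L12" by (rule solution_L12[OF x])
  have "solution x v = transport \<nu> \<tau> data solution_profile x v" for v by (simp add: solution_def)
  note * = mild_formula_iff[OF solution_profile(1) _ x, of solution, THEN iffD2, OF _ _ this]
  show "AE v in lborel.
        (v $ 1 > 0 \<longrightarrow>
           set_integrable lborel {0..x}
             (\<lambda>y. damping \<tau> solution v y x * density (solution y) * gaussian \<nu> (solution y) v) \<and>
           solution x v = damping \<tau> solution v 0 x * fL v + 1 / (\<tau> * \<bar>v $ 1\<bar>) *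
             (LINT y:{0..x}|lborel. damping \<tau> solution v y x * density (solution y) * gaussian \<nu> (solution y) v)) \<and>
        (v $ 1 < 0 \<longrightarrow>
           set_integrable lborel {x..1}
             (\<lambda>y. damping \<tau> solution v x y * density (solution y) * gaussian \<nu> (solution y) v) \<and>
           solution x v = damping \<tau> solution v x 1 * fR v + 1 / (\<tau> * \<bar>v $ 1\<bar>) *
             (LINT y:{x..1}|lborel. damping \<tau> solution v x y * density (solution y) * gaussian \<nu> (solution y) v))"
    using AE_component_nonzero[of 1]
    by eventually_elim (rule *, use solution_L12 moment_solution in auto)
qed

section \<open>Uniqueness: an arbitrary solution within the bounds\<close>

context
  fixes h :: "real \<Rightarrow> vel \<Rightarrow> real"
  assumes h: "mild_solution \<nu> \<tau> fL fR h" "\<forall>x\<in>{0..1}. AE v in lborel. 0 \<le> h x v"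
    "satisfies_bounds \<tau> data \<gamma> h"
begin

lemma h_bounds:
  assumes "x \<in> {0..1}"
  shows "h x \<in> L12" "AE v in lborel. 0 \<le> h x v" "al \<le> density (h x)" "density (h x) \<le> au"
    "(LINT v|lborel. h x v) \<le> au" "(LINT v|lborel. h x v * (norm v)\<^sup>2) \<le> cu"
  using h assms by (auto simp: mild_solution_def satisfies_bounds_def params density_def)

lemma h_damping_ge:
  assumes "0 \<le> a" "a \<le> b" "b \<le> 1"
  shows "exp (- (au / (\<tau> * \<bar>v $ 1\<bar>))) \<le> damping \<tau> h v a b"
proof -
  have "(LINT y:{a..b}|lborel. density (h y)) \<le> au"
  \<comment> \<open>Integrability of the density of \<open>h\<close> is not yet established; if it
    failed, the integral would be 0 by convention and the bound would hold all the same.\<close>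
  proof (cases "set_integrable lborel {a..b} (\<lambda>y. density (h y))")
    case True
    have "(LINT y:{a..b}|lborel. density (h y)) \<le> (LINT y:{a..b}|lborel. au)"
      using assms h_bounds(4)
      by (intro set_integral_mono True borel_integrable_atLeastAtMost' continuous_intros) auto
    also have "\<dots> = au * (b - a)" using assms by (simp add: set_lebesgue_integral_def)
    also have "\<dots> \<le> au * 1" using assms pos by (intro mult_left_mono) auto
    finally show ?thesis by simp
  next
    case False
    then have "(LINT y:{a..b}|lborel. density (h y)) = 0"
      unfolding set_integrable_def set_lebesgue_integral_def by (rule not_integrable_integral_eq)
    then show ?thesis using pos by simp
  qed
  then have "1 / (\<tau> * \<bar>v $ 1\<bar>) * (LINT y:{a..b}|lborel. density (h y)) \<le> 1 / (\<tau> * \<bar>v $ 1\<bar>) * au"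
    using pos by (intro mult_left_mono) auto
  then show ?thesis by (simp add: damping_def)
qed

lemma h_emission_nonneg:
  assumes "y \<in> {0..1}"
  shows "0 \<le> damping \<tau> h v a b * density (h y) * gaussian \<nu> (h y) v"
proof -
  have "0 < density (h y)" using h_bounds(3)[OF assms] pos by linarith
  moreover have "0 \<le> gaussian \<nu> (h y) v"
    by (rule gaussian_nonneg[OF h_bounds(1,2)[OF assms] calculation \<nu>])
  ultimately show ?thesis by (simp add: damping_def)
qed

lemma h_dominates:
  assumes x: "x \<in> {0..1}"
  shows "AE v in lborel. exp (- (a_u data / (\<tau> * \<bar>v $ 1\<bar>))) * data v \<le> h x v"
proof -
  have "AE v in lborel. (v $ 1 > 0 \<longrightarrow> h x v = damping \<tau> h v 0 x * fL v + 1 / (\<tau> * \<bar>v $ 1\<bar>) *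
             (LINT y:{0..x}|lborel. damping \<tau> h v y x * density (h y) * gaussian \<nu> (h y) v)) \<and>
        (v $ 1 < 0 \<longrightarrow> h x v = damping \<tau> h v x 1 * fR v + 1 / (\<tau> * \<bar>v $ 1\<bar>) *
             (LINT y:{x..1}|lborel. damping \<tau> h v x y * density (h y) * gaussian \<nu> (h y) v))"
    using h(1) x unfolding mild_solution_def by (fast elim!: eventually_mono)
  with g(3) AE_component_nonzero[of 1] show ?thesis
  proof eventually_elim
    case (elim v)
    have I: "0 \<le> 1 / (\<tau> * \<bar>v $ 1\<bar>) * (LINT y:{0..x}|lborel. damping \<tau> h v y x * density (h y) * gaussian \<nu> (h y) v)"
      "0 \<le> 1 / (\<tau> * \<bar>v $ 1\<bar>) * (LINT y:{x..1}|lborel. damping \<tau> h v x y * density (h y) * gaussian \<nu> (h y) v)"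
      unfolding set_lebesgue_integral_def using pos h_emission_nonneg x
      by (auto intro!: mult_nonneg_nonneg integral_nonneg_AE AE_I2 simp: indicator_def simp del: mult_eq_0_iff)
    show ?case
    proof (cases "0 < v $ 1")
      case True
      then have "data v = fL v" by (simp add: inflow_def)
      moreover have "exp (- (au / (\<tau> * \<bar>v $ 1\<bar>))) * data v \<le> damping \<tau> h v 0 x * data v"
        using elim(1) x by (intro mult_right_mono h_damping_ge) auto
      ultimately show ?thesis using elim True I(1) by (simp add: params(1))
    next
      case False
      then have "v $ 1 < 0" using elim(2) by simp
      then have "data v = fR v" by (simp add: inflow_def)
      moreover have "exp (- (au / (\<tau> * \<bar>v $ 1\<bar>))) * data v \<le> damping \<tau> h v x 1 * data v"
        using elim(1) x by (intro mult_right_mono h_damping_ge) auto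
      ultimately show ?thesis using elim \<open>v $ 1 < 0\<close> I(2) by (simp add: params(1))
    qed
  qed
qed

definition h_profile :: "real \<Rightarrow> moments" where
  "h_profile x = moment (h (clamp01 x))"

lemma h_profile: "h_profile \<in> profiles"
proof -
  have "moment (h (clamp01 x)) \<in> admissible \<nu> \<alpha> al au R" for x
    by (intro dominating_admissible h_bounds h_dominates clamp01_mem)
  moreover have "h_profile \<in> borel_measurable borel"
  proof -
    \<comment> \<open>Joint measurability is contained in the integrability clause of
      \<open>mild_solution\<close>; dividing by the weight, at points moved into the slab by
      \<open>clamp01\<close>, recovers \<open>h\<close> itself.\<close>
    let ?H = "\<lambda>p :: real \<times> vel. indicator ({0..1} \<times> UNIV) p *\<^sub>R (case p of (x, v) \<Rightarrow> (1 + (norm v)\<^sup>2) * h x v)"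
    have "?H \<in> borel_measurable (lborel :: (real \<times> vel) measure)"
      using h(1) unfolding mild_solution_def set_integrable_def by auto
    then have [measurable]: "?H \<in> borel_measurable (borel \<Otimes>\<^sub>M borel)"
      by (simp add: borel_prod)
    have [measurable]: "clamp01 \<in> borel_measurable borel" unfolding clamp01_def by measurable
    have "(\<lambda>p. ?H (clamp01 (fst p), snd p) / (1 + (norm (snd p))\<^sup>2)) \<in> borel_measurable (borel \<Otimes>\<^sub>M lborel)"
      by measurable
    moreover have "?H (clamp01 x, v) / (1 + (norm v)\<^sup>2) = h (clamp01 x) v" for x v
    proof -
      have "1 + (norm v)\<^sup>2 \<noteq> 0" by (smt (verit) zero_le_power2)
      then show ?thesis using clamp01_mem[of x] by simp
    qed
    ultimately have [measurable]: "(\<lambda>p. h (clamp01 (fst p)) (snd p)) \<in> borel_measurable (borel \<Otimes>\<^sub>M lborel)"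
      by simp
    have "(\<lambda>p. h (clamp01 (fst p)) (snd p) *\<^sub>R mvec (snd p)) \<in> borel_measurable (borel \<Otimes>\<^sub>M lborel)"
      by measurable
    then show ?thesis unfolding h_profile_def[abs_def] moment_def
      by (intro lborel.borel_measurable_lebesgue_integral) (simp add: case_prod_unfold)
  qed
  ultimately show ?thesis by (simp add: profiles_def h_profile_def)
qed

lemma h_eq_transport:
  assumes x: "x \<in> {0..1}"
  shows "AE v in lborel. h x v = transport \<nu> \<tau> data h_profile x v"
proof -
  have f: "h y \<in> L12 \<and> moment (h y) = h_profile y" if "y \<in> {0..1}" for y
    using h_bounds(1)[OF that] clamp01_id[OF that] by (simp add: h_profile_def)
  note iff = mild_formula_iff[OF h_profile f x, THEN iffD1]
  have "AE v in lborel.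
        (v $ 1 > 0 \<longrightarrow>
           set_integrable lborel {0..x}
             (\<lambda>y. damping \<tau> h v y x * density (h y) * gaussian \<nu> (h y) v) \<and>
           h x v = damping \<tau> h v 0 x * fL v + 1 / (\<tau> * \<bar>v $ 1\<bar>) *
             (LINT y:{0..x}|lborel. damping \<tau> h v y x * density (h y) * gaussian \<nu> (h y) v)) \<and>
        (v $ 1 < 0 \<longrightarrow>
           set_integrable lborel {x..1}
             (\<lambda>y. damping \<tau> h v x y * density (h y) * gaussian \<nu> (h y) v) \<and>
           h x v = damping \<tau> h v x 1 * fR v + 1 / (\<tau> * \<bar>v $ 1\<bar>) *
             (LINT y:{x..1}|lborel. damping \<tau> h v x y * density (h y) * gaussian \<nu> (h y) v))"
    using h(1) x unfolding mild_solution_def by blast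
  with AE_component_nonzero[of 1] show ?thesis by eventually_elim (rule iff)
qed

text \<open>The profile of \<open>h\<close> is a fixed point of \<open>update\<close>, hence the
  only one, and \<open>h\<close> is recovered from its profile by the transport formula.\<close>

lemma h_eq_solution:
  assumes x: "x \<in> {0..1}"
  shows "AE v in lborel. h x v = solution x v"
proof -
  have "update h_profile = h_profile"
  proof
    fix x
    let ?x = "clamp01 x"
    have "moment (h ?x) = moment (transport \<nu> \<tau> data h_profile ?x)"
      unfolding moment_def
    proof (rule integral_cong_AE)
      show "(\<lambda>v. h ?x v *\<^sub>R mvec v) \<in> borel_measurable lborel"
        "(\<lambda>v. transport \<nu> \<tau> data h_profile ?x v *\<^sub>R mvec v) \<in> borel_measurable lborel"
        using L12_integrable(7)[OF h_bounds(1)[OF clamp01_mem]]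
          L12_integrable(7)[OF transport_L12[OF h_profile clamp01_mem]] by auto
      show "AE v in lborel. h ?x v *\<^sub>R mvec v = transport \<nu> \<tau> data h_profile ?x v *\<^sub>R mvec v"
        using h_eq_transport[OF clamp01_mem[of x]] by eventually_elim simp
    qed
    then show "update h_profile x = h_profile x" by (simp add: update_def h_profile_def)
  qed
  then have "h_profile = solution_profile"
    using fixed_profile h_profile solution_profile by blast
  then show ?thesis using h_eq_transport[OF x] by (simp add: solution_def)
qed

end

end

section \<open>The threshold and its dependence on the data\<close>

text \<open>\<open>\<alpha>\<close>, \<open>R\<close>, \<open>e\<close> and \<open>C\<close> depend
  only on \<open>\<nu>\<close> and the given numbers, so the limit in \<open>\<tau>\<close> is taken
  with \<open>al\<close> frozen. The equations on the data come after \<open>K\<close> and merely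
  select those that realise these numbers.\<close>

lemma threshold_exists:
  fixes \<nu> au al as cu cs \<gamma> :: real
  assumes \<nu>: "- 1 / 2 < \<nu>" "\<nu> < 1" and pos: "0 < al" "al \<le> au" "0 < cu" "0 < \<gamma>"
  obtains K where "0 < K"
    "\<And>\<tau> fL fR. K < \<tau> \<Longrightarrow> inflow fL fR \<in> L12 \<Longrightarrow> (\<lambda>v. 1 / \<bar>v $ 1\<bar> * inflow fL fR v) \<in> L12 \<Longrightarrow>
      AE v in lborel. 0 \<le> inflow fL fR v \<Longrightarrow>
      \<gamma> < (LINT v:{v. 0 < v $ 1}|lborel. exp (- (a_u (inflow fL fR) / (\<tau> * \<bar>v $ 1\<bar>))) * fL v * \<bar>v $ 1\<bar>) *
       (LINT v:{v. v $ 1 < 0}|lborel. exp (- (a_u (inflow fL fR) / (\<tau> * \<bar>v $ 1\<bar>))) * fR v * \<bar>v $ 1\<bar>) \<Longrightarrow>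
      a_u (inflow fL fR) = au \<Longrightarrow> a_l \<tau> (inflow fL fR) = al \<Longrightarrow> a_s (inflow fL fR) = as \<Longrightarrow>
      c_u (inflow fL fR) = cu \<Longrightarrow> c_s (inflow fL fR) = cs \<Longrightarrow>
      \<exists>f. (mild_solution \<nu> \<tau> fL fR f \<and> (\<forall>x\<in>{0..1}. AE v in lborel. 0 \<le> f x v) \<and>
           satisfies_bounds \<tau> (inflow fL fR) \<gamma> f) \<and>
          (\<forall>h. mild_solution \<nu> \<tau> fL fR h \<and> (\<forall>x\<in>{0..1}. AE v in lborel. 0 \<le> h x v) \<and>
             satisfies_bounds \<tau> (inflow fL fR) \<gamma> h \<longrightarrow>
             (\<forall>x\<in>{0..1}. AE v in lborel. h x v = f x v))"
proof -
  define \<alpha> where "\<alpha> = min (1 - \<nu>) (1 + 2 * \<nu>) * (\<gamma> / (3 * au\<^sup>2))"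
  define R where "R = au + cu"
  have \<alpha>: "0 < \<alpha>" unfolding \<alpha>_def using \<nu> pos by (intro mult_pos_pos divide_pos_pos) auto
  have R: "0 \<le> R" using pos by (simp add: R_def)
  obtain e where e: "0 < e"
    "bounded_lipschitz (admissible \<nu> \<alpha> al au R) (\<lambda>v. (1 + norm v)\<^sup>2 * exp (- e * (norm v)\<^sup>2)) (mgaussian \<nu>)"
    by (rule bounded_lipschitz_mgaussian[OF pos(1) \<alpha> R])
  then obtain C where C: "0 \<le> C"
    "\<And>m v. m \<in> admissible \<nu> \<alpha> al au R \<Longrightarrow> \<bar>mgaussian \<nu> m v\<bar> \<le> C * weight e v"
    "\<And>m m' v. m \<in> admissible \<nu> \<alpha> al au R \<Longrightarrow> m' \<in> admissible \<nu> \<alpha> al au R \<Longrightarrow>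
      \<bar>mgaussian \<nu> m v - mgaussian \<nu> m' v\<bar> \<le> C * weight e v * dist m m'"
    unfolding bounded_lipschitz_def weight_def by blast
  let ?L = "C * (2 * au / al + 1 + au)"
  have S: "(slowing e (al / 2) \<longlongrightarrow> 0) at_top" using e(1) pos by (intro slowing_tendsto_0) auto
  \<comment> \<open>This limit is the contraction rate, with \<open>as + cs\<close> for the weighted
    integral of the data; the two that follow keep the gain below half of \<open>au\<close> and of
    \<open>cu\<close>.\<close>
  have "((\<lambda>\<tau>. (as + cs) / \<tau> + ?L * slowing e (al / 2) \<tau>) \<longlongrightarrow> 0 + ?L * 0) at_top"
    by (intro tendsto_add tendsto_mult S tendsto_const real_tendsto_divide_at_top[OF tendsto_const filterlim_ident])
  then have "\<forall>\<^sub>F \<tau> in at_top. (as + cs) / \<tau> + ?L * slowing e (al / 2) \<tau> < 1"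
    by (rule order_tendstoD) simp
  moreover have T: "((\<lambda>\<tau>. au * C * slowing e (al / 2) \<tau>) \<longlongrightarrow> au * C * 0) at_top"
    by (intro tendsto_mult S tendsto_const)
  have "\<forall>\<^sub>F \<tau> in at_top. au * C * slowing e (al / 2) \<tau> < au / 2"
    using T by (rule order_tendstoD) (use pos in simp)
  moreover have "\<forall>\<^sub>F \<tau> in at_top. au * C * slowing e (al / 2) \<tau> < cu / 2"
    using T by (rule order_tendstoD) (use pos in simp)
  ultimately have "\<forall>\<^sub>F \<tau> in at_top. (as + cs) / \<tau> + ?L * slowing e (al / 2) \<tau> < 1 \<and>
     au * C * slowing e (al / 2) \<tau> < au / 2 \<and> au * C * slowing e (al / 2) \<tau> < cu / 2"
    by eventually_elim auto
  then obtain K where K: "\<And>\<tau>. K \<le> \<tau> \<Longrightarrow> (as + cs) / \<tau> + ?L * slowing e (al / 2) \<tau> < 1 \<and>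
     au * C * slowing e (al / 2) \<tau> < au / 2 \<and> au * C * slowing e (al / 2) \<tau> < cu / 2"
    unfolding eventually_at_top_linorder by blast
  note const = \<nu> pos
  show ?thesis
  \<comment> \<open>The maximum with 1 makes the threshold, and with it \<open>\<tau>\<close>,
    positive.\<close>
  proof (rule that[of "max 1 K"])
    fix \<tau> :: real and fL fR :: "vel \<Rightarrow> real"
    let ?g = "inflow fL fR"
    assume \<tau>: "max 1 K < \<tau>" and g: "?g \<in> L12" "(\<lambda>v. 1 / \<bar>v $ 1\<bar> * ?g v) \<in> L12" "AE v in lborel. 0 \<le> ?g v"
      and flux: "\<gamma> < (LINT v:{v. 0 < v $ 1}|lborel. exp (- (a_u ?g / (\<tau> * \<bar>v $ 1\<bar>))) * fL v * \<bar>v $ 1\<bar>) *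
       (LINT v:{v. v $ 1 < 0}|lborel. exp (- (a_u ?g / (\<tau> * \<bar>v $ 1\<bar>))) * fR v * \<bar>v $ 1\<bar>)"
      and params: "a_u ?g = au" "a_l \<tau> ?g = al" "a_s ?g = as" "c_u ?g = cu" "c_s ?g = cs"
    interpret slab \<nu> \<tau> al au R \<alpha> e C ?g
      using \<tau> pos \<alpha> R e(1) C g by unfold_locales auto
    \<comment> \<open>Splitting the weight identifies the integral in
      \<open>contraction_rate\<close> with the sum of \<open>a_s\<close> and
      \<open>c_s\<close>.\<close>
    have "(LINT v|lborel. (1 + (norm v)\<^sup>2) * (1 / \<bar>v $ 1\<bar> * ?g v))
        = (LINT v|lborel. 1 / \<bar>v $ 1\<bar> * ?g v + 1 / \<bar>v $ 1\<bar> * ?g v * (norm v)\<^sup>2)"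
      by (intro Bochner_Integration.integral_cong) (auto simp: algebra_simps add_divide_distrib)
    also have "\<dots> = as + cs"
      using L12_integrable(1,2)[OF g(2)] params(3,5)
      by (simp only: Bochner_Integration.integral_add a_s_def c_s_def)
    finally have rate: "contraction_rate = (as + cs) / \<tau> + ?L * slowing e (al / 2) \<tau>"
      by (simp add: contraction_rate_def lip_def)
    have "slab_problem \<nu> \<tau> al au R \<alpha> e C fL fR cu \<gamma>"
    proof (unfold_locales)
      show "contraction_rate < 1" using K[of \<tau>] \<tau> rate by simp
      show "au * C * slowing e (al / 2) \<tau> \<le> au / 2" "au * C * slowing e (al / 2) \<tau> \<le> cu / 2"
        using K[of \<tau>] \<tau> by auto
    qed (use const params flux in \<open>auto simp: R_def \<alpha>_def\<close>)
    then interpret slab_problem \<nu> \<tau> al au R \<alpha> e C fL fR cu \<gamma> .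
    show "\<exists>f. (mild_solution \<nu> \<tau> fL fR f \<and> (\<forall>x\<in>{0..1}. AE v in lborel. 0 \<le> f x v) \<and>
           satisfies_bounds \<tau> ?g \<gamma> f) \<and>
          (\<forall>h. mild_solution \<nu> \<tau> fL fR h \<and> (\<forall>x\<in>{0..1}. AE v in lborel. 0 \<le> h x v) \<and>
             satisfies_bounds \<tau> ?g \<gamma> h \<longrightarrow>
             (\<forall>x\<in>{0..1}. AE v in lborel. h x v = f x v))"
      using mild_solution_solution solution_nonneg solution_bounds h_eq_solution
      by (intro exI[of _ solution]) blast
  qed simp
qed

text \<open>Guarantees that the constants of nonzero inflow data meet the sign conditions of
  \<open>threshold_exists\<close>. Test functions are asked to be positive only off the origin, a
  null set, because the squared norm vanishes there.\<close>

lemma inflow_constants_pos: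
  assumes "0 < \<tau>" "g \<in> L12" "AE v in lborel. 0 \<le> g v" "\<not> (AE v in lborel. g v = 0)"
  shows "0 < a_l \<tau> g" "a_l \<tau> g \<le> a_u g" "0 < c_u g"
proof -
  have pos: "0 < (LINT v|lborel. g v * p v)"
    if "integrable lborel (\<lambda>v. g v * p v)" "\<And>v. v \<noteq> 0 \<Longrightarrow> 0 < p v" for p :: "vel \<Rightarrow> real"
  proof -
    have nz: "AE v in lborel. v \<noteq> (0 :: vel)" by (rule AE_lborel_singleton)
    have nn: "AE v in lborel. 0 \<le> g v * p v"
      using assms(3) nz
    proof eventually_elim
      case (elim v)
      then show ?case using that(2)[of v] by simp
    qed
    have "(LINT v|lborel. g v * p v) \<noteq> 0"
    proof
      assume "(LINT v|lborel. g v * p v) = 0"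
      then have "AE v in lborel. g v * p v = 0"
        using integral_nonneg_eq_0_iff_AE[OF that(1) nn] by simp
      then have "AE v in lborel. g v = 0"
        using nz
      proof eventually_elim
        case (elim v)
        then show ?case using that(2)[of v] by auto
      qed
      then show False using assms(4) by simp
    qed
    then show ?thesis using integral_nonneg_AE[OF nn] by linarith
  qed
  have "0 \<le> (LINT v|lborel. g v)" using assms(3) by (rule integral_nonneg_AE)
  then have au: "0 \<le> a_u g" "(LINT v|lborel. g v) \<le> a_u g" by (simp_all add: a_u_def)
  have E: "exp (- (a_u g / (\<tau> * \<bar>v $ 1\<bar>))) \<le> 1" for v :: vel using au assms(1) by simp
  have int: "integrable lborel (\<lambda>v. g v * exp (- (a_u g / (\<tau> * \<bar>v $ 1\<bar>))))"
  proof (rule L12_integrable_scaleR[OF assms(2), of "\<lambda>v. exp (- (a_u g / (\<tau> * \<bar>v $ 1\<bar>)))" 1, unfolded real_scaleR_def])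
    show "norm (exp (- (a_u g / (\<tau> * \<bar>v $ 1\<bar>)))) \<le> 1 * (1 + (norm v)\<^sup>2)" for v :: vel
      using order_trans[OF E[of v], of "1 + (norm v)\<^sup>2"] by simp
  qed measurable
  have a_l: "a_l \<tau> g = (LINT v|lborel. g v * exp (- (a_u g / (\<tau> * \<bar>v $ 1\<bar>))))"
    by (simp add: a_l_def mult.commute)
  show "0 < a_l \<tau> g" unfolding a_l using int by (rule pos) simp
  have "a_l \<tau> g \<le> (LINT v|lborel. g v)"
    unfolding a_l
  proof (intro integral_mono_AE int L12_integrable(1) assms(2))
    show "AE v in lborel. g v * exp (- (a_u g / (\<tau> * \<bar>v $ 1\<bar>))) \<le> g v"
      using assms(3)
    proof eventually_elim
      case (elim v)
      then show ?case using mult_left_mono[OF E[of v]] by simp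
    qed
  qed
  then show "a_l \<tau> g \<le> a_u g" using au by simp
  show "0 < c_u g" unfolding c_u_def using pos[OF L12_integrable(2)[OF assms(2)]] by simp
qed

theorem theorem2p2:
  fixes \<nu> :: real
  assumes "- 1 / 2 < \<nu>" and "\<nu> < 1"
  shows "\<exists>K :: real \<Rightarrow> real \<Rightarrow> real \<Rightarrow> real \<Rightarrow> real \<Rightarrow> real \<Rightarrow> real \<Rightarrow> real.
    (\<forall>au al as cu cl cs \<gamma>. 0 < K au al as cu cl cs \<gamma>) \<and>
    (\<forall>(\<kappa>::real) (\<tau>::real) (fL :: real ^ 3 \<Rightarrow> real) (fR :: real ^ 3 \<Rightarrow> real) (fLR :: real ^ 3 \<Rightarrow> real) (\<gamma>::real).
       0 < \<kappa> \<longrightarrow> \<tau> = \<kappa> * (1 - \<nu>) \<longrightarrow> fLR = inflow fL fR \<longrightarrow>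
       (AE v in lborel. 0 \<le> fLR v) \<longrightarrow>
       \<not> (AE v in lborel. fLR v = 0) \<longrightarrow>
       fLR \<in> L12 \<longrightarrow> (\<lambda>v. 1 / \<bar>v $ 1\<bar> * fLR v) \<in> L12 \<longrightarrow>
       (\<forall>i\<in>{2, 3}. (AE s in lborel. 0 < s \<longrightarrow> slice_moment fL i s = 0) \<and>
                   (AE s in lborel. s < 0 \<longrightarrow> slice_moment fR i s = 0)) \<longrightarrow>
       0 < \<gamma> \<longrightarrow>
       (LINT v:{v. 0 < v $ 1}|lborel. exp (- (a_u fLR / (\<tau> * \<bar>v $ 1\<bar>))) * fL v * \<bar>v $ 1\<bar>) *
       (LINT v:{v. v $ 1 < 0}|lborel. exp (- (a_u fLR / (\<tau> * \<bar>v $ 1\<bar>))) * fR v * \<bar>v $ 1\<bar>) > \<gamma> \<longrightarrow>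
       \<tau> > K (a_u fLR) (a_l \<tau> fLR) (a_s fLR) (c_u fLR) (c_l \<tau> fLR) (c_s fLR) \<gamma> \<longrightarrow>
       (\<exists>f :: real \<Rightarrow> real ^ 3 \<Rightarrow> real.
          (mild_solution \<nu> \<tau> fL fR f \<and> (\<forall>x\<in>{0..1}. AE v in lborel. 0 \<le> f x v) \<and>
           satisfies_bounds \<tau> fLR \<gamma> f) \<and>
          (\<forall>h :: real \<Rightarrow> real ^ 3 \<Rightarrow> real.
             mild_solution \<nu> \<tau> fL fR h \<and> (\<forall>x\<in>{0..1}. AE v in lborel. 0 \<le> h x v) \<and>
             satisfies_bounds \<tau> fLR \<gamma> h \<longrightarrow>
             (\<forall>x\<in>{0..1}. AE v in lborel. h x v = f x v))))"
proof -
  \<comment> \<open>\<open>works\<close> gathers what is demanded of a threshold for one tuple of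
    values, so that the dependence of \<open>K\<close> on the quantities is obtained by the axiom of
    choice.\<close>
  define works :: "real \<Rightarrow> real \<times> real \<times> real \<times> real \<times> real \<times> real \<Rightarrow> bool" where
    "works = (\<lambda>K (au, al, as, cu, cs, \<gamma>). 0 < K \<and> (\<forall>\<tau> fL fR. K < \<tau> \<longrightarrow> inflow fL fR \<in> L12 \<longrightarrow>
      (\<lambda>v. 1 / \<bar>v $ 1\<bar> * inflow fL fR v) \<in> L12 \<longrightarrow> (AE v in lborel. 0 \<le> inflow fL fR v) \<longrightarrow>
      \<not> (AE v in lborel. inflow fL fR v = 0) \<longrightarrow> 0 < \<gamma> \<longrightarrow>
      \<gamma> < (LINT v:{v. 0 < v $ 1}|lborel. exp (- (a_u (inflow fL fR) / (\<tau> * \<bar>v $ 1\<bar>))) * fL v * \<bar>v $ 1\<bar>) *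
       (LINT v:{v. v $ 1 < 0}|lborel. exp (- (a_u (inflow fL fR) / (\<tau> * \<bar>v $ 1\<bar>))) * fR v * \<bar>v $ 1\<bar>) \<longrightarrow>
      a_u (inflow fL fR) = au \<longrightarrow> a_l \<tau> (inflow fL fR) = al \<longrightarrow> a_s (inflow fL fR) = as \<longrightarrow>
      c_u (inflow fL fR) = cu \<longrightarrow> c_s (inflow fL fR) = cs \<longrightarrow>
      (\<exists>f. (mild_solution \<nu> \<tau> fL fR f \<and> (\<forall>x\<in>{0..1}. AE v in lborel. 0 \<le> f x v) \<and>
           satisfies_bounds \<tau> (inflow fL fR) \<gamma> f) \<and>
          (\<forall>h. mild_solution \<nu> \<tau> fL fR h \<and> (\<forall>x\<in>{0..1}. AE v in lborel. 0 \<le> h x v) \<and>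
             satisfies_bounds \<tau> (inflow fL fR) \<gamma> h \<longrightarrow>
             (\<forall>x\<in>{0..1}. AE v in lborel. h x v = f x v)))))"
  have "\<exists>K. works K (au, al, as, cu, cs, \<gamma>)" for au al as cu cs \<gamma>
  proof (cases "0 < al \<and> al \<le> au \<and> 0 < cu \<and> 0 < \<gamma>")
    case True
    then have p: "0 < al" "al \<le> au" "0 < cu" "0 < \<gamma>" by auto
    show ?thesis
      by (rule threshold_exists[OF assms p, of as cs]) (auto simp: works_def)
  next
    case False
    \<comment> \<open>For such values the claim is vacuous, by \<open>inflow_constants_pos\<close>
      or the premise \<open>0 < \<gamma>\<close>; the threshold 1 supplies the positivity of
      \<open>\<tau>\<close> on which that lemma relies.\<close>
    have "works 1 (au, al, as, cu, cs, \<gamma>)"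
      unfolding works_def using False inflow_constants_pos by fastforce
    then show ?thesis by blast
  qed
  then have "\<exists>K. \<forall>p. works (K p) p" by (intro choice) auto
  then obtain K where K: "\<And>p. works (K p) p" by blast
  show ?thesis
  proof (intro exI[of _ "\<lambda>au al as cu cl cs \<gamma>. K (au, al, as, cu, cs, \<gamma>)"] conjI allI impI)
    show "0 < K (au, al, as, cu, cs, \<gamma>)" for au al as cu cs \<gamma>
      using K[of "(au, al, as, cu, cs, \<gamma>)"] by (simp add: works_def)
  next
    fix \<kappa> \<tau> :: real and fL fR fLR :: "vel \<Rightarrow> real" and \<gamma> :: real
    assume fLR: "fLR = inflow fL fR" and "0 < \<gamma>" and "AE v in lborel. 0 \<le> fLR v" "\<not> (AE v in lborel. fLR v = 0)"
      and "fLR \<in> L12" "(\<lambda>v. 1 / \<bar>v $ 1\<bar> * fLR v) \<in> L12"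
      and "\<gamma> < (LINT v:{v. 0 < v $ 1}|lborel. exp (- (a_u fLR / (\<tau> * \<bar>v $ 1\<bar>))) * fL v * \<bar>v $ 1\<bar>) *
       (LINT v:{v. v $ 1 < 0}|lborel. exp (- (a_u fLR / (\<tau> * \<bar>v $ 1\<bar>))) * fR v * \<bar>v $ 1\<bar>)"
      and "K (a_u fLR, a_l \<tau> fLR, a_s fLR, c_u fLR, c_s fLR, \<gamma>) < \<tau>"
    with K[of "(a_u fLR, a_l \<tau> fLR, a_s fLR, c_u fLR, c_s fLR, \<gamma>)"]
    show "\<exists>f. (mild_solution \<nu> \<tau> fL fR f \<and> (\<forall>x\<in>{0..1}. AE v in lborel. 0 \<le> f x v) \<and>
           satisfies_bounds \<tau> fLR \<gamma> f) \<and>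
          (\<forall>h. mild_solution \<nu> \<tau> fL fR h \<and> (\<forall>x\<in>{0..1}. AE v in lborel. 0 \<le> h x v) \<and>
             satisfies_bounds \<tau> fLR \<gamma> h \<longrightarrow>
             (\<forall>x\<in>{0..1}. AE v in lborel. h x v = f x v))"
      unfolding works_def by simp
  qed
qed

end
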